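(* Fix a time step $n\ge 1$. Assume that for each $\ell\in\{1,2\}$: (i) $k_\ell:[0,1]\to[m_{k_\ell},M_{k_\ell}]$ is Lipschitz continuous with $0<m_{k_\ell}\le M_{k_\ell}<\infty$; consequently $k_\ell^{-1}:=1/k_\ell:[0,1]\to[m_{\bar k_\ell},M_{\bar k_\ell}]$ is Lipschitz continuous with $0<m_{\bar k_\ell}\le M_{\bar k_\ell}<\infty$ and Lipschitz constant $L_{\bar k_\ell}$; (ii) $S_\ell:\mathbb{R}\to[0,1]$ is monotonically increasing and Lipschitz continuous with Lipschitz constant $L_{S_\ell}$; (iii) the solution $(\mathbf{q}^n,p^n,g^n)\in Q\times P\times G$ of the limit problem satisfies $\lVert \mathbf{q}^n_\ell\rVert_{L^\infty(\Omega_\ell)}\le M_{\mathbf{q}_\ell}<\infty$; (iv) $L_\ell>\tfrac12 L_{S_\ell}$, $\alpha>0$, and $\tau<\Bigl(\frac{1}{L_{S_\ell}}-\frac{1}{2L_\ell}\Bigr)\frac{2m_{\bar k_\ell}}{L_{\bar k_\ell}^2M_{\mathbf{q}_\ell}^2}$. Let $(\mathbf{q}^i,p^i,g^i)_{i\ge 1}$ be generated by the iterative scheme from arbitrary $(\mathbf{q}^0,p^0,g^0)\in Q\times P\times G$. Then the pressure $p^i$ converges strongly to $p^n$ in $L^2(\Omega)$: $$\lim_{i\to\infty}\lVert p^n-p^i\rVert=0.$$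
   Context: Geometry. $\Omega\subset\mathbb{R}^d$, $d\in\{2,3\}$, is an open bounded domain with Lipschitz boundary partitioned into a Dirichlet part $\partial\Omega_D$ and a Neumann part $\partial\Omega_N$ ($\partial\Omega=\overline{\partial\Omega}_D\cup\overline{\partial\Omega}_N$, $\partial\Omega_D\cap\partial\Omega_N=\emptyset$). $\Omega$ is partitioned into two non-overlapping Lipschitz subdomains, $\overline\Omega=\overline\Omega_1\cup\overline\Omega_2$, $\Omega_1\cap\Omega_2=\emptyset$, with interface $\Gamma:=\partial\Omega_1\cap\partial\Omega_2$, a $(d-1)$-dimensional manifold. Each subdomain borders part of the Dirichlet boundary: $\partial\Omega_\ell\cap\partial\Omega_D\neq\emptyset$ (understood as having positive $(d-1)$-dimensional measure), $\ell\in\{1,2\}$. $\mathbf{n}_\ell$ is the outward unit normal on $\partial\Omega_\ell$, so $\mathbf{n}_1=-\mathbf{n}_2$ on $\Gamma$. Spaces. $\langle\cdot,\cdot\rangle_X$ is the $L^2(X)$ inner product. $$Q_\ell:=\{\tilde{\mathbf{q}}_\ell\in H(\mathrm{div};\Omega_\ell)\mid (\tilde{\mathbf{q}}_\ell\cdot\mathbf{n}_\ell)|_\Gamma\in L^2(\Gamma),\ (\tilde{\mathbf{q}}_\ell\cdot\mathbf{n}_\ell)|_{\partial\Omega_N\cap\partial\Omega_\ell}=0\},\qquad P_\ell:=L^2(\Omega_\ell),$$ $Q:=Q_1\times Q_2$, $P:=P_1\times P_2$, $G:=[L^2(\Gamma)]^2$. A quantity without subscript $\ell$ denotes the pair of its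 subdomain restrictions, and $\lVert u\rVert^2:=\sum_{\ell=1}^2\lVert u_\ell\rVert^2_{L^2(\Omega_\ell)}$. Data. $\tau>0$ (time step), $\alpha>0$ (Robin parameter), $L_\ell>0$ (stabilization parameters), $\mathcal{F}_\ell\in L^2(\Omega_\ell)$, $\nabla\eta_\ell\in[L^2(\Omega_\ell)]^d$, and $S_\ell^{n-1}:=S_\ell(p_\ell^{n-1})$ with $p^{n-1}\in P$ given (the previous time step). $k_\ell$ is the permeability and $S_\ell$ the saturation function. The Lipschitz constants and bounds appearing in denominators are taken positive. Limit problem. Find $\mathbf{q}^n\in Q$, $p^n\in P$, $g^n\in G$ such that, with $S_\ell^n:=S_\ell(p_\ell^n)$, $\bar k_\ell^n:=k_\ell^{-1}(S_\ell(p_\ell^n))$, for all $\tilde{\mathbf{q}}\in Q$, $\tilde p\in P$, $\tilde g\in G$ and $\ell,j\in\{1,2\}$, $\ell\ne j$, $$\langle\bar k_\ell^n\mathbf{q}_\ell^n,\tilde{\mathbf{q}}_\ell\rangle_{\Omega_\ell}-\langle p_\ell^n,\nabla\cdot\tilde{\mathbf{q}}_\ell\rangle_{\Omega_\ell}+\alpha\langle\mathbf{q}_\ell^n\cdot\mathbf{n}_\ell,\tilde{\mathbf{q}}_\ell\cdot\mathbf{n}_\ell\rangle_\Gamma=\langle\nabla\eta_\ell,\tilde{\mathbf{q}}_\ell\rangle_{\Omega_\ell}-\langle g_\ell^n,\tilde{\mathbf{q}}_\ell\cdot\mathbf{n}_\ell\rangle_\Gamma,$$ $$\langle S_\ell^n,\tilde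 p_\ell\rangle_{\Omega_\ell}+\tau\langle\nabla\cdot\mathbf{q}_\ell^n,\tilde p_\ell\rangle_{\Omega_\ell}=\tau\langle\mathcal{F}_\ell,\tilde p_\ell\rangle_{\Omega_\ell}+\langle S_\ell^{n-1},\tilde p_\ell\rangle_{\Omega_\ell},$$ $$\langle g_\ell^n,\tilde g_\ell\rangle_\Gamma=\langle 2\alpha\,\mathbf{q}_j^n\cdot\mathbf{n}_j+g_j^n,\tilde g_\ell\rangle_\Gamma.$$ This problem is taken to have a (unique) solution. Iterative scheme (the index $n$ is dropped on iterates). For $i\ge1$, given $(\mathbf{q}^{i-1},p^{i-1},g^{i-1})\in Q\times P\times G$, set $S_\ell^{i-1}:=S_\ell(p_\ell^{i-1})$, $\bar k_\ell^{i-1}:=k_\ell^{-1}(S_\ell(p_\ell^{i-1}))$; compute $g^i\in G$ from $$\langle g_\ell^i,\tilde g_\ell\rangle_\Gamma=\langle2\alpha\,\mathbf{q}_j^{i-1}\cdot\mathbf{n}_j+g_j^{i-1},\tilde g_\ell\rangle_\Gamma\quad(\ell\neq j)\ \text{ for all }\tilde g\in G,$$ and then find $\mathbf{q}^i\in Q$, $p^i\in P$ such that for all $\tilde{\mathbf{q}}\in Q$, $\tilde p\in P$, $\ell\in\{1,2\}$, $$\langle\bar k_\ell^{i-1}\mathbf{q}_\ell^i,\tilde{\mathbf{q}}_\ell\rangle_{\Omega_\ell}-\langle p_\ell^i,\nabla\cdot\tilde{\mathbf{q}}_\ell\rangle_{\Omega_\ell}+\alpha\langle\mathbf{q}_\ell^i\cdot\mathbf{n}_\ell,\tilde{\mathbf{q}}_\ell\cdot\mathbf{n}_\ell\rangle_\Gamma=\langle\nabla\eta_\ell,\tilde{\mathbf{q}}_\ell\rangle_{\Omega_\ell}-\langle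 g_\ell^i,\tilde{\mathbf{q}}_\ell\cdot\mathbf{n}_\ell\rangle_\Gamma,$$ $$L_\ell\langle p_\ell^i,\tilde p_\ell\rangle_{\Omega_\ell}+\tau\langle\nabla\cdot\mathbf{q}_\ell^i,\tilde p_\ell\rangle_{\Omega_\ell}=\tau\langle\mathcal{F}_\ell,\tilde p_\ell\rangle_{\Omega_\ell}-\langle S_\ell^{i-1}-S_\ell^{n-1},\tilde p_\ell\rangle_{\Omega_\ell}+L_\ell\langle p_\ell^{i-1},\tilde p_\ell\rangle_{\Omega_\ell}.$$ Each step of the scheme is well-posed. *)

theory Defs
  imports "HOL-Analysis.Analysis" "HOL-Probability.Essential_Supremum"
begin

section \<open>Hausdorff measure\<close>

text \<open>The surface measure on boundaries and interfaces is the Hausdorff measure of dimension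
  one less than the space, normalised so that it agrees with Lebesgue measure on flat pieces.
  Since the diameter of an unbounded set is unspecified, only bounded covering sets are admitted.
  The lemmas below establish that Borel sets are Caratheodory measurable, i.e. that
  measure_of does not collapse to the zero measure.\<close>

definition hausdorff_gauge :: "nat \<Rightarrow> 'a::metric_space set \<Rightarrow> real" where
  "hausdorff_gauge m U =
     (if U = {} then 0 else unit_ball_vol (real m) / 2 ^ m * diameter U ^ m)"

definition hausdorff_pre :: "nat \<Rightarrow> real \<Rightarrow> 'a::metric_space set \<Rightarrow> ennreal" where
  "hausdorff_pre m \<delta> A =
     (INF U\<in>{U :: nat \<Rightarrow> 'a set. A \<subseteq> (\<Union>i. U i) \<and> (\<forall>i. bounded (U i) \<and> diameter (U i) \<le> \<delta>)}.
        \<Sum>i. ennreal (hausdorff_gauge m (U i)))"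

definition hausdorff_outer :: "nat \<Rightarrow> 'a::metric_space set \<Rightarrow> ennreal" where
  "hausdorff_outer m A = (SUP \<delta>\<in>{0<..}. hausdorff_pre m \<delta> A)"

definition hausdorff_measure :: "nat \<Rightarrow> 'a::metric_space measure" where
  "hausdorff_measure m = measure_of UNIV (sets borel) (hausdorff_outer m)"

lemma hausdorff_pre_mono: "A \<subseteq> B \<Longrightarrow> hausdorff_pre m \<delta> A \<le> hausdorff_pre m \<delta> B"
  unfolding hausdorff_pre_def by (rule INF_superset_mono) auto

lemma hausdorff_pre_antimono: "\<delta> \<le> \<epsilon> \<Longrightarrow> hausdorff_pre m \<epsilon> A \<le> hausdorff_pre m \<delta> A"
  unfolding hausdorff_pre_def by (rule INF_superset_mono) (auto intro: order_trans)

lemma hausdorff_pre_le: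
  "A \<subseteq> (\<Union>i. U i) \<Longrightarrow> (\<And>i. bounded (U i) \<and> diameter (U i) \<le> \<delta>) \<Longrightarrow>
    hausdorff_pre m \<delta> A \<le> (\<Sum>i. ennreal (hausdorff_gauge m (U i)))"
  unfolding hausdorff_pre_def by (rule INF_lower) auto

lemma hausdorff_outer_mono: "A \<subseteq> B \<Longrightarrow> hausdorff_outer m A \<le> hausdorff_outer m B"
  unfolding hausdorff_outer_def by (intro SUP_mono) (auto intro: hausdorff_pre_mono)

lemma hausdorff_pre_le_outer: "0 < \<delta> \<Longrightarrow> hausdorff_pre m \<delta> A \<le> hausdorff_outer m A"
  unfolding hausdorff_outer_def by (rule SUP_upper) simp

lemma hausdorff_outer_empty: "hausdorff_outer m {} = 0"
proof -
  have "hausdorff_pre m \<delta> {} = 0" if "0 < \<delta>" for \<delta>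
    using hausdorff_pre_le[of "{}" "\<lambda>_. {}" \<delta> m] that by (simp add: hausdorff_gauge_def)
  then show ?thesis unfolding hausdorff_outer_def by (intro antisym SUP_least) auto
qed

lemma hausdorff_pre_UN:
  assumes "0 < \<delta>"
  shows "hausdorff_pre m \<delta> (\<Union>n. A n) \<le> (\<Sum>n::nat. hausdorff_pre m \<delta> (A n))"
proof (rule ennreal_le_epsilon)
  fix e :: real assume e: "0 < e" and fin: "(\<Sum>n. hausdorff_pre m \<delta> (A n)) < top"
  have "\<exists>U. A n \<subseteq> (\<Union>i. U i) \<and> (\<forall>i. bounded (U i) \<and> diameter (U i) \<le> \<delta>) \<and>
      (\<Sum>i. ennreal (hausdorff_gauge m (U i))) \<le> hausdorff_pre m \<delta> (A n) + ennreal (e * (1/2)^Suc n)" for n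
  proof -
    have "hausdorff_pre m \<delta> (A n) \<noteq> top"
      using fin ennreal_suminf_lessD[OF fin] by (auto simp: less_top)
    then have "hausdorff_pre m \<delta> (A n) < hausdorff_pre m \<delta> (A n) + ennreal (e * (1/2)^Suc n)"
      using e by (cases "hausdorff_pre m \<delta> (A n)") (auto simp flip: ennreal_plus simp: ennreal_less_iff)
    then show ?thesis
      by (subst (asm) (1) hausdorff_pre_def) (auto simp: INF_less_iff intro: less_imp_le)
  qed
  then obtain U where U: "\<And>n. A n \<subseteq> (\<Union>i. U n i)" "\<And>n i. bounded (U n i) \<and> diameter (U n i) \<le> \<delta>"
    "\<And>n. (\<Sum>i. ennreal (hausdorff_gauge m (U n i))) \<le> hausdorff_pre m \<delta> (A n) + ennreal (e * (1/2)^Suc n)"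
    by metis
  define V where "V k = (case prod_decode k of (n, i) \<Rightarrow> U n i)" for k
  have "hausdorff_pre m \<delta> (\<Union>n. A n) \<le> (\<Sum>k. ennreal (hausdorff_gauge m (V k)))"
  proof (rule hausdorff_pre_le)
    show "(\<Union>n. A n) \<subseteq> (\<Union>k. V k)"
    proof
      fix x assume "x \<in> (\<Union>n. A n)"
      then obtain n i where "x \<in> U n i" using U(1) by blast
      then have "x \<in> V (prod_encode (n, i))" by (simp add: V_def)
      then show "x \<in> (\<Union>k. V k)" by blast
    qed
    show "bounded (V k) \<and> diameter (V k) \<le> \<delta>" for k
      using U(2) by (auto simp: V_def split: prod.split)
  qed
  also have "\<dots> = (\<Sum>n. \<Sum>i. ennreal (hausdorff_gauge m (U n i)))"
  proof -
    have "(\<Sum>k. (\<lambda>(n, i). ennreal (hausdorff_gauge m (U n i))) (prod_decode k)) =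
        (\<Sum>n. \<Sum>i. ennreal (hausdorff_gauge m (U n i)))"
      by (rule suminf_ennreal_2dimen) simp
    then show ?thesis by (simp add: V_def split_beta)
  qed
  also have "\<dots> \<le> (\<Sum>n. hausdorff_pre m \<delta> (A n) + ennreal (e * (1/2)^Suc n))"
    by (intro suminf_le U) auto
  also have "\<dots> = (\<Sum>n. hausdorff_pre m \<delta> (A n)) + (\<Sum>n. ennreal (e * (1/2)^Suc n))"
    by (intro suminf_add[symmetric]) auto
  also have "(\<Sum>n. ennreal (e * (1/2)^Suc n)) = ennreal e"
  proof (rule suminf_ennreal_eq)
    show "(\<lambda>n. e * (1/2)^Suc n) sums e"
      using sums_mult[OF power_half_series, of e] by (simp only: mult_1_right)
  qed (use e in simp)
  finally show "hausdorff_pre m \<delta> (\<Union>n. A n) \<le> (\<Sum>n. hausdorff_pre m \<delta> (A n)) + ennreal e" .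
qed

lemma hausdorff_outer_UN: "hausdorff_outer m (\<Union>n. A n) \<le> (\<Sum>n::nat. hausdorff_outer m (A n))"
  unfolding hausdorff_outer_def[of m "\<Union>n. A n"]
proof (rule SUP_least)
  fix \<delta> :: real assume "\<delta> \<in> {0<..}"
  then have "0 < \<delta>" by simp
  have "hausdorff_pre m \<delta> (\<Union>n. A n) \<le> (\<Sum>n. hausdorff_pre m \<delta> (A n))"
    using \<open>0 < \<delta>\<close> by (rule hausdorff_pre_UN)
  also have "\<dots> \<le> (\<Sum>n. hausdorff_outer m (A n))"
    by (intro suminf_le hausdorff_pre_le_outer \<open>0 < \<delta>\<close>) auto
  finally show "hausdorff_pre m \<delta> (\<Union>n. A n) \<le> (\<Sum>n. hausdorff_outer m (A n))" .
qed

lemma hausdorff_outer_measure_space: "outer_measure_space UNIV (hausdorff_outer m)"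
  unfolding outer_measure_space_def positive_def increasing_def countably_subadditive_def
  by (auto intro: hausdorff_outer_mono hausdorff_outer_UN simp: hausdorff_outer_empty)

lemma hausdorff_outer_Un: "hausdorff_outer m (A \<union> B) \<le> hausdorff_outer m A + hausdorff_outer m B"
proof -
  have "subadditive UNIV (hausdorff_outer m :: 'a set \<Rightarrow> _)"
    using hausdorff_outer_measure_space[of m] ring_of_sets.countably_subadditive_subadditive[of UNIV UNIV "hausdorff_outer m"]
    unfolding outer_measure_space_def
    by (metis Pow_UNIV algebra_Pow algebra_def)
  have "hausdorff_outer m (A \<union> (B - A)) \<le> hausdorff_outer m A + hausdorff_outer m (B - A)"
    by (rule subadditiveD[OF \<open>subadditive UNIV (hausdorff_outer m)\<close>]) auto
  also have "\<dots> \<le> hausdorff_outer m A + hausdorff_outer m B"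
    by (intro add_left_mono hausdorff_outer_mono) auto
  finally show ?thesis by simp
qed

lemma hausdorff_outer_separated:
  assumes d: "0 < d" and sep: "\<And>a b. a \<in> A \<Longrightarrow> b \<in> B \<Longrightarrow> d \<le> dist a b"
  shows "hausdorff_outer m A + hausdorff_outer m B \<le> hausdorff_outer m (A \<union> B)"
proof -
  have key: "hausdorff_pre m \<delta> A + hausdorff_pre m \<delta> B \<le> hausdorff_pre m \<delta> (A \<union> B)"
    if \<delta>: "0 < \<delta>" "\<delta> < d" for \<delta>
    unfolding hausdorff_pre_def[of m \<delta> "A \<union> B"]
  proof (rule INF_greatest)
    fix U :: "nat \<Rightarrow> 'a set" assume "U \<in> {U. A \<union> B \<subseteq> (\<Union>i. U i) \<and> (\<forall>i. bounded (U i) \<and> diameter (U i) \<le> \<delta>)}"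
    then have U: "A \<union> B \<subseteq> (\<Union>i::nat. U i)" "\<And>i. bounded (U i)" "\<And>i. diameter (U i) \<le> \<delta>" by auto
    define UA where "UA i = (if U i \<inter> A = {} then {} else U i)" for i
    define UB where "UB i = (if U i \<inter> B = {} then {} else U i)" for i
    have "hausdorff_pre m \<delta> A \<le> (\<Sum>i. ennreal (hausdorff_gauge m (UA i)))"
    proof (rule hausdorff_pre_le)
      show "A \<subseteq> (\<Union>i. UA i)"
      proof
        fix x assume "x \<in> A"
        with U(1) obtain i where "x \<in> U i" by blast
        with \<open>x \<in> A\<close> have "x \<in> UA i" by (auto simp: UA_def)
        then show "x \<in> (\<Union>i. UA i)" by blast
      qed
      show "bounded (UA i) \<and> diameter (UA i) \<le> \<delta>" for i
        using U(2,3)[of i] \<delta> by (simp add: UA_def)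
    qed
    moreover have "hausdorff_pre m \<delta> B \<le> (\<Sum>i. ennreal (hausdorff_gauge m (UB i)))"
    proof (rule hausdorff_pre_le)
      show "B \<subseteq> (\<Union>i. UB i)"
      proof
        fix x assume "x \<in> B"
        with U(1) obtain i where "x \<in> U i" by blast
        with \<open>x \<in> B\<close> have "x \<in> UB i" by (auto simp: UB_def)
        then show "x \<in> (\<Union>i. UB i)" by blast
      qed
      show "bounded (UB i) \<and> diameter (UB i) \<le> \<delta>" for i
        using U(2,3)[of i] \<delta> by (simp add: UB_def)
    qed
    ultimately have "hausdorff_pre m \<delta> A + hausdorff_pre m \<delta> B \<le>
       (\<Sum>i. ennreal (hausdorff_gauge m (UA i))) + (\<Sum>i. ennreal (hausdorff_gauge m (UB i)))"
      by (rule add_mono)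
    also have "\<dots> = (\<Sum>i. ennreal (hausdorff_gauge m (UA i)) + ennreal (hausdorff_gauge m (UB i)))"
      by (intro suminf_add) auto
    also have "\<dots> \<le> (\<Sum>i. ennreal (hausdorff_gauge m (U i)))"
    proof (intro suminf_le)
      fix i
      have "U i \<inter> A = {} \<or> U i \<inter> B = {}"
      proof (rule ccontr)
        assume "\<not> ?thesis"
        then obtain a b where ab: "a \<in> U i" "a \<in> A" "b \<in> U i" "b \<in> B" by auto
        with sep have "d \<le> dist a b" by blast
        also have "\<dots> \<le> diameter (U i)" using ab U(2) by (simp add: diameter_bounded_bound)
        finally show False using U(3)[of i] \<delta> by simp
      qed
      then show "ennreal (hausdorff_gauge m (UA i)) + ennreal (hausdorff_gauge m (UB i)) \<le> ennreal (hausdorff_gauge m (U i))"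
        by (auto simp: UA_def UB_def hausdorff_gauge_def)
    qed auto
    finally show "hausdorff_pre m \<delta> A + hausdorff_pre m \<delta> B \<le> (\<Sum>i. ennreal (hausdorff_gauge m (U i)))" .
  qed
  have small: "hausdorff_outer m X = (SUP \<delta>\<in>{0<..<d}. hausdorff_pre m \<delta> X)" for X :: "'a set"
  proof (rule antisym)
    show "hausdorff_outer m X \<le> (SUP \<delta>\<in>{0<..<d}. hausdorff_pre m \<delta> X)"
      unfolding hausdorff_outer_def
    proof (rule SUP_least)
      fix \<delta> :: real assume "\<delta> \<in> {0<..}"
      then have "min \<delta> (d/2) \<in> {0<..<d}" using d by auto
      moreover have "hausdorff_pre m \<delta> X \<le> hausdorff_pre m (min \<delta> (d/2)) X" by (rule hausdorff_pre_antimono) simp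
      ultimately show "hausdorff_pre m \<delta> X \<le> (SUP \<delta>\<in>{0<..<d}. hausdorff_pre m \<delta> X)" by (rule SUP_upper2)
    qed
    show "(SUP \<delta>\<in>{0<..<d}. hausdorff_pre m \<delta> X) \<le> hausdorff_outer m X"
      by (intro SUP_least hausdorff_pre_le_outer) auto
  qed
  have "hausdorff_outer m A + hausdorff_outer m B = (SUP \<delta>\<in>{0<..<d}. hausdorff_pre m \<delta> A + hausdorff_pre m \<delta> B)"
    unfolding small
  proof (rule SUP_add_directed_ennreal[symmetric])
    fix i j assume "i \<in> {0<..<d}" "j \<in> {0<..<d}"
    then show "\<exists>k\<in>{0<..<d}. hausdorff_pre m i A + hausdorff_pre m j B \<le> hausdorff_pre m k A + hausdorff_pre m k B"
      by (intro bexI[of _ "min i j"] add_mono[OF hausdorff_pre_antimono hausdorff_pre_antimono]) auto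
  qed
  also have "\<dots> \<le> hausdorff_outer m (A \<union> B)"
  proof (rule SUP_least)
    fix \<delta> assume "\<delta> \<in> {0<..<d}"
    then show "hausdorff_pre m \<delta> A + hausdorff_pre m \<delta> B \<le> hausdorff_outer m (A \<union> B)"
      by (intro order_trans[OF key hausdorff_pre_le_outer]) simp_all
  qed
  finally show ?thesis .
qed

lemma closed_in_lambda_system:
  assumes "closed C"
  shows "C \<in> lambda_system UNIV UNIV (hausdorff_outer m)"
proof -
  have main: "hausdorff_outer m (X \<inter> C) + hausdorff_outer m (X - C) \<le> hausdorff_outer m X" (is "?a + ?b \<le> ?c") for X
  proof (cases "C = {} \<or> ?c = top")
    case True
    then show ?thesis by (auto simp: hausdorff_outer_empty)
  next
    case False
    then have ne: "C \<noteq> {}" and fin: "?c < top" by (auto simp: less_top)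
    define D where "D n = {x \<in> X. 1 / real (Suc n) \<le> infdist x C}" for n
    define R where "R n = D (Suc n) - D n" for n
    have D_mono: "D n \<subseteq> D k" if "n \<le> k" for n k
    proof -
      have "1 / real (Suc k) \<le> 1 / real (Suc n)" using that by (simp add: frac_le)
      then show ?thesis unfolding D_def by auto
    qed
    have DX: "D n \<subseteq> X" for n by (auto simp: D_def)
    have cov: "X - C \<subseteq> (\<Union>n. D n)"
    proof
      fix x assume "x \<in> X - C"
      then have "0 < infdist x C"
        using assms ne in_closed_iff_infdist_zero[of C x] infdist_nonneg[of x C] by (auto simp: less_le)
      then obtain n where "inverse (real (Suc n)) < infdist x C" using reals_Archimedean by blast
      then show "x \<in> (\<Union>n. D n)" using \<open>x \<in> X - C\<close> by (auto simp: D_def inverse_eq_divide intro!: exI[of _ n])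
    qed
    have sepD: "hausdorff_outer m (X \<inter> C) + hausdorff_outer m (D n) \<le> ?c" for n
    proof -
      have "hausdorff_outer m (X \<inter> C) + hausdorff_outer m (D n) \<le> hausdorff_outer m ((X \<inter> C) \<union> D n)"
      proof (rule hausdorff_outer_separated)
        show "0 < 1 / real (Suc n)" by simp
        fix a b assume "a \<in> X \<inter> C" "b \<in> D n"
        then show "1 / real (Suc n) \<le> dist a b"
          using infdist_le[of a C b] by (auto simp: D_def dist_commute)
      qed
      also have "\<dots> \<le> ?c" by (rule hausdorff_outer_mono) (use DX in auto)
      finally show ?thesis .
    qed
    have sepR: "hausdorff_outer m A + hausdorff_outer m (R n) \<le> hausdorff_outer m (A \<union> R n)"
      if A: "A \<subseteq> D k" and k: "k < n" for A k n
    proof (rule hausdorff_outer_separated)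
      have lt: "1 / real (Suc n) < 1 / real (Suc k)" using k by (simp add: frac_less2)
      then show "0 < 1 / real (Suc k) - 1 / real (Suc n)" by simp
      fix a b assume "a \<in> A" "b \<in> R n"
      then have "1 / real (Suc k) \<le> infdist a C" "infdist b C < 1 / real (Suc n)"
        using A by (auto simp: D_def R_def)
      moreover have "infdist a C \<le> infdist b C + dist a b" by (rule infdist_triangle)
      ultimately show "1 / real (Suc k) - 1 / real (Suc n) \<le> dist a b" by simp
    qed
    have step: "(\<Sum>i<n. hausdorff_outer m (R (2*i+s))) \<le> ?c" if "s < 2" for n s :: nat
    proof -
      have "(\<Sum>i<n. hausdorff_outer m (R (2*i+s))) \<le> hausdorff_outer m (\<Union>i<n. R (2*i+s))"
      proof (induction n)
        case 0
        then show ?case by simp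
      next
        case (Suc n)
        have *: "hausdorff_outer m (\<Union>i<n. R (2*i+s)) + hausdorff_outer m (R (2*n+s)) \<le>
           hausdorff_outer m ((\<Union>i<n. R (2*i+s)) \<union> R (2*n+s))"
        proof (cases n)
          case 0
          then show ?thesis by (simp add: hausdorff_outer_empty)
        next
          case (Suc n')
          show ?thesis
          proof (rule sepR)
            show "(\<Union>i<n. R (2*i+s)) \<subseteq> D (2*n'+s+1)"
            proof (rule UN_least)
              fix i assume "i \<in> {..<n}"
              then have "Suc (2*i+s) \<le> 2*n'+s+1" using Suc by auto
              then show "R (2*i+s) \<subseteq> D (2*n'+s+1)" unfolding R_def using D_mono by blast
            qed
            show "2*n'+s+1 < 2*n+s" using Suc by simp
          qed
        qed
        have "(\<Sum>i<Suc n. hausdorff_outer m (R (2*i+s))) \<le>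
            hausdorff_outer m (\<Union>i<n. R (2*i+s)) + hausdorff_outer m (R (2*n+s))"
          using Suc.IH by (simp add: add_right_mono)
        also note *
        also have "(\<Union>i<n. R (2*i+s)) \<union> R (2*n+s) = (\<Union>i<Suc n. R (2*i+s))"
          by (auto simp: lessThan_Suc)
        finally show ?case .
      qed
      also have "\<dots> \<le> ?c" by (rule hausdorff_outer_mono) (use DX in \<open>auto simp: R_def\<close>)
      finally show ?thesis .
    qed
    have partial: "(\<Sum>i<n. hausdorff_outer m (R i)) \<le> ?c + ?c" for n
    proof -
      have "(\<Sum>i<n. hausdorff_outer m (R i)) \<le> (\<Sum>i<2*n. hausdorff_outer m (R i))"
        by (rule sum_mono2) auto
      also have "\<dots> = (\<Sum>i<n. hausdorff_outer m (R (2*i+0))) + (\<Sum>i<n. hausdorff_outer m (R (2*i+1)))"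
        by (induction n) (auto simp: algebra_simps)
      also have "\<dots> \<le> ?c + ?c" by (intro add_mono step) auto
      finally show ?thesis .
    qed
    then have sumfin: "(\<Sum>i. hausdorff_outer m (R i)) \<noteq> top"
    proof -
      have "(\<Sum>i. hausdorff_outer m (R i)) \<le> ?c + ?c" by (intro suminf_le_const partial) auto
      also have "\<dots> < top" using fin by simp
      finally show ?thesis by simp
    qed
    have tail: "(\<lambda>n. \<Sum>i. hausdorff_outer m (R (i + n))) \<longlonglongrightarrow> 0"
    proof -
      define r where "r i = enn2real (hausdorff_outer m (R i))" for i
      have fi: "hausdorff_outer m (R i) < top" for i
      proof -
        have "hausdorff_outer m (R i) \<le> ?c" by (rule hausdorff_outer_mono) (use DX in \<open>auto simp: R_def\<close>)
        then show ?thesis using fin by simp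
      qed
      then have r: "hausdorff_outer m (R i) = ennreal (r i)" "0 \<le> r i" for i by (auto simp: r_def)
      have "summable r"
        using sumfin r by (simp add: summable_suminf_not_top)
      have eq: "(\<Sum>i. hausdorff_outer m (R (i + n))) = ennreal (\<Sum>i. r (i + n))" for n
        unfolding r(1) by (rule suminf_ennreal2) (use r(2) \<open>summable r\<close> summable_ignore_initial_segment in auto)
      have "(\<lambda>n. \<Sum>i. r (i + n)) \<longlonglongrightarrow> 0" by (rule suminf_exist_split2[OF \<open>summable r\<close>])
      then show ?thesis unfolding eq using tendsto_ennrealI by fastforce
    qed
    have bnd: "?a + ?b \<le> ?c + (\<Sum>i. hausdorff_outer m (R (i + n)))" for n
    proof -
      have "X - C \<subseteq> D n \<union> (\<Union>i. R (i + n))"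
      proof
        fix x assume "x \<in> X - C"
        then obtain k where k: "x \<in> D k" using cov by blast
        show "x \<in> D n \<union> (\<Union>i. R (i + n))"
        proof (cases "x \<in> D n")
          case True
          then show ?thesis by simp
        next
          case xn: False
          define j where "j = (LEAST j. x \<in> D j)"
          have j: "x \<in> D j" unfolding j_def using k by (rule LeastI)
          have "n < j" using xn j D_mono[of j n] by (metis not_less subsetD)
          then have "x \<notin> D (j - 1)" using not_less_Least[of "j - 1" "\<lambda>j. x \<in> D j"] unfolding j_def by simp
          then have "x \<in> R ((j - 1 - n) + n)" using j \<open>n < j\<close> by (simp add: R_def)
          then show ?thesis by blast
        qed
      qed
      then have "?b \<le> hausdorff_outer m (D n \<union> (\<Union>i. R (i + n)))" by (rule hausdorff_outer_mono)
      also have "\<dots> \<le> hausdorff_outer m (D n) + hausdorff_outer m (\<Union>i. R (i + n))" by (rule hausdorff_outer_Un)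
      also have "\<dots> \<le> hausdorff_outer m (D n) + (\<Sum>i. hausdorff_outer m (R (i + n)))"
        by (intro add_left_mono hausdorff_outer_UN)
      finally have "?a + ?b \<le> ?a + (hausdorff_outer m (D n) + (\<Sum>i. hausdorff_outer m (R (i + n))))"
        by (rule add_left_mono)
      also have "\<dots> \<le> ?c + (\<Sum>i. hausdorff_outer m (R (i + n)))"
        using sepD[of n] by (simp add: add_right_mono flip: add.assoc)
      finally show ?thesis .
    qed
    have "(\<lambda>n. ?c + (\<Sum>i. hausdorff_outer m (R (i + n)))) \<longlonglongrightarrow> ?c + 0"
      by (intro tendsto_add tail tendsto_const)
    then show ?thesis using bnd by (intro LIMSEQ_le_const[where X = "\<lambda>n. ?c + (\<Sum>i. hausdorff_outer m (R (i + n)))"]) auto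
  qed
  have "hausdorff_outer m (C \<inter> X) + hausdorff_outer m ((UNIV - C) \<inter> X) = hausdorff_outer m X" for X
  proof (rule antisym)
    have "(UNIV - C) \<inter> X = X - C" by auto
    then show "hausdorff_outer m (C \<inter> X) + hausdorff_outer m ((UNIV - C) \<inter> X) \<le> hausdorff_outer m X"
      using main[of X] by (simp add: Int_commute)
    have "hausdorff_outer m X = hausdorff_outer m ((C \<inter> X) \<union> ((UNIV - C) \<inter> X))"
      by (rule arg_cong[where f = "hausdorff_outer m"]) auto
    also have "\<dots> \<le> hausdorff_outer m (C \<inter> X) + hausdorff_outer m ((UNIV - C) \<inter> X)" by (rule hausdorff_outer_Un)
    finally show "hausdorff_outer m X \<le> hausdorff_outer m (C \<inter> X) + hausdorff_outer m ((UNIV - C) \<inter> X)" .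
  qed
  then show ?thesis by (simp add: lambda_system_def)
qed

lemma measure_space_hausdorff_outer: "measure_space UNIV (sets borel) (hausdorff_outer m)"
proof -
  interpret sigma_algebra UNIV "UNIV :: 'a set set" using sigma_algebra_Pow[of UNIV] by simp
  have L: "measure_space UNIV (lambda_system UNIV UNIV (hausdorff_outer m)) (hausdorff_outer m :: 'a set \<Rightarrow> _)"
    by (rule caratheodory_lemma[OF hausdorff_outer_measure_space])
  then interpret L: sigma_algebra UNIV "lambda_system UNIV UNIV (hausdorff_outer m) :: 'a set set"
    by (simp add: measure_space_def)
  have sub: "sets (borel :: 'a measure) \<subseteq> lambda_system UNIV UNIV (hausdorff_outer m)"
    unfolding borel_eq_closed
    by (subst sets_measure_of) (auto intro!: L.sigma_sets_subset closed_in_lambda_system)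
  have "countably_additive (sets (borel :: 'a measure)) (hausdorff_outer m)"
    unfolding countably_additive_def
  proof (intro allI impI)
    fix A :: "nat \<Rightarrow> 'a set"
    assume "range A \<subseteq> sets borel" "disjoint_family A" "(\<Union>i. A i) \<in> sets borel"
    then show "(\<Sum>i. hausdorff_outer m (A i)) = hausdorff_outer m (\<Union>i. A i)"
      using L sub unfolding measure_space_def countably_additive_def by (meson subset_trans subsetD)
  qed
  then show ?thesis
    using sets.sigma_algebra_axioms[of "borel :: 'a measure"]
    by (simp add: measure_space_def positive_def hausdorff_outer_empty)
qed

lemma sets_hausdorff_measure [simp]: "sets (hausdorff_measure m) = sets borel"
  unfolding hausdorff_measure_def by (metis sets.sets_measure_of_eq space_borel)

lemma space_hausdorff_measure [simp]: "space (hausdorff_measure m) = UNIV"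
  unfolding hausdorff_measure_def by (simp add: space_measure_of_conv)

lemma emeasure_hausdorff_measure:
  "A \<in> sets borel \<Longrightarrow> emeasure (hausdorff_measure m) A = hausdorff_outer m A"
  using measure_space_hausdorff_outer[of m] unfolding hausdorff_measure_def measure_space_def
  by (intro emeasure_measure_of_sigma) auto

section \<open>Domains and interfaces\<close>

text \<open>Locally, after a rigid motion, a Lipschitz domain is the strict epigraph of a Lipschitz
  function: e is the direction of the last local coordinate, and gamma is only evaluated
  on the hyperplane orthogonal to e.\<close>

definition lipschitz_domain :: "'a::euclidean_space set \<Rightarrow> bool" where
  "lipschitz_domain \<Omega> \<longleftrightarrow>
     open \<Omega> \<and> bounded \<Omega> \<and> connected \<Omega> \<and> \<Omega> \<noteq> {} \<and>
     (\<forall>x\<in>frontier \<Omega>. \<exists>e r C \<gamma>. norm e = 1 \<and> 0 < r \<and> C-lipschitz_on UNIV \<gamma> \<and>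
        (\<forall>y\<in>ball x r. y \<in> \<Omega> \<longleftrightarrow> \<gamma> (y - (y \<bullet> e) *\<^sub>R e) < y \<bullet> e))"

text \<open>Topological manifolds with boundary (an interface may end on the outer boundary), modelled
  on relatively open subsets of half-spaces of m-dimensional linear subspaces.\<close>

definition manifold_with_boundary :: "nat \<Rightarrow> 'a::euclidean_space set \<Rightarrow> bool" where
  "manifold_with_boundary m M \<longleftrightarrow>
     (\<forall>x\<in>M. \<exists>U (T :: 'a set) b V. openin (top_of_set M) U \<and> x \<in> U \<and>
        subspace T \<and> dim T = m \<and> b \<in> T \<and> b \<noteq> 0 \<and>
        openin (top_of_set (T \<inter> {y. 0 \<le> b \<bullet> y})) V \<and> U homeomorphic V)"

definition surface_measure :: "'a::euclidean_space set \<Rightarrow> 'a measure" where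
  "surface_measure \<Sigma> = restrict_space (hausdorff_measure (DIM('a) - 1)) \<Sigma>"

definition interface :: "(2 \<Rightarrow> 'a::topological_space set) \<Rightarrow> 'a set" where
  "interface \<Omega>s = frontier (\<Omega>s 1) \<inter> frontier (\<Omega>s 2)"

section \<open>Function spaces\<close>

text \<open>Elements of Lebesgue spaces are represented by functions; all notions below are
  insensitive to changes on null sets.\<close>

definition L2_space :: "'a measure \<Rightarrow> ('a \<Rightarrow> 'b::euclidean_space) set" where
  "L2_space M = {f \<in> borel_measurable M. integrable M (\<lambda>x. (norm (f x))\<^sup>2)}"

definition L2_inner :: "'a measure \<Rightarrow> ('a \<Rightarrow> 'b::euclidean_space) \<Rightarrow> ('a \<Rightarrow> 'b) \<Rightarrow> real" where
  "L2_inner M f g = (LINT x|M. f x \<bullet> g x)"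

definition L2_norm :: "'a measure \<Rightarrow> ('a \<Rightarrow> 'b::euclidean_space) \<Rightarrow> real" where
  "L2_norm M f = sqrt (L2_inner M f f)"

definition L2_norm_pair ::
    "(2 \<Rightarrow> 'a::euclidean_space set) \<Rightarrow> (2 \<Rightarrow> 'a \<Rightarrow> 'b::euclidean_space) \<Rightarrow> real" where
  "L2_norm_pair \<Omega>s u = sqrt (\<Sum>l\<in>UNIV. (L2_norm (lebesgue_on (\<Omega>s l)) (u l))\<^sup>2)"

text \<open>Continuously differentiable and smooth test functions define the same weak derivatives and
  the same normal traces, by mollification.\<close>

definition C1_functions :: "('a::euclidean_space \<Rightarrow> real) set" where
  "C1_functions = {\<phi>. \<exists>D. (\<forall>x. GDERIV \<phi> x :> D x) \<and> continuous_on UNIV D}"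

definition grad :: "('a::euclidean_space \<Rightarrow> real) \<Rightarrow> 'a \<Rightarrow> 'a" where
  "grad \<phi> x = (THE D. GDERIV \<phi> x :> D)"

definition test_functions :: "'a::euclidean_space set \<Rightarrow> ('a \<Rightarrow> real) set" where
  "test_functions \<Omega> =
     {\<phi> \<in> C1_functions. compact (closure {x. \<phi> x \<noteq> 0}) \<and> closure {x. \<phi> x \<noteq> 0} \<subseteq> \<Omega>}"

definition locally_integrable ::
    "'a::euclidean_space set \<Rightarrow> ('a \<Rightarrow> 'b::euclidean_space) \<Rightarrow> bool" where
  "locally_integrable \<Omega> f \<longleftrightarrow> (\<forall>K. compact K \<and> K \<subseteq> \<Omega> \<longrightarrow> set_integrable lebesgue K f)"

definition has_weak_gradient ::
    "'a::euclidean_space set \<Rightarrow> ('a \<Rightarrow> real) \<Rightarrow> ('a \<Rightarrow> 'a) \<Rightarrow> bool" where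
  "has_weak_gradient \<Omega> f G \<longleftrightarrow> locally_integrable \<Omega> f \<and> locally_integrable \<Omega> G \<and>
     (\<forall>\<phi>\<in>test_functions \<Omega>.
        (LINT x|lebesgue_on \<Omega>. f x *\<^sub>R grad \<phi> x) = - (LINT x|lebesgue_on \<Omega>. \<phi> x *\<^sub>R G x))"

definition has_weak_divergence ::
    "'a::euclidean_space set \<Rightarrow> ('a \<Rightarrow> 'a) \<Rightarrow> ('a \<Rightarrow> real) \<Rightarrow> bool" where
  "has_weak_divergence \<Omega> q f \<longleftrightarrow>
     (\<forall>\<phi>\<in>test_functions \<Omega>.
        L2_inner (lebesgue_on \<Omega>) q (grad \<phi>) = - L2_inner (lebesgue_on \<Omega>) f \<phi>)"

definition H_div :: "'a::euclidean_space set \<Rightarrow> ('a \<Rightarrow> 'a) set" where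
  "H_div \<Omega> = {q \<in> L2_space (lebesgue_on \<Omega>).
     \<exists>f\<in>L2_space (lebesgue_on \<Omega>). has_weak_divergence \<Omega> q f}"

definition weak_div :: "'a::euclidean_space set \<Rightarrow> ('a \<Rightarrow> 'a) \<Rightarrow> 'a \<Rightarrow> real" where
  "weak_div \<Omega> q = (SOME f. f \<in> L2_space (lebesgue_on \<Omega>) \<and> has_weak_divergence \<Omega> q f)"

text \<open>The normal trace of an H(div) field is the functional on boundary values that is defined by
  Green's formula with respect to the outward unit normal. The relation says that its restriction
  to the part Sigma of the boundary is the square-integrable function h; the restriction acts on
  those functions whose boundary values vanish off Sigma.\<close>

definition has_normal_trace ::
    "'a::euclidean_space set \<Rightarrow> 'a set \<Rightarrow> ('a \<Rightarrow> 'a) \<Rightarrow> ('a \<Rightarrow> real) \<Rightarrow> bool" where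
  "has_normal_trace \<Omega> \<Sigma> q h \<longleftrightarrow> h \<in> L2_space (surface_measure \<Sigma>) \<and>
     (\<forall>\<phi>\<in>C1_functions. (\<forall>x\<in>frontier \<Omega> - \<Sigma>. \<phi> x = 0) \<longrightarrow>
        L2_inner (lebesgue_on \<Omega>) q (grad \<phi>) + L2_inner (lebesgue_on \<Omega>) (weak_div \<Omega> q) \<phi>
          = L2_inner (surface_measure \<Sigma>) h \<phi>)"

definition normal_trace ::
    "'a::euclidean_space set \<Rightarrow> 'a set \<Rightarrow> ('a \<Rightarrow> 'a) \<Rightarrow> 'a \<Rightarrow> real" where
  "normal_trace \<Omega> \<Sigma> q = (SOME h. has_normal_trace \<Omega> \<Sigma> q h)"

definition flux_space :: "'a::euclidean_space set \<Rightarrow> 'a set \<Rightarrow> 'a set \<Rightarrow> ('a \<Rightarrow> 'a) set" where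
  "flux_space \<Omega> \<Gamma> \<Gamma>N = {q \<in> H_div \<Omega>.
     (\<exists>h. has_normal_trace \<Omega> \<Gamma> q h) \<and> has_normal_trace \<Omega> (\<Gamma>N \<inter> frontier \<Omega>) q (\<lambda>x. 0)}"

text \<open>The product space of fluxes, pressures and interface variables.\<close>

definition state_space :: "(2 \<Rightarrow> 'a::euclidean_space set) \<Rightarrow> 'a set \<Rightarrow>
    ((2 \<Rightarrow> 'a \<Rightarrow> 'a) \<times> (2 \<Rightarrow> 'a \<Rightarrow> real) \<times> (2 \<Rightarrow> 'a \<Rightarrow> real)) set" where
  "state_space \<Omega>s \<Gamma>N = {(q, p, g). \<forall>l. q l \<in> flux_space (\<Omega>s l) (interface \<Omega>s) \<Gamma>N \<and>
     p l \<in> L2_space (lebesgue_on (\<Omega>s l)) \<and> g l \<in> L2_space (surface_measure (interface \<Omega>s))}"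

section \<open>The limit problem and the iterative scheme\<close>

text \<open>Here kap is the inverse permeability and D the gradient of eta on one subdomain.\<close>

definition flux_equation :: "'a::euclidean_space set \<Rightarrow> 'a set \<Rightarrow> 'a set \<Rightarrow> real \<Rightarrow> ('a \<Rightarrow> 'a) \<Rightarrow>
    ('a \<Rightarrow> real) \<Rightarrow> ('a \<Rightarrow> 'a) \<Rightarrow> ('a \<Rightarrow> real) \<Rightarrow> ('a \<Rightarrow> real) \<Rightarrow> bool" where
  "flux_equation \<Omega> \<Gamma> \<Gamma>N \<alpha> D kap q p g \<longleftrightarrow>
     (\<forall>v\<in>flux_space \<Omega> \<Gamma> \<Gamma>N.
        L2_inner (lebesgue_on \<Omega>) (\<lambda>x. kap x *\<^sub>R q x) v
          - L2_inner (lebesgue_on \<Omega>) p (weak_div \<Omega> v)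
          + \<alpha> * L2_inner (surface_measure \<Gamma>) (normal_trace \<Omega> \<Gamma> q) (normal_trace \<Omega> \<Gamma> v)
        = L2_inner (lebesgue_on \<Omega>) D v
          - L2_inner (surface_measure \<Gamma>) g (normal_trace \<Omega> \<Gamma> v))"

text \<open>Omega, q and g belong to the neighbouring subdomain, and g' is the interface variable that
  is computed from them.\<close>

definition exchange_equation :: "'a::euclidean_space set \<Rightarrow> 'a set \<Rightarrow> real \<Rightarrow>
    ('a \<Rightarrow> 'a) \<Rightarrow> ('a \<Rightarrow> real) \<Rightarrow> ('a \<Rightarrow> real) \<Rightarrow> bool" where
  "exchange_equation \<Omega> \<Gamma> \<alpha> q g g' \<longleftrightarrow>
     (\<forall>w\<in>L2_space (surface_measure \<Gamma>).
        L2_inner (surface_measure \<Gamma>) g' w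
        = L2_inner (surface_measure \<Gamma>) (\<lambda>x. 2 * \<alpha> * normal_trace \<Omega> \<Gamma> q x + g x) w)"

definition limit_solution :: "(2 \<Rightarrow> 'a::euclidean_space set) \<Rightarrow> 'a set \<Rightarrow> real \<Rightarrow> real \<Rightarrow>
    (2 \<Rightarrow> real \<Rightarrow> real) \<Rightarrow> (2 \<Rightarrow> real \<Rightarrow> real) \<Rightarrow> (2 \<Rightarrow> 'a \<Rightarrow> real) \<Rightarrow> (2 \<Rightarrow> 'a \<Rightarrow> 'a) \<Rightarrow>
    (2 \<Rightarrow> 'a \<Rightarrow> real) \<Rightarrow> (2 \<Rightarrow> 'a \<Rightarrow> 'a) \<Rightarrow> (2 \<Rightarrow> 'a \<Rightarrow> real) \<Rightarrow> (2 \<Rightarrow> 'a \<Rightarrow> real) \<Rightarrow> bool" where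
  "limit_solution \<Omega>s \<Gamma>N \<alpha> \<tau> k S F D pprev q p g \<longleftrightarrow>
     (q, p, g) \<in> state_space \<Omega>s \<Gamma>N \<and>
     (\<forall>l. flux_equation (\<Omega>s l) (interface \<Omega>s) \<Gamma>N \<alpha> (D l) (\<lambda>x. 1 / k l (S l (p l x)))
        (q l) (p l) (g l)) \<and>
     (\<forall>l. \<forall>w\<in>L2_space (lebesgue_on (\<Omega>s l)).
        L2_inner (lebesgue_on (\<Omega>s l)) (\<lambda>x. S l (p l x)) w
          + \<tau> * L2_inner (lebesgue_on (\<Omega>s l)) (weak_div (\<Omega>s l) (q l)) w
        = \<tau> * L2_inner (lebesgue_on (\<Omega>s l)) (F l) w
          + L2_inner (lebesgue_on (\<Omega>s l)) (\<lambda>x. S l (pprev l x)) w) \<and>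
     (\<forall>l j. l \<noteq> j \<longrightarrow> exchange_equation (\<Omega>s j) (interface \<Omega>s) \<alpha> (q j) (g j) (g l))"

text \<open>The sequences of all iterates, including the initial state, of the linearised scheme with
  stabilisation parameters L.\<close>

definition iterative_scheme :: "(2 \<Rightarrow> 'a::euclidean_space set) \<Rightarrow> 'a set \<Rightarrow> real \<Rightarrow> real \<Rightarrow>
    (2 \<Rightarrow> real \<Rightarrow> real) \<Rightarrow> (2 \<Rightarrow> real \<Rightarrow> real) \<Rightarrow> (2 \<Rightarrow> real) \<Rightarrow> (2 \<Rightarrow> 'a \<Rightarrow> real) \<Rightarrow>
    (2 \<Rightarrow> 'a \<Rightarrow> 'a) \<Rightarrow> (2 \<Rightarrow> 'a \<Rightarrow> real) \<Rightarrow> (nat \<Rightarrow> 2 \<Rightarrow> 'a \<Rightarrow> 'a) \<Rightarrow> (nat \<Rightarrow> 2 \<Rightarrow> 'a \<Rightarrow> real) \<Rightarrow>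
    (nat \<Rightarrow> 2 \<Rightarrow> 'a \<Rightarrow> real) \<Rightarrow> bool" where
  "iterative_scheme \<Omega>s \<Gamma>N \<alpha> \<tau> k S L F D pprev q p g \<longleftrightarrow>
     (\<forall>i. (q i, p i, g i) \<in> state_space \<Omega>s \<Gamma>N) \<and>
     (\<forall>i\<ge>1.
        (\<forall>l j. l \<noteq> j \<longrightarrow> exchange_equation (\<Omega>s j) (interface \<Omega>s) \<alpha>
           (q (i - 1) j) (g (i - 1) j) (g i l)) \<and>
        (\<forall>l. flux_equation (\<Omega>s l) (interface \<Omega>s) \<Gamma>N \<alpha> (D l)
           (\<lambda>x. 1 / k l (S l (p (i - 1) l x))) (q i l) (p i l) (g i l)) \<and>
        (\<forall>l. \<forall>w\<in>L2_space (lebesgue_on (\<Omega>s l)).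
           L l * L2_inner (lebesgue_on (\<Omega>s l)) (p i l) w
             + \<tau> * L2_inner (lebesgue_on (\<Omega>s l)) (weak_div (\<Omega>s l) (q i l)) w
           = \<tau> * L2_inner (lebesgue_on (\<Omega>s l)) (F l) w
             - L2_inner (lebesgue_on (\<Omega>s l)) (\<lambda>x. S l (p (i - 1) l x) - S l (pprev l x)) w
             + L l * L2_inner (lebesgue_on (\<Omega>s l)) (p (i - 1) l) w))"

end

theory Submission
  imports Defs
begin

text \<open>Testing the error equations with the errors themselves and using the monotonicity of S shows that
  L/2 |e_p|^2 + tau/(4 alpha) |e_g|^2, summed over the subdomains, decreases in each iteration by a
  multiple of the squared flux error plus the squared saturation error, because the exchange
  condition turns the Robin terms into a telescoping sum. Hence both of these errors tend to zero.
  Since S need not be strictly increasing, the pressure error is recovered by duality: it is the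
  divergence of a field without flux through the interface and the Neumann boundary whose norm it
  bounds, and one tests the flux equation with that field. The field exists by a Poincare inequality
  on each subdomain for functions that vanish on its Dirichlet part. Both this and the uniqueness of
  normal traces rely on the fact that the interface meets the outer boundary in a set of surface
  measure zero: at a density point of that set, the cone conditions of the two subdomains would make
  them overlap.\<close>


section \<open>Square-integrable functions\<close>

text \<open>The smallness conditions come from one coefficient: the squared saturation error carries
  the factor 1/LS - 1/(2L) - \<tau> Lk^2 Mq^2 / (2m). Its first term is the cocoercivity of a
  monotone Lipschitz function, the second pays for absorbing the pressure increment into the
  stabilisation, the third for absorbing the change of the coefficient into its lower bound m. The
  condition on \<tau> says that the factor is positive. One obstacle is that divergences and normal
  traces are selected by Hilbert choice: they are linear only almost everywhere, by uniqueness. A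
  trace on the interface is tested only with functions vanishing on the remaining boundary of the
  subdomain; these see an interface point only if the boundary near it belongs to the interface,
  which is known inside \<Omega> but not where the interface touches the outer boundary. Another
  obstacle is that the field with prescribed divergence must be admissible in the flux equation. It
  is a limit of gradients of continuously differentiable functions, so the Poincare inequality is
  needed only for these and follows from elementary translation arguments.\<close>

lemma L2_spaceD:
  assumes "f \<in> L2_space M"
  shows "f \<in> borel_measurable M" "integrable M (\<lambda>x. (norm (f x))\<^sup>2)"
  using assms by (auto simp: L2_space_def)

lemma L2_space_dominated:
  fixes f :: "'a \<Rightarrow> 'b::euclidean_space" and g :: "'a \<Rightarrow> 'c::euclidean_space"
  assumes "f \<in> L2_space M" and "g \<in> borel_measurable M" and "AE x in M. norm (g x) \<le> c * norm (f x)"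
  shows "g \<in> L2_space M"
proof -
  have "integrable M (\<lambda>x. (norm (g x))\<^sup>2)"
  proof (rule Bochner_Integration.integrable_bound)
    show "integrable M (\<lambda>x. c\<^sup>2 * (norm (f x))\<^sup>2)" using L2_spaceD[OF assms(1)] by auto
    show "AE x in M. norm ((norm (g x))\<^sup>2) \<le> norm (c\<^sup>2 * (norm (f x))\<^sup>2)"
      using assms(3)
    proof eventually_elim
      case (elim x)
      then have "(norm (g x))\<^sup>2 \<le> (c * norm (f x))\<^sup>2" by (intro power_mono) auto
      then show ?case by (simp add: power_mult_distrib)
    qed
  qed (use assms in auto)
  then show ?thesis using assms by (simp add: L2_space_def)
qed

lemma L2_space_zero [simp]: "(\<lambda>x. 0) \<in> L2_space M"
  by (simp add: L2_space_def)

lemma L2_space_add: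
  assumes "f \<in> L2_space M" "g \<in> L2_space M"
  shows "(\<lambda>x. f x + g x) \<in> L2_space M"
proof -
  have "integrable M (\<lambda>x. (norm (f x + g x))\<^sup>2)"
  proof (rule Bochner_Integration.integrable_bound)
    show "integrable M (\<lambda>x. 2 * (norm (f x))\<^sup>2 + 2 * (norm (g x))\<^sup>2)"
      using L2_spaceD[OF assms(1)] L2_spaceD[OF assms(2)] by auto
    have "(norm (f x + g x))\<^sup>2 \<le> 2 * (norm (f x))\<^sup>2 + 2 * (norm (g x))\<^sup>2" for x
    proof -
      have "(norm (f x + g x))\<^sup>2 \<le> (norm (f x) + norm (g x))\<^sup>2"
        by (intro power_mono norm_triangle_ineq) auto
      also have "\<dots> \<le> 2 * (norm (f x))\<^sup>2 + 2 * (norm (g x))\<^sup>2" using sum_squares_bound[of "norm (f x)" "norm (g x)"] by (simp add: power2_sum)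
      finally show ?thesis .
    qed
    then show "AE x in M. norm ((norm (f x + g x))\<^sup>2) \<le> norm (2 * (norm (f x))\<^sup>2 + 2 * (norm (g x))\<^sup>2)"
      by (auto intro!: AE_I2 intro: order_trans[OF _ abs_ge_self])
  qed (use L2_spaceD[OF assms(1)] L2_spaceD[OF assms(2)] in auto)
  then show ?thesis using L2_spaceD[OF assms(1)] L2_spaceD[OF assms(2)] by (simp add: L2_space_def)
qed

lemma L2_space_scaleR:
  assumes "f \<in> L2_space M"
  shows "(\<lambda>x. c *\<^sub>R f x) \<in> L2_space M"
  using assms L2_spaceD[OF assms] by (intro L2_space_dominated[OF assms, where c = "\<bar>c\<bar>"]) auto

lemma L2_space_mult: "f \<in> L2_space M \<Longrightarrow> (\<lambda>x. c * f x) \<in> L2_space M" for f :: "'a \<Rightarrow> real"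
  using L2_space_scaleR[of f M c] by simp

lemma L2_space_diff:
  assumes "f \<in> L2_space M" "g \<in> L2_space M"
  shows "(\<lambda>x. f x - g x) \<in> L2_space M"
  using L2_space_add[OF assms(1) L2_space_scaleR[OF assms(2), of "-1"]] by simp

lemma L2_space_bounded_scaleR:
  assumes "f \<in> L2_space M" "\<phi> \<in> borel_measurable M" "\<And>x. \<bar>\<phi> x\<bar> \<le> c"
  shows "(\<lambda>x. \<phi> x *\<^sub>R f x) \<in> L2_space M"
  using L2_spaceD[OF assms(1)] assms(2,3)
  by (intro L2_space_dominated[OF assms(1), where c = c]) (auto intro!: mult_right_mono)

lemma integrable_L2_inner:
  assumes "f \<in> L2_space M" "g \<in> L2_space M"
  shows "integrable M (\<lambda>x. f x \<bullet> g x)"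
proof (rule Bochner_Integration.integrable_bound)
  show "integrable M (\<lambda>x. (norm (f x))\<^sup>2 + (norm (g x))\<^sup>2)"
    using L2_spaceD[OF assms(1)] L2_spaceD[OF assms(2)] by auto
  have "\<bar>f x \<bullet> g x\<bar> \<le> (norm (f x))\<^sup>2 + (norm (g x))\<^sup>2" for x
  proof -
    have "\<bar>f x \<bullet> g x\<bar> \<le> norm (f x) * norm (g x)" by (rule Cauchy_Schwarz_ineq2)
    moreover have "0 \<le> norm (f x) * norm (g x)" by simp
    ultimately show ?thesis using sum_squares_bound[of "norm (f x)" "norm (g x)"] by linarith
  qed
  then show "AE x in M. norm (f x \<bullet> g x) \<le> norm ((norm (f x))\<^sup>2 + (norm (g x))\<^sup>2)"
    by (auto intro!: AE_I2 intro: order_trans[OF _ abs_ge_self])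
qed (use L2_spaceD[OF assms(1)] L2_spaceD[OF assms(2)] in auto)

section \<open>Bilinearity, the Cauchy-Schwarz inequality and the triangle inequality\<close>

lemma L2_inner_commute: "L2_inner M f g = L2_inner M g f"
  by (simp add: L2_inner_def inner_commute)

lemma L2_inner_add_left:
  "f \<in> L2_space M \<Longrightarrow> g \<in> L2_space M \<Longrightarrow> h \<in> L2_space M \<Longrightarrow>
    L2_inner M (\<lambda>x. f x + g x) h = L2_inner M f h + L2_inner M g h"
  by (simp add: L2_inner_def inner_add_left integrable_L2_inner)

lemma L2_inner_diff_left:
  "f \<in> L2_space M \<Longrightarrow> g \<in> L2_space M \<Longrightarrow> h \<in> L2_space M \<Longrightarrow>
    L2_inner M (\<lambda>x. f x - g x) h = L2_inner M f h - L2_inner M g h"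
  by (simp add: L2_inner_def inner_diff_left integrable_L2_inner)

lemma L2_inner_add_right:
  "f \<in> L2_space M \<Longrightarrow> g \<in> L2_space M \<Longrightarrow> h \<in> L2_space M \<Longrightarrow>
    L2_inner M h (\<lambda>x. f x + g x) = L2_inner M h f + L2_inner M h g"
  by (simp add: L2_inner_def inner_add_right integrable_L2_inner)

lemma L2_inner_diff_right:
  "f \<in> L2_space M \<Longrightarrow> g \<in> L2_space M \<Longrightarrow> h \<in> L2_space M \<Longrightarrow>
    L2_inner M h (\<lambda>x. f x - g x) = L2_inner M h f - L2_inner M h g"
  by (simp add: L2_inner_def inner_diff_right integrable_L2_inner)

lemma L2_inner_scaleR_left: "L2_inner M (\<lambda>x. c *\<^sub>R f x) g = c * L2_inner M f g"
  by (simp add: L2_inner_def)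

lemma L2_inner_scaleR_right: "L2_inner M f (\<lambda>x. c *\<^sub>R g x) = c * L2_inner M f g"
  by (simp add: L2_inner_def)

lemma L2_inner_mult_right: "L2_inner M f (\<lambda>x. c * g x) = c * L2_inner M f g" for f :: "'a \<Rightarrow> real"
  using L2_inner_scaleR_right[of M f c g] by simp

lemma L2_inner_zero [simp]: "L2_inner M (\<lambda>x. 0) g = 0" "L2_inner M f (\<lambda>x. 0) = 0"
  by (simp_all add: L2_inner_def)

lemma L2_inner_cong_AE:
  assumes "AE x in M. f x = f' x" "AE x in M. g x = g' x"
    and "f \<in> borel_measurable M" "f' \<in> borel_measurable M" "g \<in> borel_measurable M" "g' \<in> borel_measurable M"
  shows "L2_inner M f g = L2_inner M f' g'"
proof -
  have "AE x in M. f x \<bullet> g x = f' x \<bullet> g' x" using assms(1,2) by eventually_elim simp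
  then show ?thesis
    unfolding L2_inner_def using assms(3-) by (intro integral_cong_AE borel_measurable_inner)
qed

lemma L2_inner_self_nonneg [simp]: "0 \<le> L2_inner M f f"
  by (simp add: L2_inner_def)

lemma L2_norm_nonneg [simp]: "0 \<le> L2_norm M f"
  by (simp add: L2_norm_def)

lemma L2_norm_power2: "(L2_norm M f)\<^sup>2 = L2_inner M f f"
  by (simp add: L2_norm_def)

lemma L2_norm_power2_add:
  assumes "f \<in> L2_space M" "g \<in> L2_space M"
  shows "(L2_norm M (\<lambda>x. f x + g x))\<^sup>2 = (L2_norm M f)\<^sup>2 + 2 * L2_inner M f g + (L2_norm M g)\<^sup>2"
  using L2_inner_commute[of M g f]
  unfolding L2_norm_power2 L2_inner_add_left[OF assms L2_space_add[OF assms]]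
    L2_inner_add_right[OF assms assms(1)] L2_inner_add_right[OF assms assms(2)] by simp

lemma L2_norm_scaleR: "L2_norm M (\<lambda>x. c *\<^sub>R f x) = \<bar>c\<bar> * L2_norm M f"
  by (simp add: L2_norm_def L2_inner_scaleR_left L2_inner_scaleR_right real_sqrt_mult flip: mult.assoc)

lemma L2_norm_mono_AE:
  fixes f :: "'a \<Rightarrow> 'b::euclidean_space" and g :: "'a \<Rightarrow> 'c::euclidean_space"
  assumes "f \<in> L2_space M" "g \<in> L2_space M" "AE x in M. norm (g x) \<le> norm (f x)"
  shows "L2_norm M g \<le> L2_norm M f"
  unfolding L2_norm_def L2_inner_def
proof (intro real_sqrt_le_mono integral_mono_AE integrable_L2_inner assms)
  show "AE x in M. g x \<bullet> g x \<le> f x \<bullet> f x"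
    using assms(3) by eventually_elim (simp flip: power2_norm_eq_inner)
qed

text \<open>The quadratic polynomial t -> |f - t g|^2 is nonnegative at its minimiser. The form is
  only semidefinite on functions, so the degenerate case <g, g> = 0 needs its own argument.\<close>

lemma L2_Cauchy_Schwarz:
  assumes f: "f \<in> L2_space M" and g: "g \<in> L2_space M"
  shows "\<bar>L2_inner M f g\<bar> \<le> L2_norm M f * L2_norm M g"
proof -
  have quad: "0 \<le> L2_inner M f f - 2 * t * L2_inner M f g + t\<^sup>2 * L2_inner M g g" for t
  proof -
    have "0 \<le> (L2_norm M (\<lambda>x. f x + (- t) *\<^sub>R g x))\<^sup>2" by simp
    also have "\<dots> = L2_inner M f f - 2 * t * L2_inner M f g + t\<^sup>2 * L2_inner M g g"
      by (subst L2_norm_power2_add[OF f L2_space_scaleR[OF g]])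
        (simp only: L2_norm_power2 L2_inner_scaleR_left L2_inner_scaleR_right, simp add: power2_eq_square)
    finally show ?thesis .
  qed
  have "(L2_inner M f g)\<^sup>2 \<le> L2_inner M f f * L2_inner M g g"
  proof (cases "L2_inner M g g = 0")
    case True
    have "L2_inner M f g = 0"
    proof (rule ccontr)
      assume n: "L2_inner M f g \<noteq> 0"
      \<comment> \<open>For <g, g> = 0 the polynomial is affine with nonzero slope; this t gives it
        the value -1.\<close>
      have "0 \<le> L2_inner M f f - (L2_inner M f f + 1)"
        using quad[of "(L2_inner M f f + 1) / (2 * L2_inner M f g)"] n True by simp
      then show False by simp
    qed
    then show ?thesis using True by simp
  next
    case False
    then have pos: "0 < L2_inner M g g" using L2_inner_self_nonneg[of M g] by linarith
    have "0 \<le> L2_inner M f f - (L2_inner M f g)\<^sup>2 / L2_inner M g g"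
      using quad[of "L2_inner M f g / L2_inner M g g"] pos by (simp add: power2_eq_square field_simps)
    then show ?thesis using pos by (simp add: field_simps)
  qed
  then have "sqrt ((L2_inner M f g)\<^sup>2) \<le> sqrt (L2_inner M f f * L2_inner M g g)" by (rule real_sqrt_le_mono)
  then show ?thesis by (simp add: L2_norm_def real_sqrt_mult)
qed

lemma L2_norm_triangle:
  assumes "f \<in> L2_space M" "g \<in> L2_space M"
  shows "L2_norm M (\<lambda>x. f x + g x) \<le> L2_norm M f + L2_norm M g"
proof (rule power2_le_imp_le)
  show "(L2_norm M (\<lambda>x. f x + g x))\<^sup>2 \<le> (L2_norm M f + L2_norm M g)\<^sup>2"
    using L2_Cauchy_Schwarz[OF assms] by (simp add: L2_norm_power2_add[OF assms] power2_sum)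
qed simp

section \<open>Completeness of L2\<close>

lemma nn_integral_L2:
  assumes "f \<in> L2_space M"
  shows "(\<integral>\<^sup>+x. ennreal ((norm (f x))\<^sup>2) \<partial>M) = ennreal ((L2_norm M f)\<^sup>2)"
  using L2_spaceD[OF assms]
  by (simp add: nn_integral_eq_integral L2_norm_power2 L2_inner_def power2_norm_eq_inner)

lemma L2_spaceI_nn_integral:
  assumes "f \<in> borel_measurable M" "(\<integral>\<^sup>+x. ennreal ((norm (f x))\<^sup>2) \<partial>M) < top"
  shows "f \<in> L2_space M"
  using assms by (auto simp: L2_space_def integrable_iff_bounded)

text \<open>The weight 2^k makes the integral of 2^k |f (k+1) - f k|^2 at most 2^(-k), so the series
  of these functions is finite almost everywhere; a \<le> 2^(-k) + 2^k a^2 then gives summability of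
  the increments themselves. This avoids an inclusion of L2 in L1, which fails for infinite
  measures.\<close>

lemma L2_Cauchy_AE_subseq:
  fixes f :: "nat \<Rightarrow> 'a \<Rightarrow> 'b::euclidean_space"
  assumes f: "\<And>n. f n \<in> L2_space M"
    and close: "\<And>k. L2_norm M (\<lambda>x. f (Suc k) x - f k x) \<le> (1/2)^k"
  shows "AE x in M. convergent (\<lambda>k. f k x)"
proof -
  have d: "(\<lambda>x. f (Suc k) x - f k x) \<in> L2_space M" for k by (intro L2_space_diff f)
  have [measurable]: "f n \<in> borel_measurable M" for n using f L2_spaceD by blast
  define a where "a k x = norm (f (Suc k) x - f k x)" for k x
  have [measurable]: "a k \<in> borel_measurable M" for k unfolding a_def by measurable
  have "(\<integral>\<^sup>+x. (\<Sum>k. ennreal (2^k * (a k x)\<^sup>2)) \<partial>M) = (\<Sum>k. \<integral>\<^sup>+x. ennreal (2^k * (a k x)\<^sup>2) \<partial>M)"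
    by (intro nn_integral_suminf) measurable
  also have "\<dots> \<le> (\<Sum>k. ennreal ((1/2)^k))"
  proof (intro suminf_le)
    fix k
    have "(\<integral>\<^sup>+x. ennreal (2^k * (a k x)\<^sup>2) \<partial>M) = ennreal (2^k) * ennreal ((L2_norm M (\<lambda>x. f (Suc k) x - f k x))\<^sup>2)"
      unfolding nn_integral_L2[OF d, symmetric] a_def
      by (subst nn_integral_cmult[symmetric]) (auto simp: ennreal_mult)
    also have "\<dots> \<le> ennreal (2^k) * ennreal (((1/2)^k)\<^sup>2)"
      by (intro mult_left_mono ennreal_leI power_mono close) auto
    also have "\<dots> = ennreal ((1/2)^k)"
      by (simp add: ennreal_mult[symmetric] power2_eq_square power_mult_distrib[symmetric] mult.assoc[symmetric])
    finally show "(\<integral>\<^sup>+x. ennreal (2^k * (a k x)\<^sup>2) \<partial>M) \<le> ennreal ((1/2)^k)" .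
  qed auto
  also have "\<dots> < top"
    by (subst suminf_ennreal2) (auto intro: summable_geometric)
  finally have "AE x in M. (\<Sum>k. ennreal (2^k * (a k x)\<^sup>2)) \<noteq> \<infinity>"
    by (intro nn_integral_noteq_infinite) auto
  then show ?thesis
  proof eventually_elim
    case (elim x)
    then have "summable (\<lambda>k. 2^k * (a k x)\<^sup>2)"
      by (intro summable_suminf_not_top) auto
    then have s: "summable (\<lambda>k. (1/2)^k + 2^k * (a k x)\<^sup>2)"
      by (intro summable_add summable_geometric) auto
    have "summable (\<lambda>k. f (Suc k) x - f k x)"
    proof (rule summable_comparison_test'[OF s])
      fix k
      \<comment> \<open>The inequality a \<le> 2^(-k) + 2^k a^2, multiplied by 2^k.\<close>
      have "0 \<le> (1 - 2^k * a k x)\<^sup>2 + (2^k * a k x)\<^sup>2 + 1" by simp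
      then have "2 * (2^k * a k x) \<le> 2 * (1 + (2^k * a k x)\<^sup>2)" by (simp add: power2_eq_square algebra_simps)
      then have "2^k * a k x \<le> 1 + 2^k * 2^k * (a k x)\<^sup>2" by (simp add: power2_eq_square algebra_simps)
      then have "(1/2)^k * (2^k * a k x) \<le> (1/2)^k * (1 + 2^k * 2^k * (a k x)\<^sup>2)" by (intro mult_left_mono) auto
      then have "a k x \<le> (1/2)^k + 2^k * (a k x)\<^sup>2"
        by (simp add: power_divide field_simps)
      then show "norm (f (Suc k) x - f k x) \<le> (1/2)^k + 2^k * (a k x)\<^sup>2" by (simp add: a_def)
    qed
    then have "convergent (\<lambda>n. \<Sum>k<n. f (Suc k) x - f k x)" by (simp add: summable_iff_convergent)
    then obtain l where "(\<lambda>n. \<Sum>k<n. f (Suc k) x - f k x) \<longlonglongrightarrow> l" by (auto simp: convergent_def)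
    then have "(\<lambda>n. f n x - f 0 x) \<longlonglongrightarrow> l" by (simp add: sum_lessThan_telescope[of "\<lambda>k. f k x"])
    from tendsto_add[OF this tendsto_const[of "f 0 x"]] show ?case
      unfolding convergent_def by auto
  qed
qed

text \<open>Riesz-Fischer: the limit is the pointwise limit of a fast subsequence, and Fatou's lemma
  transfers the Cauchy estimates to the distance from this limit, for every late index and not only
  along the subsequence.\<close>

theorem L2_complete:
  fixes f :: "nat \<Rightarrow> 'a \<Rightarrow> 'b::euclidean_space"
  assumes f: "\<And>n. f n \<in> L2_space M"
    and Cauchy: "\<And>e. 0 < e \<Longrightarrow> \<exists>N. \<forall>m\<ge>N. \<forall>n\<ge>N. L2_norm M (\<lambda>x. f m x - f n x) < e"
  obtains g where "g \<in> L2_space M" "(\<lambda>n. L2_norm M (\<lambda>x. f n x - g x)) \<longlonglongrightarrow> 0"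
proof -
  have [measurable]: "f n \<in> borel_measurable M" for n using f L2_spaceD by blast
  obtain N where N: "\<And>k m n. N k \<le> m \<Longrightarrow> N k \<le> n \<Longrightarrow> L2_norm M (\<lambda>x. f m x - f n x) < (1/2)^k"
    using Cauchy[of "(1/2)^k" for k] by (metis half_gt_zero_iff zero_less_one zero_less_power)
  \<comment> \<open>The running maximum makes \<open>r\<close> nondecreasing and keeps
    \<open>N k \<le> r k\<close>.\<close>
  define r where "r k = Max (N ` {..k})" for k
  have rN: "N k \<le> r k" for k unfolding r_def by (intro Max_ge) auto
  have rmono: "r j \<le> r k" if "j \<le> k" for j k unfolding r_def using that by (intro Max_mono) auto
  \<comment> \<open>Where the subsequence diverges, \<open>lim\<close> is an unspecified value; this
    happens on a null set only.\<close>
  define g where "g x = lim (\<lambda>k. f (r k) x)" for x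
  have [measurable]: "g \<in> borel_measurable M"
    unfolding g_def by (rule borel_measurable_lim_metric) measurable
  have ae: "AE x in M. (\<lambda>k. f (r k) x) \<longlonglongrightarrow> g x"
  proof -
    have "AE x in M. convergent (\<lambda>k. f (r k) x)"
    proof (rule L2_Cauchy_AE_subseq)
      show "L2_norm M (\<lambda>x. f (r (Suc k)) x - f (r k) x) \<le> (1/2)^k" for k
        using N[of k "r (Suc k)" "r k"] rN[of k] rmono[of k "Suc k"] by simp
    qed (rule f)
    then show ?thesis by eventually_elim (simp add: g_def convergent_LIMSEQ_iff)
  qed
  have est: "(\<integral>\<^sup>+x. ennreal ((norm (f n x - g x))\<^sup>2) \<partial>M) \<le> ennreal (((1/2)^k)\<^sup>2)" if n: "N k \<le> n" for n k
  proof -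
    have "(\<integral>\<^sup>+x. ennreal ((norm (f n x - g x))\<^sup>2) \<partial>M)
        = (\<integral>\<^sup>+x. liminf (\<lambda>j. ennreal ((norm (f n x - f (r j) x))\<^sup>2)) \<partial>M)"
    proof (rule nn_integral_cong_AE, use ae in eventually_elim)
      case (elim x)
      have "(\<lambda>j. ennreal ((norm (f n x - f (r j) x))\<^sup>2)) \<longlonglongrightarrow> ennreal ((norm (f n x - g x))\<^sup>2)"
        by (intro tendsto_intros elim)
      then show ?case by (intro lim_imp_Liminf[symmetric]) auto
    qed
    also have "\<dots> \<le> liminf (\<lambda>j. \<integral>\<^sup>+x. ennreal ((norm (f n x - f (r j) x))\<^sup>2) \<partial>M)"
      by (rule nn_integral_liminf) measurable
    also have "\<dots> \<le> limsup (\<lambda>j. \<integral>\<^sup>+x. ennreal ((norm (f n x - f (r j) x))\<^sup>2) \<partial>M)"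
      by (rule Liminf_le_Limsup) simp
    also have "\<dots> \<le> ennreal (((1/2)^k)\<^sup>2)"
    proof (rule Limsup_bounded)
      show "\<forall>\<^sub>F j in sequentially. (\<integral>\<^sup>+x. ennreal ((norm (f n x - f (r j) x))\<^sup>2) \<partial>M) \<le> ennreal (((1/2)^k)\<^sup>2)"
        using eventually_ge_at_top[of k]
      proof eventually_elim
        case (elim j)
        then have "N k \<le> r j" using rN[of k] rmono[of k j] by simp
        then show ?case
          unfolding nn_integral_L2[OF L2_space_diff[OF f f]]
          using N[of k n "r j"] n by (intro ennreal_leI power_mono) auto
      qed
    qed
    finally show ?thesis .
  qed
  have dL2: "(\<lambda>x. f n x - g x) \<in> L2_space M" if "N k \<le> n" for n k
    by (rule L2_spaceI_nn_integral) (use est[OF that] in \<open>auto intro: le_less_trans\<close>)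
  have gL2: "g \<in> L2_space M"
    using L2_space_diff[OF f dL2[of 0 "N 0"], of "N 0"] by simp
  have bound: "L2_norm M (\<lambda>x. f n x - g x) \<le> (1/2)^k" if n: "N k \<le> n" for n k
  proof -
    have "ennreal ((L2_norm M (\<lambda>x. f n x - g x))\<^sup>2) \<le> ennreal (((1/2)^k)\<^sup>2)"
      using est[OF n] nn_integral_L2[OF dL2[OF n]] by simp
    then have "(L2_norm M (\<lambda>x. f n x - g x))\<^sup>2 \<le> ((1/2)^k)\<^sup>2"
      by (subst (asm) ennreal_le_iff) simp_all
    then show ?thesis by (rule power2_le_imp_le) simp
  qed
  have "(\<lambda>n. L2_norm M (\<lambda>x. f n x - g x)) \<longlonglongrightarrow> 0"
  proof (rule LIMSEQ_I)
    fix e :: real assume "0 < e"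
    then obtain k where k: "(1/2)^k < e" using real_arch_pow_inv[of e "1/2"] by auto
    show "\<exists>no. \<forall>n\<ge>no. norm (L2_norm M (\<lambda>x. f n x - g x) - 0) < e"
      using bound k by (intro exI[of _ "N k"]) (auto intro: le_less_trans)
  qed
  then show ?thesis using gL2 that by blast
qed

section \<open>Continuously differentiable functions\<close>

lemma abs_le_imp_power2_le: "\<bar>x\<bar> \<le> y \<Longrightarrow> x\<^sup>2 \<le> y\<^sup>2" for x y :: real
  using power_mono[of "\<bar>x\<bar>" y 2] by simp

lemma GDERIV_unique:
  assumes "GDERIV f x :> D" "GDERIV f x :> D'"
  shows "D = D'"
proof -
  have "(\<lambda>h. h \<bullet> D) = (\<lambda>h. h \<bullet> D')"
    using assms unfolding gderiv_def by (rule has_derivative_unique)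
  then show ?thesis by (simp only: fun_eq_iff vector_eq_ldot)
qed

lemma grad_eqI: "GDERIV \<phi> x :> D \<Longrightarrow> grad \<phi> x = D"
  unfolding grad_def by (rule the_equality) (auto dest: GDERIV_unique)

lemma C1_functionsI:
  "(\<And>x. GDERIV \<phi> x :> D x) \<Longrightarrow> continuous_on UNIV D \<Longrightarrow> \<phi> \<in> C1_functions"
  by (auto simp: C1_functions_def)

lemma
  assumes "\<phi> \<in> C1_functions"
  shows GDERIV_grad: "GDERIV \<phi> x :> grad \<phi> x"
    and continuous_on_grad: "continuous_on UNIV (grad \<phi>)"
    and continuous_on_C1: "continuous_on UNIV \<phi>"
proof -
  obtain D where D: "\<And>x. GDERIV \<phi> x :> D x" "continuous_on UNIV D"
    using assms by (auto simp: C1_functions_def)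
  have "grad \<phi> = D" using D(1) by (auto intro!: ext grad_eqI)
  then show "GDERIV \<phi> x :> grad \<phi> x" "continuous_on UNIV (grad \<phi>)" using D by auto
  show "continuous_on UNIV \<phi>"
    using D(1) unfolding gderiv_def
    by (meson continuous_at_imp_continuous_on has_derivative_continuous)
qed

lemma C1_const: "(\<lambda>x. c) \<in> C1_functions"
  by (rule C1_functionsI[where D = "\<lambda>_. 0"]) (auto intro: GDERIV_const)

lemma
  assumes "\<phi> \<in> C1_functions" "\<psi> \<in> C1_functions"
  shows C1_add: "(\<lambda>x. \<phi> x + \<psi> x) \<in> C1_functions"
    and grad_add: "grad (\<lambda>x. \<phi> x + \<psi> x) = (\<lambda>x. grad \<phi> x + grad \<psi> x)"
    and C1_mult: "(\<lambda>x. \<phi> x * \<psi> x) \<in> C1_functions"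
proof -
  have g: "GDERIV (\<lambda>x. \<phi> x + \<psi> x) x :> grad \<phi> x + grad \<psi> x" for x
    using assms by (intro GDERIV_add GDERIV_grad)
  show "(\<lambda>x. \<phi> x + \<psi> x) \<in> C1_functions"
    using g by (rule C1_functionsI) (intro continuous_on_add continuous_on_grad assms)
  show "grad (\<lambda>x. \<phi> x + \<psi> x) = (\<lambda>x. grad \<phi> x + grad \<psi> x)"
    using g by (auto intro!: ext grad_eqI)
  have "GDERIV (\<lambda>x. \<phi> x * \<psi> x) x :> \<phi> x *\<^sub>R grad \<psi> x + \<psi> x *\<^sub>R grad \<phi> x" for x
    using assms by (intro GDERIV_mult GDERIV_grad)
  then show "(\<lambda>x. \<phi> x * \<psi> x) \<in> C1_functions"
    by (rule C1_functionsI) (intro continuous_on_add continuous_on_scaleR continuous_on_grad continuous_on_C1 assms)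
qed

lemma
  assumes "\<phi> \<in> C1_functions"
  shows C1_scale: "(\<lambda>x. c * \<phi> x) \<in> C1_functions"
    and grad_scale: "grad (\<lambda>x. c * \<phi> x) = (\<lambda>x. c *\<^sub>R grad \<phi> x)"
proof -
  have g: "GDERIV (\<lambda>x. c * \<phi> x) x :> c *\<^sub>R grad \<phi> x" for x
    using GDERIV_mult[OF GDERIV_const[of c x] GDERIV_grad[OF assms, of x]] by simp
  show "(\<lambda>x. c * \<phi> x) \<in> C1_functions"
    using g by (rule C1_functionsI) (intro continuous_on_scaleR continuous_on_const continuous_on_grad assms)
  show "grad (\<lambda>x. c * \<phi> x) = (\<lambda>x. c *\<^sub>R grad \<phi> x)"
    using g by (auto intro!: ext grad_eqI)
qed

lemma C1_prod:
  assumes "\<And>i. i \<in> I \<Longrightarrow> \<phi> i \<in> C1_functions"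
  shows "(\<lambda>x. \<Prod>i\<in>I. \<phi> i x) \<in> C1_functions"
  using assms
proof (induction I rule: infinite_finite_induct)
  case (insert i I)
  then show ?case by (simp add: C1_mult)
qed (simp_all add: C1_const)

lemma C1_compose:
  assumes "\<phi> \<in> C1_functions" "\<And>t. DERIV g t :> g' t" "continuous_on UNIV g'"
  shows "(\<lambda>x. g (\<phi> x)) \<in> C1_functions"
proof (rule C1_functionsI)
  show "GDERIV (\<lambda>x. g (\<phi> x)) x :> g' (\<phi> x) *\<^sub>R grad \<phi> x" for x
    by (rule GDERIV_DERIV_compose[OF GDERIV_grad[OF assms(1)] assms(2)])
  show "continuous_on UNIV (\<lambda>x. g' (\<phi> x) *\<^sub>R grad \<phi> x)"
    by (intro continuous_on_scaleR continuous_on_grad continuous_on_compose2[OF assms(3)] continuous_on_C1 assms) auto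
qed

lemma C1_affine: "(\<lambda>x. x \<bullet> v + c) \<in> C1_functions"
proof (rule C1_functionsI)
  show "GDERIV (\<lambda>x. x \<bullet> v + c) x :> v" for x
    unfolding gderiv_def by (auto intro!: derivative_eq_intros)
qed simp

section \<open>Measurability and square integrability of C1 functions\<close>

lemma borel_measurable_C1:
  assumes "\<phi> \<in> C1_functions" "(\<lambda>x. x) \<in> M \<rightarrow>\<^sub>M borel"
  shows "\<phi> \<in> borel_measurable M" "grad \<phi> \<in> borel_measurable M"
  using measurable_compose[OF assms(2) borel_measurable_continuous_onI[OF continuous_on_C1[OF assms(1)]]]
    measurable_compose[OF assms(2) borel_measurable_continuous_onI[OF continuous_on_grad[OF assms(1)]]]
  by simp_all

lemma measurable_ident_lebesgue_on: "(\<lambda>x. x) \<in> lebesgue_on \<Omega> \<rightarrow>\<^sub>M borel"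
  by (intro measurable_restrict_space1 measurable_completion) simp

lemma bounded_continuous_L2:
  fixes f :: "'a::euclidean_space \<Rightarrow> 'b::euclidean_space"
  assumes "continuous_on UNIV f" "bounded \<Omega>" "(\<lambda>x. x) \<in> M \<rightarrow>\<^sub>M borel" "space M = \<Omega>" "finite_measure M"
  shows "f \<in> L2_space M"
proof -
  interpret finite_measure M by fact
  have "compact (closure \<Omega>)" using assms(2) by simp
  then have "bounded (f ` closure \<Omega>)"
    using assms(1) by (intro compact_imp_bounded compact_continuous_image) (auto intro: continuous_on_subset)
  then obtain B where B: "\<And>x. x \<in> closure \<Omega> \<Longrightarrow> norm (f x) \<le> B" by (auto simp: bounded_iff)
  have m: "f \<in> borel_measurable M"
    using measurable_compose[OF assms(3) borel_measurable_continuous_onI[OF assms(1)]] .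
  have "integrable M (\<lambda>x. (norm (f x))\<^sup>2)"
  proof (rule integrable_const_bound[where B = "B\<^sup>2"])
    show "AE x in M. norm ((norm (f x))\<^sup>2) \<le> B\<^sup>2"
      using B closure_subset assms(4) by (intro AE_I2) (auto intro!: power_mono)
  qed (use m in auto)
  then show ?thesis using m by (simp add: L2_space_def)
qed

lemma
  fixes \<Omega> :: "'a::euclidean_space set"
  assumes "\<phi> \<in> C1_functions" "bounded \<Omega>" "open \<Omega>"
  shows C1_in_L2: "\<phi> \<in> L2_space (lebesgue_on \<Omega>)"
    and grad_in_L2: "grad \<phi> \<in> L2_space (lebesgue_on \<Omega>)"
proof -
  have "\<Omega> \<in> lmeasurable" using assms by (simp add: bounded_set_imp_lmeasurable borel_open sets_completionI_sets)
  then have "finite_measure (lebesgue_on \<Omega>)" by (rule finite_measure_lebesgue_on)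
  then show "\<phi> \<in> L2_space (lebesgue_on \<Omega>)" "grad \<phi> \<in> L2_space (lebesgue_on \<Omega>)"
    using assms by (auto intro!: bounded_continuous_L2 continuous_on_C1 continuous_on_grad measurable_ident_lebesgue_on)
qed

text \<open>The fundamental theorem of calculus along the segment, followed by Cauchy-Schwarz in the
  parameter, which yields the factor s. The bound takes values in \<open>ennreal\<close> so that it
  can be integrated in x and the integrals exchanged by Tonelli without integrability
  conditions.\<close>

lemma C1_line_estimate:
  fixes \<phi> :: "'a::euclidean_space \<Rightarrow> real"
  assumes "\<phi> \<in> C1_functions" "0 \<le> s"
  shows "ennreal ((\<phi> (x + s *\<^sub>R v) - \<phi> x)\<^sup>2)
    \<le> ennreal (s * (norm v)\<^sup>2) * (\<integral>\<^sup>+t. ennreal ((norm (grad \<phi> (x + t *\<^sub>R v)))\<^sup>2) * indicator {0..s} t \<partial>lborel)"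
proof -
  define f where "f t = grad \<phi> (x + t *\<^sub>R v) \<bullet> v" for t :: real
  define G where "G t = norm (grad \<phi> (x + t *\<^sub>R v))" for t :: real
  have contG: "continuous_on UNIV (\<lambda>t. grad \<phi> (x + t *\<^sub>R v))"
    by (intro continuous_on_compose2[OF continuous_on_grad[OF assms(1)]] continuous_intros) auto
  have contf: "continuous_on UNIV f" unfolding f_def by (intro continuous_intros contG)
  have "continuous_on UNIV G" unfolding G_def by (intro continuous_intros contG)
  then have [measurable]: "G \<in> borel_measurable borel" by (rule borel_measurable_continuous_onI)
  have der: "DERIV (\<lambda>t. \<phi> (x + t *\<^sub>R v)) t :> f t" for t
  proof -
    have "((\<lambda>t. \<phi> (x + t *\<^sub>R v)) has_derivative (\<lambda>h. (h *\<^sub>R v) \<bullet> grad \<phi> (x + t *\<^sub>R v))) (at t)"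
    proof (rule has_derivative_compose[of "\<lambda>t. x + t *\<^sub>R v" "\<lambda>h. h *\<^sub>R v" t UNIV \<phi>, simplified])
      show "((\<lambda>t. x + t *\<^sub>R v) has_derivative (\<lambda>h. h *\<^sub>R v)) (at t)" by (auto intro!: derivative_eq_intros)
      show "(\<phi> has_derivative (\<lambda>h. h \<bullet> grad \<phi> (x + t *\<^sub>R v))) (at (x + t *\<^sub>R v))"
        using GDERIV_grad[OF assms(1)] by (simp add: gderiv_def)
    qed
    then show ?thesis
      by (simp add: has_field_derivative_def f_def inner_commute mult_commute_abs)
  qed
  have ftc: "has_bochner_integral lborel (\<lambda>t. f t * indicator {0..s} t) (\<phi> (x + s *\<^sub>R v) - \<phi> (x + 0 *\<^sub>R v))"
    using assms(2) der contf by (intro has_bochner_integral_FTC_Icc_real)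
      (auto intro: DERIV_subset has_field_derivative_at_within simp: continuous_on_eq_continuous_at)
  have I1: "(\<lambda>t. indicator {0..s} t :: real) \<in> L2_space lborel"
  proof -
    have "(\<lambda>t. (norm (indicator {0..s} t :: real))\<^sup>2) = indicator {0..s}" by (auto simp: indicator_def)
    moreover have "integrable lborel (indicator {0..s} :: real \<Rightarrow> real)"
      using assms(2) by (intro integrable_real_indicator) auto
    ultimately show ?thesis by (simp add: L2_space_def)
  qed
  have If: "(\<lambda>t. f t * indicator {0..s} t) \<in> L2_space lborel"
  proof -
    have "continuous_on UNIV (\<lambda>t. (f t)\<^sup>2)" by (intro continuous_intros contf)
    then have "integrable lborel (\<lambda>t. indicator {0..s} t *\<^sub>R (f t)\<^sup>2)"
      using borel_integrable_compact[of "{0..s}" "\<lambda>t. (f t)\<^sup>2"] by (auto intro: continuous_on_subset)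
    then have "integrable lborel (\<lambda>t. (norm (f t * indicator {0..s} t))\<^sup>2)"
      by (rule Bochner_Integration.integrable_cong[THEN iffD1, rotated -1]) (auto simp: indicator_def)
    then show ?thesis using borel_measurable_continuous_onI[OF contf] by (simp add: L2_space_def)
  qed
  have "(\<phi> (x + s *\<^sub>R v) - \<phi> x) = L2_inner lborel (\<lambda>t. f t * indicator {0..s} t) (\<lambda>t. indicator {0..s} t)"
  proof -
    have "(\<lambda>t. (f t * indicator {0..s} t) \<bullet> indicator {0..s} t) = (\<lambda>t. f t * indicator {0..s} t)"
      by (auto simp: indicator_def)
    then show ?thesis using has_bochner_integral_integral_eq[OF ftc] by (simp add: L2_inner_def)
  qed
  then have "\<bar>\<phi> (x + s *\<^sub>R v) - \<phi> x\<bar> \<le>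
      L2_norm lborel (\<lambda>t. f t * indicator {0..s} t) * L2_norm lborel (\<lambda>t. indicator {0..s} t :: real)"
    using L2_Cauchy_Schwarz[OF If I1] by simp
  then have "(\<phi> (x + s *\<^sub>R v) - \<phi> x)\<^sup>2 \<le>
      (L2_norm lborel (\<lambda>t. f t * indicator {0..s} t) * L2_norm lborel (\<lambda>t. indicator {0..s} t :: real))\<^sup>2"
    by (rule abs_le_imp_power2_le)
  also have "\<dots> = s * (L2_norm lborel (\<lambda>t. f t * indicator {0..s} t))\<^sup>2"
  proof -
    have "(L2_norm lborel (\<lambda>t. indicator {0..s} t :: real))\<^sup>2 = s"
    proof -
      have "(\<lambda>t. (indicator {0..s} t :: real) \<bullet> indicator {0..s} t) = indicator {0..s}"
        by (auto simp: indicator_def)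
      then show ?thesis using assms(2) by (simp add: L2_norm_power2 L2_inner_def)
    qed
    then show ?thesis by (simp add: power_mult_distrib)
  qed
  finally have "ennreal ((\<phi> (x + s *\<^sub>R v) - \<phi> x)\<^sup>2) \<le> ennreal s * ennreal ((L2_norm lborel (\<lambda>t. f t * indicator {0..s} t))\<^sup>2)"
    using assms(2) by (simp add: ennreal_leI flip: ennreal_mult)
  also have "ennreal ((L2_norm lborel (\<lambda>t. f t * indicator {0..s} t))\<^sup>2)
      = (\<integral>\<^sup>+t. ennreal ((norm (f t * indicator {0..s} t))\<^sup>2) \<partial>lborel)"
    by (rule nn_integral_L2[OF If, symmetric])
  also have "\<dots> \<le> (\<integral>\<^sup>+t. ennreal ((norm v)\<^sup>2) * (ennreal ((G t)\<^sup>2) * indicator {0..s} t) \<partial>lborel)"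
  proof (rule nn_integral_mono)
    fix t
    have "\<bar>f t\<bar> \<le> norm v * G t" using Cauchy_Schwarz_ineq2[of "grad \<phi> (x + t *\<^sub>R v)" v] by (simp add: f_def G_def mult.commute)
    then have "(f t)\<^sup>2 \<le> (norm v * G t)\<^sup>2" by (rule abs_le_imp_power2_le)
    then show "ennreal ((norm (f t * indicator {0..s} t))\<^sup>2) \<le> ennreal ((norm v)\<^sup>2) * (ennreal ((G t)\<^sup>2) * indicator {0..s} t)"
      by (auto simp: indicator_def ennreal_leI power_mult_distrib simp flip: ennreal_mult)
  qed
  also have "\<dots> = ennreal ((norm v)\<^sup>2) * (\<integral>\<^sup>+t. ennreal ((G t)\<^sup>2) * indicator {0..s} t \<partial>lborel)"
    by (rule nn_integral_cmult) measurable
  finally show ?thesis using assms(2) by (simp add: G_def ennreal_mult mult.assoc mult_left_mono)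
qed

section \<open>Cut-off functions for boxes and the fundamental lemma of the calculus of
  variations\<close>

definition square_pos :: "real \<Rightarrow> real" where
  "square_pos t = (max 0 t)\<^sup>2"

lemma DERIV_square_pos: "DERIV square_pos t :> 2 * max 0 t"
proof (cases t "0::real" rule: linorder_cases)
  case less
  have "DERIV (\<lambda>t. 0) t :> (0::real)" by simp
  then have "DERIV square_pos t :> 0"
    by (rule has_field_derivative_transform_within_open[of _ _ _ "{..<0}"])
      (use less in \<open>auto simp: square_pos_def\<close>)
  then show ?thesis using less by simp
next
  case equal
  have "((\<lambda>h. square_pos h / h) \<longlongrightarrow> 0) (at 0)"
  proof (rule tendsto_0_le[where K = 1])
    show "((\<lambda>h. h) \<longlongrightarrow> (0::real)) (at 0)" by (rule tendsto_ident_at)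
    show "\<forall>\<^sub>F h in at 0. norm (square_pos h / h) \<le> norm h * 1"
    proof (rule always_eventually, rule allI)
      show "norm (square_pos h / h) \<le> norm h * 1" for h
        by (cases "0 < h") (auto simp: square_pos_def power2_eq_square max_def)
    qed
  qed
  then show ?thesis using equal by (simp add: DERIV_def square_pos_def)
next
  case greater
  have "DERIV (\<lambda>t. t\<^sup>2) t :> 2 * t" by (auto intro!: derivative_eq_intros)
  then have "DERIV square_pos t :> 2 * t"
    by (rule has_field_derivative_transform_within_open[of _ _ _ "{0<..}"])
      (use greater in \<open>auto simp: square_pos_def\<close>)
  then show ?thesis using greater by simp
qed

text \<open>There is one factor per face. It is positive on the inner side of its face and zero
  beyond it, and squaring the positive part makes it continuously differentiable across the
  face.\<close>

definition box_bump :: "'a::euclidean_space \<Rightarrow> 'a \<Rightarrow> 'a \<Rightarrow> real" where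
  "box_bump a b x = (\<Prod>i\<in>Basis. square_pos (x \<bullet> i - a \<bullet> i) * square_pos (b \<bullet> i - x \<bullet> i))"

lemma box_bump_pos: "x \<in> box a b \<Longrightarrow> 0 < box_bump a b x"
  unfolding box_bump_def by (intro prod_pos) (auto simp: mem_box square_pos_def)

lemma box_bump_zero: "x \<notin> box a b \<Longrightarrow> box_bump a b x = 0"
  unfolding box_bump_def by (force simp: mem_box square_pos_def not_less intro!: prod_zero)

lemma box_bump_nonneg: "0 \<le> box_bump a b x"
  by (cases "x \<in> box a b") (auto dest: box_bump_pos box_bump_zero)

lemma C1_box_bump: "box_bump a b \<in> C1_functions"
  unfolding box_bump_def[abs_def]
proof (intro C1_prod C1_mult)
  fix i :: 'a
  have cont: "continuous_on UNIV (\<lambda>t. 2 * max 0 t :: real)" by (intro continuous_intros)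
  show "(\<lambda>x. square_pos (x \<bullet> i - a \<bullet> i)) \<in> C1_functions"
    using C1_compose[OF C1_affine[of i "- (a \<bullet> i)"] DERIV_square_pos cont] by simp
  show "(\<lambda>x. square_pos (b \<bullet> i - x \<bullet> i)) \<in> C1_functions"
    using C1_compose[OF C1_affine[of "- i" "b \<bullet> i"] DERIV_square_pos cont] by simp
qed

text \<open>Off the box the bump vanishes and the value is 1 - 1 = 0; where the bump is at least 1/n
  the value is 1. These C1 functions with values in [0, 1] converge pointwise to the indicator of
  the open box, as dominated convergence requires.\<close>

definition box_cutoff :: "nat \<Rightarrow> 'a::euclidean_space \<Rightarrow> 'a \<Rightarrow> 'a \<Rightarrow> real" where
  "box_cutoff n a b x = 1 - square_pos (1 - real n * box_bump a b x)"

lemma C1_box_cutoff: "box_cutoff n a b \<in> C1_functions"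
proof -
  have "(\<lambda>x. - real n * box_bump a b x + 1) \<in> C1_functions"
    by (intro C1_add C1_scale C1_box_bump C1_const)
  then have "(\<lambda>x. square_pos (- real n * box_bump a b x + 1)) \<in> C1_functions"
    by (rule C1_compose[OF _ DERIV_square_pos]) (intro continuous_intros)
  then have "(\<lambda>x. 1 + (-1) * square_pos (- real n * box_bump a b x + 1)) \<in> C1_functions"
    by (intro C1_add C1_scale C1_const)
  then show ?thesis by (simp add: box_cutoff_def[abs_def] add.commute)
qed

lemma box_cutoff_zero: "x \<notin> box a b \<Longrightarrow> box_cutoff n a b x = 0"
  by (simp add: box_cutoff_def box_bump_zero square_pos_def)

lemma box_cutoff_bounds: "0 \<le> box_cutoff n a b x" "box_cutoff n a b x \<le> 1"
proof -
  have "0 \<le> real n * box_bump a b x" by (simp add: box_bump_nonneg)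
  then have "(max 0 (1 - real n * box_bump a b x))\<^sup>2 \<le> 1" by (intro power_le_one) auto
  then show "0 \<le> box_cutoff n a b x" by (simp add: box_cutoff_def square_pos_def)
qed (simp add: box_cutoff_def square_pos_def)

lemma box_cutoff_tendsto: "(\<lambda>n. box_cutoff n a b x) \<longlonglongrightarrow> indicator (box a b) x"
proof (cases "x \<in> box a b")
  case True
  obtain N where N: "1 / box_bump a b x \<le> real N" using real_arch_simple by blast
  have "\<forall>\<^sub>F n in sequentially. box_cutoff n a b x = 1"
    using eventually_ge_at_top[of N]
  proof eventually_elim
    case (elim n)
    have "1 / box_bump a b x \<le> real n" using N elim by linarith
    then have "1 \<le> real n * box_bump a b x" using box_bump_pos[OF True] by (simp add: field_simps)
    then show ?case by (simp add: box_cutoff_def square_pos_def)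
  qed
  then show ?thesis using True by (simp add: tendsto_eventually)
qed (simp add: box_cutoff_zero)

text \<open>\<open>M\<close> is a general measure because both volume and surface measure are needed
  later. On the box, the positive and the negative part of h are densities of two finite measures
  that agree on all boxes, hence on all Borel sets; comparing them on {h > 0} and on {h < 0} shows
  that both densities vanish.\<close>

lemma zero_AE_on_box:
  fixes M :: "'a::euclidean_space measure"
  assumes id: "(\<lambda>x. x) \<in> M \<rightarrow>\<^sub>M borel" and h: "h \<in> borel_measurable borel"
    and int: "integrable M (\<lambda>x. indicator (box a b) x * h x)"
    and zero: "\<And>\<phi>. \<phi> \<in> C1_functions \<Longrightarrow> (\<And>x. x \<notin> box a b \<Longrightarrow> \<phi> x = 0) \<Longrightarrow> (LINT x|M. h x * \<phi> x) = 0"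
  shows "AE x in M. x \<in> box a b \<longrightarrow> h x = 0"
proof -
  let ?J = "box a b"
  have meas: "f \<in> borel_measurable M" if "f \<in> borel_measurable borel" for f :: "'a \<Rightarrow> 'c::topological_space"
    using measurable_compose[OF id that] .
  have hM: "h \<in> borel_measurable M" by (rule meas[OF h])
  have setsM: "A \<inter> space M \<in> sets M" if "A \<in> sets borel" for A
    using measurable_sets[OF id that] by (simp add: vimage_def Int_def)
  have indM: "(indicator A :: 'a \<Rightarrow> real) \<in> borel_measurable M" if "A \<in> sets borel" for A
    using that by (intro meas) simp
  have indE: "(indicator A :: 'a \<Rightarrow> ennreal) \<in> borel_measurable M" if "A \<in> sets borel" for A
    using that by (intro meas) simp
  have box0: "(LINT x|M. indicator (box c d) x * (indicator ?J x * h x)) = 0" for c d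
  proof -
    \<comment> \<open>Intersecting with the given box makes the cut-offs vanish off it, so that
      \<open>zero\<close> applies to them.\<close>
    obtain u v where uv: "box c d \<inter> ?J = box u v" by (rule that[OF box_Int_box])
    have sub: "box u v \<subseteq> ?J" using uv by blast
    have "(\<lambda>n. LINT x|M. h x * box_cutoff n u v x) \<longlonglongrightarrow> (LINT x|M. h x * indicator (box u v) x)"
    proof (rule integral_dominated_convergence[where w = "\<lambda>x. norm (indicator ?J x * h x)"])
      show "integrable M (\<lambda>x. norm (indicator ?J x * h x))" using int by (rule integrable_norm)
      show "(\<lambda>x. h x * box_cutoff n u v x) \<in> borel_measurable M" for n
        by (intro borel_measurable_times hM borel_measurable_C1[OF C1_box_cutoff id])
      show "(\<lambda>x. h x * indicator (box u v) x) \<in> borel_measurable M"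
        by (intro borel_measurable_times hM indM) simp
      show "AE x in M. (\<lambda>n. h x * box_cutoff n u v x) \<longlonglongrightarrow> h x * indicator (box u v) x"
        by (intro AE_I2 tendsto_mult tendsto_const box_cutoff_tendsto)
      fix n
      have "norm (h x * box_cutoff n u v x) \<le> norm (indicator ?J x * h x)" for x
      proof (cases "x \<in> box u v")
        case True
        then have "x \<in> ?J" using sub by blast
        then show ?thesis
          using box_cutoff_bounds[of n u v x] by (simp add: abs_mult mult_left_le)
      qed (simp add: box_cutoff_zero)
      then show "AE x in M. norm (h x * box_cutoff n u v x) \<le> norm (indicator ?J x * h x)" by simp
    qed
    moreover have "(LINT x|M. h x * box_cutoff n u v x) = 0" for n
      using sub by (intro zero C1_box_cutoff box_cutoff_zero) blast
    ultimately have "(LINT x|M. h x * indicator (box u v) x) = 0"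
      by (simp add: LIMSEQ_const_iff)
    moreover have "h x * indicator (box u v) x = indicator (box c d) x * (indicator ?J x * h x)" for x
      unfolding uv[symmetric] by (simp add: indicator_inter_arith mult_ac)
    ultimately show ?thesis by simp
  qed
  define P where "P x = ennreal (indicator ?J x * h x)" for x
  define N where "N x = ennreal (- (indicator ?J x * h x))" for x
  have P: "P \<in> borel_measurable borel" and N: "N \<in> borel_measurable borel"
    unfolding P_def N_def using h by measurable
  have emP: "emeasure (distr (density M P) borel (\<lambda>x. x)) A = (\<integral>\<^sup>+x. P x * indicator A x \<partial>M)"
    and emN: "emeasure (distr (density M N) borel (\<lambda>x. x)) A = (\<integral>\<^sup>+x. N x * indicator A x \<partial>M)"
    if A: "A \<in> sets borel" for A
  proof -
    have id': "(\<lambda>x. x) \<in> density M Q \<rightarrow>\<^sub>M borel" for Q using id by simp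
    have ind: "(\<integral>\<^sup>+x. Q x * indicator (A \<inter> space M) x \<partial>M) = (\<integral>\<^sup>+x. Q x * indicator A x \<partial>M)" for Q :: "'a \<Rightarrow> ennreal"
      by (intro nn_integral_cong) (auto simp: indicator_def)
    have "emeasure (distr (density M Q) borel (\<lambda>x. x)) A = (\<integral>\<^sup>+x. Q x * indicator A x \<partial>M)"
      if "Q \<in> borel_measurable borel" for Q
      using A setsM[OF A] meas[OF that] unfolding emeasure_distr[OF id' A]
      by (simp add: vimage_def Int_def[symmetric] emeasure_density ind)
    then show "emeasure (distr (density M P) borel (\<lambda>x. x)) A = (\<integral>\<^sup>+x. P x * indicator A x \<partial>M)"
      "emeasure (distr (density M N) borel (\<lambda>x. x)) A = (\<integral>\<^sup>+x. N x * indicator A x \<partial>M)"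
      using P N by auto
  qed
  have fin: "(\<integral>\<^sup>+x. P x * indicator A x \<partial>M) < top" for A
  proof -
    have "(\<integral>\<^sup>+x. P x * indicator A x \<partial>M) \<le> (\<integral>\<^sup>+x. ennreal (norm (indicator ?J x * h x)) \<partial>M)"
      by (intro nn_integral_mono) (auto simp: P_def indicator_def intro!: ennreal_leI)
    also have "\<dots> < top" using int by (simp add: integrable_iff_bounded)
    finally show ?thesis .
  qed
  have box_eq: "(\<integral>\<^sup>+x. P x * indicator (box c d) x \<partial>M) = (\<integral>\<^sup>+x. N x * indicator (box c d) x \<partial>M)" for c d
  proof -
    let ?f = "\<lambda>x. indicator (box c d) x * (indicator ?J x * h x)"
    have "integrable M ?f"
    proof (rule Bochner_Integration.integrable_bound[OF int])
      show "?f \<in> borel_measurable M" by (intro borel_measurable_times hM indM) simp_all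
      show "AE x in M. norm (?f x) \<le> norm (indicator ?J x * h x)" by (simp add: indicator_def)
    qed
    then have "(LINT x|M. ?f x) = enn2real (\<integral>\<^sup>+x. ennreal (?f x) \<partial>M) - enn2real (\<integral>\<^sup>+x. ennreal (- ?f x) \<partial>M)"
      "(\<integral>\<^sup>+x. ennreal (?f x) \<partial>M) < top" "(\<integral>\<^sup>+x. ennreal (- ?f x) \<partial>M) < top"
      by (auto simp: real_lebesgue_integral_def real_integrable_def less_top)
    moreover have "(\<integral>\<^sup>+x. ennreal (?f x) \<partial>M) = (\<integral>\<^sup>+x. P x * indicator (box c d) x \<partial>M)"
      "(\<integral>\<^sup>+x. ennreal (- ?f x) \<partial>M) = (\<integral>\<^sup>+x. N x * indicator (box c d) x \<partial>M)"
      by (auto intro!: nn_integral_cong simp: P_def N_def indicator_def)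
    ultimately show ?thesis using box0[of c d] by (metis eq_iff_diff_eq_0 ennreal_enn2real)
  qed
  \<comment> \<open>Both measures are pushed forward to the Borel sets, because the sigma-algebra of
    \<open>M\<close> may differ from the one generated by boxes.\<close>
  have "distr (density M P) borel (\<lambda>x. x) = distr (density M N) borel (\<lambda>x. x)"
  proof (rule measure_eqI_generator_eq[where E = "range (\<lambda>(a, b). box a b)" and \<Omega> = UNIV
      and A = "\<lambda>n. box (- (real n *\<^sub>R One)) (real n *\<^sub>R One)"])
    show "Int_stable (range (\<lambda>(a, b). box a b :: 'a set))"
      by (auto simp: Int_stable_def box_Int_box)
    show "sets (distr (density M P) borel (\<lambda>x. x)) = sigma_sets UNIV (range (\<lambda>(a, b). box a b))"
      "sets (distr (density M N) borel (\<lambda>x. x)) = sigma_sets UNIV (range (\<lambda>(a, b). box a b))"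
      by (simp_all add: borel_eq_box)
    show "(\<Union>n. box (- (real n *\<^sub>R One)) (real n *\<^sub>R One)) = (UNIV :: 'a set)"
      by (rule UN_box_eq_UNIV)
    fix X :: "'a set" assume "X \<in> range (\<lambda>(a, b). box a b)"
    then show "emeasure (distr (density M P) borel (\<lambda>x. x)) X = emeasure (distr (density M N) borel (\<lambda>x. x)) X"
      by (auto simp: emP emN box_eq)
  next
    show "emeasure (distr (density M P) borel (\<lambda>x. x)) (box (- (real n *\<^sub>R One)) (real n *\<^sub>R One)) \<noteq> \<infinity>" for n
      using fin by (simp add: emP less_top)
  qed auto
  then have eq: "(\<integral>\<^sup>+x. P x * indicator A x \<partial>M) = (\<integral>\<^sup>+x. N x * indicator A x \<partial>M)" if "A \<in> sets borel" for A
    using emP[OF that] emN[OF that] by simp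
  have pos: "{x. 0 < h x} \<in> sets borel" "{x. h x < 0} \<in> sets borel" using h by measurable
  have "(\<integral>\<^sup>+x. P x * indicator {x. 0 < h x} x \<partial>M) = 0"
  proof -
    have "(\<lambda>x. N x * indicator {x. 0 < h x} x) = (\<lambda>_. 0)" by (auto simp: N_def indicator_def ennreal_neg fun_eq_iff)
    then show ?thesis unfolding eq[OF pos(1)] by (simp only: nn_integral_const mult_zero_left)
  qed
  then have 1: "AE x in M. P x * indicator {x. 0 < h x} x = 0"
    by (subst (asm) nn_integral_0_iff_AE) (auto intro!: borel_measurable_times_ennreal meas[OF P] indE pos)
  have "(\<integral>\<^sup>+x. N x * indicator {x. h x < 0} x \<partial>M) = 0"
  proof -
    have "(\<lambda>x. P x * indicator {x. h x < 0} x) = (\<lambda>_. 0)" by (auto simp: P_def indicator_def ennreal_neg fun_eq_iff)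
    then show ?thesis unfolding eq[OF pos(2), symmetric] by (simp only: nn_integral_const mult_zero_left)
  qed
  then have 2: "AE x in M. N x * indicator {x. h x < 0} x = 0"
    by (subst (asm) nn_integral_0_iff_AE) (auto intro!: borel_measurable_times_ennreal meas[OF N] indE pos)
  show ?thesis using 1 2
  proof eventually_elim
    case (elim x)
    show ?case
    proof
      assume "x \<in> box a b"
      then show "h x = 0" using elim by (cases "h x" "0::real" rule: linorder_cases) (auto simp: P_def N_def)
    qed
  qed
qed

text \<open>A C1 function vanishing off a box has its support in the closed box, so it is a test
  function as soon as the closed box lies in \<open>U\<close>. Such boxes cover \<open>U\<close>,
  and by Lindelof countably many suffice, so the exceptional null sets can be united.\<close>

theorem zero_AE_on_open:
  fixes M :: "'a::euclidean_space measure"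
  assumes id: "(\<lambda>x. x) \<in> M \<rightarrow>\<^sub>M borel" and h: "h \<in> borel_measurable borel" and U: "open U"
    and int: "\<And>a b. cbox a b \<subseteq> U \<Longrightarrow> integrable M (\<lambda>x. indicator (box a b) x * h x)"
    and zero: "\<And>\<phi>. \<phi> \<in> test_functions U \<Longrightarrow> (LINT x|M. h x * \<phi> x) = 0"
  shows "AE x in M. x \<in> U \<longrightarrow> h x = 0"
proof -
  define F where "F = {box a b | a b :: 'a. cbox a b \<subseteq> U}"
  have "\<Union>F = U"
  proof
    show "\<Union>F \<subseteq> U" using box_subset_cbox by (fastforce simp: F_def)
    show "U \<subseteq> \<Union>F"
    proof
      fix x assume "x \<in> U"
      then obtain e where e: "0 < e" "cball x e \<subseteq> U" using U by (meson open_contains_cball)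
      obtain a b where ab: "x \<in> box a b" "box a b \<subseteq> ball x e" using rational_boxes[OF e(1)] by metis
      have "box a b \<noteq> {}" using ab(1) by blast
      then have "cbox a b = closure (box a b)" by (rule closure_box[symmetric])
      also have "\<dots> \<subseteq> cball x e" using closure_mono[OF ab(2)] e(1) by simp
      finally have "box a b \<in> F" using e(2) unfolding F_def by blast
      then show "x \<in> \<Union>F" using ab(1) by blast
    qed
  qed
  obtain F' where F': "F' \<subseteq> F" "countable F'" "\<Union>F' = \<Union>F"
    by (rule Lindelof[of F]) (auto simp: F_def)
  have "AE x in M. \<forall>B\<in>F'. x \<in> B \<longrightarrow> h x = 0"
  proof (subst AE_ball_countable[OF F'(2)], intro ballI)
    fix B assume "B \<in> F'"
    then obtain a b where ab: "B = box a b" "cbox a b \<subseteq> U" using F'(1) by (auto simp: F_def)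
    show "AE x in M. x \<in> B \<longrightarrow> h x = 0"
      unfolding ab(1)
    proof (rule zero_AE_on_box[OF id h int[OF ab(2)] zero])
      fix \<phi> :: "'a \<Rightarrow> real" assume \<phi>: "\<phi> \<in> C1_functions" "\<And>x. x \<notin> box a b \<Longrightarrow> \<phi> x = 0"
      have "closure {x. \<phi> x \<noteq> 0} \<subseteq> cbox a b"
        using \<phi>(2) box_subset_cbox by (intro closure_minimal) (auto intro: closed_cbox)
      then show "\<phi> \<in> test_functions U"
        using \<phi>(1) ab(2) bounded_subset[OF bounded_cbox]
        by (auto simp: test_functions_def compact_eq_bounded_closed)
    qed
  qed
  then show ?thesis
  proof eventually_elim
    case (elim x)
    then show ?case using F'(3) \<open>\<Union>F = U\<close> by blast
  qed
qed

section \<open>Weak divergence and normal traces\<close>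

text \<open>Bridges a gap: the fundamental lemma asks for a Borel function, while the elements of L2
  on a domain are only Lebesgue measurable.\<close>

lemma lebesgue_on_borel_representative:
  fixes f :: "'a::euclidean_space \<Rightarrow> real"
  assumes f: "f \<in> borel_measurable (lebesgue_on \<Omega>)" and \<Omega>: "\<Omega> \<in> sets lebesgue"
  obtains f' where "f' \<in> borel_measurable borel" "AE x in lebesgue_on \<Omega>. f x = f' x"
proof -
  have "(\<lambda>x. indicator \<Omega> x *\<^sub>R f x) \<in> borel_measurable lebesgue"
    using f \<Omega> by (simp add: borel_measurable_restrict_space_iff)
  then obtain f' where f': "f' \<in> borel_measurable lborel" "AE x in lborel. indicator \<Omega> x *\<^sub>R f x = f' x"
    using completion_ex_borel_measurable_real by blast
  have "AE x in lebesgue. indicator \<Omega> x *\<^sub>R f x = f' x" using f'(2) by (rule AE_completion)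
  then have "AE x in lebesgue_on \<Omega>. f x = f' x"
    using \<Omega> by (subst AE_restrict_space_iff) auto
  then show ?thesis using that f'(1) by simp
qed

lemma test_functions_C1: "\<phi> \<in> test_functions \<Omega> \<Longrightarrow> \<phi> \<in> C1_functions"
  by (simp add: test_functions_def)

lemma test_functions_zero:
  assumes "\<phi> \<in> test_functions \<Omega>" "x \<notin> \<Omega>"
  shows "\<phi> x = 0"
proof -
  have "closure {x. \<phi> x \<noteq> 0} \<subseteq> \<Omega>" using assms(1) by (simp add: test_functions_def)
  then have "x \<notin> {x. \<phi> x \<noteq> 0}"
    using assms(2) subsetD[OF closure_subset, of x "{x. \<phi> x \<noteq> 0}"] by (meson subsetD)
  then show ?thesis by simp
qed

lemma finite_measure_lebesgue_on_bounded:
  "bounded \<Omega> \<Longrightarrow> open \<Omega> \<Longrightarrow> finite_measure (lebesgue_on \<Omega>)" for \<Omega> :: "'a::euclidean_space set"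
  by (intro finite_measure_lebesgue_on bounded_set_imp_lmeasurable) (auto intro: borel_open sets_completionI_sets)

lemma L2_space_const:
  fixes c :: "'b::euclidean_space"
  assumes "finite_measure M"
  shows "(\<lambda>x. c) \<in> L2_space M"
proof -
  interpret finite_measure M by fact
  show ?thesis by (simp add: L2_space_def)
qed

lemma integrable_L2:
  fixes f :: "'a \<Rightarrow> real"
  assumes "f \<in> L2_space M" "finite_measure M"
  shows "integrable M f"
  using integrable_L2_inner[OF assms(1) L2_space_const[OF assms(2), of 1]] by simp

text \<open>On a bounded domain a square-integrable function is integrable, so that
  \<open>zero_AE_on_open\<close> applies to a Borel representative of it.\<close>

lemma L2_inner_test_zero_imp_AE_zero:
  fixes \<Omega> :: "'a::euclidean_space set"
  assumes \<Omega>: "open \<Omega>" "bounded \<Omega>" and f: "f \<in> L2_space (lebesgue_on \<Omega>)"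
    and zero: "\<And>\<phi>. \<phi> \<in> test_functions \<Omega> \<Longrightarrow> L2_inner (lebesgue_on \<Omega>) f \<phi> = 0"
  shows "AE x in lebesgue_on \<Omega>. f x = 0"
proof -
  let ?M = "lebesgue_on \<Omega>"
  have \<Omega>s: "\<Omega> \<in> sets lebesgue" using \<Omega>(1) by (auto intro: borel_open sets_completionI_sets)
  have id: "(\<lambda>x. x) \<in> ?M \<rightarrow>\<^sub>M borel" by (rule measurable_ident_lebesgue_on)
  obtain f' where f': "f' \<in> borel_measurable borel" "AE x in ?M. f x = f' x"
    using lebesgue_on_borel_representative[OF _ \<Omega>s] L2_spaceD(1)[OF f] by blast
  have f'M: "f' \<in> borel_measurable ?M" using measurable_compose[OF id f'(1)] .
  have "integrable ?M f" using f finite_measure_lebesgue_on_bounded[OF \<Omega>(2,1)] by (rule integrable_L2)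
  then have intf': "integrable ?M f'"
    using f'(2) f'M L2_spaceD(1)[OF f] integrable_cong_AE[of f ?M f'] by simp
  have "AE x in ?M. x \<in> \<Omega> \<longrightarrow> f' x = 0"
  proof (rule zero_AE_on_open[OF id f'(1) \<Omega>(1)])
    fix a b :: 'a
    have "(indicator (box a b) :: 'a \<Rightarrow> real) \<in> borel_measurable ?M"
      using measurable_compose[OF id, of "indicator (box a b) :: 'a \<Rightarrow> real" borel] by simp
    then have "(\<lambda>x. indicator (box a b) x * f' x) \<in> borel_measurable ?M"
      by (rule borel_measurable_times) (rule f'M)
    then show "integrable ?M (\<lambda>x. indicator (box a b) x * f' x)"
      by (rule Bochner_Integration.integrable_bound[OF intf']) (auto simp: indicator_def)
  next
    fix \<phi> :: "'a \<Rightarrow> real" assume \<phi>: "\<phi> \<in> test_functions \<Omega>"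
    have m: "\<phi> \<in> borel_measurable ?M" using borel_measurable_C1[OF test_functions_C1[OF \<phi>] id] by simp
    have "(LINT x|?M. f' x * \<phi> x) = L2_inner ?M f \<phi>"
      unfolding L2_inner_def inner_real_def
    proof (rule integral_cong_AE)
      show "AE x in ?M. f' x * \<phi> x = f x * \<phi> x" using f'(2) by eventually_elim simp
    qed (use f'M m L2_spaceD(1)[OF f] in auto)
    then show "(LINT x|?M. f' x * \<phi> x) = 0" using zero[OF \<phi>] by simp
  qed
  moreover have "AE x in ?M. x \<in> \<Omega>" by (rule AE_I2) simp
  ultimately show ?thesis using f'(2) by eventually_elim simp
qed

section \<open>Linearity and uniqueness of the weak divergence\<close>

lemma weak_divergence_diff:
  fixes \<Omega> :: "'a::euclidean_space set"
  assumes \<Omega>: "open \<Omega>" "bounded \<Omega>"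
    and "q \<in> L2_space (lebesgue_on \<Omega>)" "q' \<in> L2_space (lebesgue_on \<Omega>)"
    and "f \<in> L2_space (lebesgue_on \<Omega>)" "f' \<in> L2_space (lebesgue_on \<Omega>)"
    and "has_weak_divergence \<Omega> q f" "has_weak_divergence \<Omega> q' f'"
  shows "has_weak_divergence \<Omega> (\<lambda>x. q x - q' x) (\<lambda>x. f x - f' x)"
  unfolding has_weak_divergence_def
proof
  fix \<phi> :: "'a \<Rightarrow> real" assume \<phi>: "\<phi> \<in> test_functions \<Omega>"
  then have L2: "\<phi> \<in> L2_space (lebesgue_on \<Omega>)" "grad \<phi> \<in> L2_space (lebesgue_on \<Omega>)"
    using C1_in_L2 grad_in_L2 \<Omega> test_functions_C1 by blast+
  show "L2_inner (lebesgue_on \<Omega>) (\<lambda>x. q x - q' x) (grad \<phi>) = - L2_inner (lebesgue_on \<Omega>) (\<lambda>x. f x - f' x) \<phi>"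
    using assms \<phi> L2 by (simp add: L2_inner_diff_left has_weak_divergence_def)
qed

lemma weak_divergence_unique:
  fixes \<Omega> :: "'a::euclidean_space set"
  assumes \<Omega>: "open \<Omega>" "bounded \<Omega>"
    and "f \<in> L2_space (lebesgue_on \<Omega>)" "f' \<in> L2_space (lebesgue_on \<Omega>)"
    and "has_weak_divergence \<Omega> q f" "has_weak_divergence \<Omega> q f'"
  shows "AE x in lebesgue_on \<Omega>. f x = f' x"
proof -
  have "AE x in lebesgue_on \<Omega>. f x - f' x = 0"
  proof (rule L2_inner_test_zero_imp_AE_zero[OF \<Omega>])
    show "(\<lambda>x. f x - f' x) \<in> L2_space (lebesgue_on \<Omega>)" by (intro L2_space_diff assms)
    fix \<phi> :: "'a \<Rightarrow> real" assume \<phi>: "\<phi> \<in> test_functions \<Omega>"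
    then have L2: "\<phi> \<in> L2_space (lebesgue_on \<Omega>)" using C1_in_L2 \<Omega> test_functions_C1 by blast
    show "L2_inner (lebesgue_on \<Omega>) (\<lambda>x. f x - f' x) \<phi> = 0"
      using assms \<phi> L2 by (simp add: L2_inner_diff_left has_weak_divergence_def)
  qed
  then show ?thesis by eventually_elim simp
qed

lemma H_divD:
  assumes "q \<in> H_div \<Omega>"
  shows "q \<in> L2_space (lebesgue_on \<Omega>)" "weak_div \<Omega> q \<in> L2_space (lebesgue_on \<Omega>)"
    "has_weak_divergence \<Omega> q (weak_div \<Omega> q)"
proof -
  show "q \<in> L2_space (lebesgue_on \<Omega>)" using assms by (simp add: H_div_def)
  have "\<exists>f. f \<in> L2_space (lebesgue_on \<Omega>) \<and> has_weak_divergence \<Omega> q f" using assms by (auto simp: H_div_def)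
  then have "weak_div \<Omega> q \<in> L2_space (lebesgue_on \<Omega>) \<and> has_weak_divergence \<Omega> q (weak_div \<Omega> q)"
    unfolding weak_div_def by (rule someI_ex)
  then show "weak_div \<Omega> q \<in> L2_space (lebesgue_on \<Omega>)" "has_weak_divergence \<Omega> q (weak_div \<Omega> q)" by auto
qed

text \<open>\<open>weak_div\<close> is a Hilbert choice, so it can be identified with a given weak
  divergence only up to a null set. The normal traces below behave in the same way.\<close>

lemma
  fixes \<Omega> :: "'a::euclidean_space set"
  assumes \<Omega>: "open \<Omega>" "bounded \<Omega>"
    and q: "q \<in> L2_space (lebesgue_on \<Omega>)" and f: "f \<in> L2_space (lebesgue_on \<Omega>)" "has_weak_divergence \<Omega> q f"
  shows H_divI: "q \<in> H_div \<Omega>" and weak_div_eq: "AE x in lebesgue_on \<Omega>. weak_div \<Omega> q x = f x"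
proof -
  show "q \<in> H_div \<Omega>" using q f by (auto simp: H_div_def)
  then show "AE x in lebesgue_on \<Omega>. weak_div \<Omega> q x = f x"
    using weak_divergence_unique[OF \<Omega>] H_divD f by blast
qed

lemma L2_inner_cong_AE_left:
  assumes "AE x in M. f x = f' x" "f \<in> L2_space M" "f' \<in> L2_space M" "g \<in> L2_space M"
  shows "L2_inner M f g = L2_inner M f' g"
  using assms by (intro L2_inner_cong_AE) (auto dest: L2_spaceD)

section \<open>Surface measure and normal traces on the interface\<close>

lemma space_surface_measure [simp]: "space (surface_measure \<Sigma>) = \<Sigma>"
  by (simp add: surface_measure_def space_restrict_space)

lemma measurable_ident_surface_measure: "(\<lambda>x. x) \<in> surface_measure \<Sigma> \<rightarrow>\<^sub>M borel"
  unfolding surface_measure_def by (intro measurable_restrict_space1) (simp add: measurable_def)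

lemma finite_measure_surface_measure:
  fixes \<Sigma> :: "'a::euclidean_space set"
  assumes "\<Sigma> \<in> sets borel" "hausdorff_outer (DIM('a) - 1) \<Sigma> < top"
  shows "finite_measure (surface_measure \<Sigma>)"
proof
  have "emeasure (surface_measure \<Sigma>) \<Sigma> = hausdorff_outer (DIM('a) - 1) \<Sigma>"
    unfolding surface_measure_def using assms(1)
    by (subst emeasure_restrict_space) (auto simp: emeasure_hausdorff_measure)
  then show "emeasure (surface_measure \<Sigma>) (space (surface_measure \<Sigma>)) \<noteq> \<infinity>" using assms(2) by simp
qed

text \<open>The normal trace of a field on Omega is determined almost everywhere on Gamma because the
  part of Gamma inside the open set U is relatively open in the boundary of Omega.\<close>

locale trace_domain =
  fixes \<Omega> \<Gamma> U :: "'a::euclidean_space set"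
  assumes \<Omega>: "open \<Omega>" "bounded \<Omega>" and U: "open U" and \<Gamma>: "compact \<Gamma>"
    and \<Gamma>_finite: "hausdorff_outer (DIM('a) - 1) \<Gamma> < top"
    and \<Gamma>_null: "hausdorff_outer (DIM('a) - 1) (\<Gamma> - U) = 0"
    and frontier_U: "frontier \<Omega> \<inter> U \<subseteq> \<Gamma>"
begin

lemma borel_\<Gamma>: "\<Gamma> \<in> sets borel"
  using \<Gamma> by (simp add: borel_compact)

lemma finite_measure_\<Gamma>: "finite_measure (surface_measure \<Gamma>)"
  using borel_\<Gamma> \<Gamma>_finite by (rule finite_measure_surface_measure)

lemma C1_in_L2_surface: "\<phi> \<in> C1_functions \<Longrightarrow> \<phi> \<in> L2_space (surface_measure \<Gamma>)"
  by (rule bounded_continuous_L2[OF continuous_on_C1 compact_imp_bounded[OF \<Gamma>] measurable_ident_surface_measure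
        space_surface_measure finite_measure_\<Gamma>])

lemma AE_surface_in_U: "AE x in surface_measure \<Gamma>. x \<in> U"
proof -
  have b: "\<Gamma> - U \<in> sets borel" using borel_\<Gamma> U by auto
  have "emeasure (surface_measure \<Gamma>) (\<Gamma> - U) = 0"
    unfolding surface_measure_def using borel_\<Gamma> b \<Gamma>_null
    by (subst emeasure_restrict_space) (auto simp: emeasure_hausdorff_measure)
  moreover have "\<Gamma> - U \<in> sets (surface_measure \<Gamma>)"
    unfolding surface_measure_def using b borel_\<Gamma> by (subst sets_restrict_space_iff) auto
  ultimately show ?thesis
    by (intro AE_I[of _ _ "\<Gamma> - U"]) auto
qed

text \<open>By \<open>frontier_U\<close>, test functions supported in \<open>U\<close> vanish on the
  boundary off \<Gamma>, so the hypothesis covers them. They determine h on the part of \<Gamma>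
  inside \<open>U\<close>, and the rest of \<Gamma> is null.\<close>

lemma L2_inner_surface_zero_imp_AE_zero:
  assumes h: "h \<in> L2_space (surface_measure \<Gamma>)"
    and zero: "\<And>\<phi>. \<phi> \<in> C1_functions \<Longrightarrow> (\<And>x. x \<in> frontier \<Omega> - \<Gamma> \<Longrightarrow> \<phi> x = 0) \<Longrightarrow>
      L2_inner (surface_measure \<Gamma>) h \<phi> = 0"
  shows "AE x in surface_measure \<Gamma>. h x = 0"
proof -
  let ?M = "surface_measure \<Gamma>"
  \<comment> \<open>\<open>h\<close> is arbitrary off \<Gamma>; extension by zero makes it Borel on
    the whole space.\<close>
  define h' where "h' x = indicator \<Gamma> x *\<^sub>R h x" for x
  have id: "(\<lambda>x. x) \<in> ?M \<rightarrow>\<^sub>M borel" by (rule measurable_ident_surface_measure)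
  have hh': "h' x = h x" if "x \<in> space ?M" for x using that by (simp add: h'_def)
  have "h \<in> borel_measurable (restrict_space (hausdorff_measure (DIM('a) - 1)) \<Gamma>)"
    using L2_spaceD(1)[OF h] by (simp add: surface_measure_def)
  then have "h' \<in> borel_measurable (hausdorff_measure (DIM('a) - 1))"
    unfolding h'_def using borel_\<Gamma> by (subst (asm) borel_measurable_restrict_space_iff) simp_all
  then have h': "h' \<in> borel_measurable borel" by (simp cong: measurable_cong_sets)
  have int: "integrable ?M h'"
    using integrable_L2[OF h finite_measure_\<Gamma>] Bochner_Integration.integrable_cong[OF refl hh', of ?M] by simp
  have "AE x in ?M. x \<in> U \<longrightarrow> h' x = 0"
  proof (rule zero_AE_on_open[OF id h' U])
    fix a b :: 'a
    have "(indicator (box a b) :: 'a \<Rightarrow> real) \<in> borel_measurable ?M"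
      using measurable_compose[OF id, of "indicator (box a b) :: 'a \<Rightarrow> real" borel] by simp
    then have "(\<lambda>x. indicator (box a b) x * h' x) \<in> borel_measurable ?M"
      by (rule borel_measurable_times) (rule measurable_compose[OF id h'])
    then show "integrable ?M (\<lambda>x. indicator (box a b) x * h' x)"
      by (rule Bochner_Integration.integrable_bound[OF int]) (auto simp: indicator_def)
  next
    fix \<phi> :: "'a \<Rightarrow> real" assume \<phi>: "\<phi> \<in> test_functions U"
    have "(LINT x|?M. h' x * \<phi> x) = L2_inner ?M h \<phi>"
      unfolding L2_inner_def by (intro Bochner_Integration.integral_cong) (simp_all add: hh')
    also have "\<dots> = 0"
      using \<phi> frontier_U by (intro zero test_functions_C1) (auto intro: test_functions_zero)
    finally show "(LINT x|?M. h' x * \<phi> x) = 0" .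
  qed
  with AE_surface_in_U show ?thesis
    using AE_space by eventually_elim (simp add: hh')
qed

lemma normal_trace_unique:
  assumes "has_normal_trace \<Omega> \<Gamma> q h" "has_normal_trace \<Omega> \<Gamma> q h'"
  shows "AE x in surface_measure \<Gamma>. h x = h' x"
proof -
  have "AE x in surface_measure \<Gamma>. h x - h' x = 0"
  proof (rule L2_inner_surface_zero_imp_AE_zero)
    show "(\<lambda>x. h x - h' x) \<in> L2_space (surface_measure \<Gamma>)"
      using assms by (intro L2_space_diff) (auto simp: has_normal_trace_def)
    fix \<phi> :: "'a \<Rightarrow> real" assume \<phi>: "\<phi> \<in> C1_functions" "\<And>x. x \<in> frontier \<Omega> - \<Gamma> \<Longrightarrow> \<phi> x = 0"
    then have "L2_inner (surface_measure \<Gamma>) h \<phi> = L2_inner (surface_measure \<Gamma>) h' \<phi>"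
      using assms unfolding has_normal_trace_def by metis
    then show "L2_inner (surface_measure \<Gamma>) (\<lambda>x. h x - h' x) \<phi> = 0"
      using assms C1_in_L2_surface[OF \<phi>(1)] by (simp add: L2_inner_diff_left has_normal_trace_def)
  qed
  then show ?thesis by eventually_elim simp
qed

lemma weak_div_diff:
  assumes "q \<in> H_div \<Omega>" "q' \<in> H_div \<Omega>"
  shows "(\<lambda>x. q x - q' x) \<in> H_div \<Omega>"
    "AE x in lebesgue_on \<Omega>. weak_div \<Omega> (\<lambda>x. q x - q' x) x = weak_div \<Omega> q x - weak_div \<Omega> q' x"
proof -
  note q = H_divD[OF assms(1)] and q' = H_divD[OF assms(2)]
  note d = weak_divergence_diff[OF \<Omega> q(1) q'(1) q(2) q'(2) q(3) q'(3)]
  show "(\<lambda>x. q x - q' x) \<in> H_div \<Omega>"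
    by (rule H_divI[OF \<Omega> L2_space_diff[OF q(1) q'(1)] L2_space_diff[OF q(2) q'(2)] d])
  show "AE x in lebesgue_on \<Omega>. weak_div \<Omega> (\<lambda>x. q x - q' x) x = weak_div \<Omega> q x - weak_div \<Omega> q' x"
    by (rule weak_div_eq[OF \<Omega> L2_space_diff[OF q(1) q'(1)] L2_space_diff[OF q(2) q'(2)] d])
qed

text \<open>Linearity needs a proof because the chosen divergence of a difference equals the
  difference of the chosen divergences only almost everywhere, which suffices inside the inner
  product.\<close>

lemma green_diff:
  assumes "q \<in> H_div \<Omega>" "q' \<in> H_div \<Omega>" "\<phi> \<in> C1_functions"
  shows "L2_inner (lebesgue_on \<Omega>) (\<lambda>x. q x - q' x) (grad \<phi>)
      + L2_inner (lebesgue_on \<Omega>) (weak_div \<Omega> (\<lambda>x. q x - q' x)) \<phi>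
    = (L2_inner (lebesgue_on \<Omega>) q (grad \<phi>) + L2_inner (lebesgue_on \<Omega>) (weak_div \<Omega> q) \<phi>)
      - (L2_inner (lebesgue_on \<Omega>) q' (grad \<phi>) + L2_inner (lebesgue_on \<Omega>) (weak_div \<Omega> q') \<phi>)"
proof -
  note q = H_divD[OF assms(1)] and q' = H_divD[OF assms(2)]
  have L2: "\<phi> \<in> L2_space (lebesgue_on \<Omega>)" "grad \<phi> \<in> L2_space (lebesgue_on \<Omega>)"
    using C1_in_L2 grad_in_L2 \<Omega> assms(3) by blast+
  have "L2_inner (lebesgue_on \<Omega>) (weak_div \<Omega> (\<lambda>x. q x - q' x)) \<phi>
      = L2_inner (lebesgue_on \<Omega>) (\<lambda>x. weak_div \<Omega> q x - weak_div \<Omega> q' x) \<phi>"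
    by (rule L2_inner_cong_AE_left[OF weak_div_diff(2)[OF assms(1,2)]
          H_divD(2)[OF weak_div_diff(1)[OF assms(1,2)]] L2_space_diff[OF q(2) q'(2)] L2(1)])
  then show ?thesis using q q' L2 by (simp add: L2_inner_diff_left)
qed

lemma flux_space_normal_trace:
  assumes "q \<in> flux_space \<Omega> \<Gamma> \<Gamma>N"
  shows "q \<in> H_div \<Omega>" "has_normal_trace \<Omega> \<Gamma> q (normal_trace \<Omega> \<Gamma> q)"
    "normal_trace \<Omega> \<Gamma> q \<in> L2_space (surface_measure \<Gamma>)"
proof -
  show "q \<in> H_div \<Omega>" using assms by (simp add: flux_space_def)
  show *: "has_normal_trace \<Omega> \<Gamma> q (normal_trace \<Omega> \<Gamma> q)"
  proof -
    have "\<exists>h. has_normal_trace \<Omega> \<Gamma> q h" using assms unfolding flux_space_def by (elim CollectE conjE)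
    then show ?thesis unfolding normal_trace_def by (rule someI_ex)
  qed
  then show "normal_trace \<Omega> \<Gamma> q \<in> L2_space (surface_measure \<Gamma>)" by (simp add: has_normal_trace_def)
qed

lemma normal_trace_eq:
  assumes "has_normal_trace \<Omega> \<Gamma> q h"
  shows "AE x in surface_measure \<Gamma>. normal_trace \<Omega> \<Gamma> q x = h x"
proof (rule normal_trace_unique[OF _ assms])
  show "has_normal_trace \<Omega> \<Gamma> q (normal_trace \<Omega> \<Gamma> q)"
    unfolding normal_trace_def by (rule someI[of "has_normal_trace \<Omega> \<Gamma> q", OF assms])
qed

text \<open>Makes the flux error an admissible test field. The difference of the two traces
  satisfies Green's formula for the difference of the fields, and uniqueness identifies it with the
  chosen trace.\<close>

lemma
  assumes q: "q \<in> flux_space \<Omega> \<Gamma> \<Gamma>N" and q': "q' \<in> flux_space \<Omega> \<Gamma> \<Gamma>N"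
  shows flux_space_diff: "(\<lambda>x. q x - q' x) \<in> flux_space \<Omega> \<Gamma> \<Gamma>N"
    and normal_trace_diff: "AE x in surface_measure \<Gamma>. normal_trace \<Omega> \<Gamma> (\<lambda>x. q x - q' x) x
      = normal_trace \<Omega> \<Gamma> q x - normal_trace \<Omega> \<Gamma> q' x"
proof -
  note nq = flux_space_normal_trace[OF q] and nq' = flux_space_normal_trace[OF q']
  note green = green_diff[OF nq(1) nq'(1)]
  have tr: "has_normal_trace \<Omega> \<Gamma> (\<lambda>x. q x - q' x) (\<lambda>x. normal_trace \<Omega> \<Gamma> q x - normal_trace \<Omega> \<Gamma> q' x)"
    unfolding has_normal_trace_def
  proof (intro conjI ballI impI)
    show "(\<lambda>x. normal_trace \<Omega> \<Gamma> q x - normal_trace \<Omega> \<Gamma> q' x) \<in> L2_space (surface_measure \<Gamma>)"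
      by (intro L2_space_diff nq nq')
    fix \<phi> assume \<phi>: "\<phi> \<in> C1_functions" "\<forall>x\<in>frontier \<Omega> - \<Gamma>. \<phi> x = 0"
    show "L2_inner (lebesgue_on \<Omega>) (\<lambda>x. q x - q' x) (grad \<phi>)
        + L2_inner (lebesgue_on \<Omega>) (weak_div \<Omega> (\<lambda>x. q x - q' x)) \<phi>
      = L2_inner (surface_measure \<Gamma>) (\<lambda>x. normal_trace \<Omega> \<Gamma> q x - normal_trace \<Omega> \<Gamma> q' x) \<phi>"
      using nq(2) nq'(2) \<phi> unfolding green[OF \<phi>(1)] has_normal_trace_def
      by (simp add: L2_inner_diff_left[OF nq(3) nq'(3) C1_in_L2_surface[OF \<phi>(1)]])
  qed
  have trN: "has_normal_trace \<Omega> (\<Gamma>N \<inter> frontier \<Omega>) (\<lambda>x. q x - q' x) (\<lambda>x. 0)"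
    unfolding has_normal_trace_def
  proof (intro conjI ballI impI)
    fix \<phi> assume \<phi>: "\<phi> \<in> C1_functions" "\<forall>x\<in>frontier \<Omega> - \<Gamma>N \<inter> frontier \<Omega>. \<phi> x = 0"
    then show "L2_inner (lebesgue_on \<Omega>) (\<lambda>x. q x - q' x) (grad \<phi>)
        + L2_inner (lebesgue_on \<Omega>) (weak_div \<Omega> (\<lambda>x. q x - q' x)) \<phi>
      = L2_inner (surface_measure (\<Gamma>N \<inter> frontier \<Omega>)) (\<lambda>x. 0) \<phi>"
      using q q' unfolding green[OF \<phi>(1)] flux_space_def has_normal_trace_def by simp
  qed simp
  show "(\<lambda>x. q x - q' x) \<in> flux_space \<Omega> \<Gamma> \<Gamma>N"
    unfolding flux_space_def using weak_div_diff(1)[OF nq(1) nq'(1)] tr trN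
    by (intro CollectI conjI exI)
  show "AE x in surface_measure \<Gamma>. normal_trace \<Omega> \<Gamma> (\<lambda>x. q x - q' x) x
      = normal_trace \<Omega> \<Gamma> q x - normal_trace \<Omega> \<Gamma> q' x"
    by (rule normal_trace_eq[OF tr])
qed

end

section \<open>Hausdorff measure and transversal thickenings\<close>

text \<open>Dyadic cubes have a diameter comparable to their side, so powers of diameters are
  bounded by volumes. The cubes have disjoint interiors and stay inside an open set T barely larger
  than A, so their volumes sum to little more than the measure of A.\<close>

lemma cube_cover:
  fixes A :: "'a::euclidean_space set"
  assumes A: "A \<in> sets lebesgue" "bounded A" and \<delta>: "0 < \<delta>" and e: "0 < e"
  obtains U :: "nat \<Rightarrow> 'a set" and l :: "nat \<Rightarrow> real"
  where "A \<subseteq> (\<Union>i. U i)" "\<And>i. 0 \<le> l i" "\<And>i. bounded (U i)" "\<And>i. diameter (U i) \<le> \<delta>"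
    "\<And>i. diameter (U i) \<le> DIM('a) * l i"
    "(\<Sum>i. ennreal (l i ^ DIM('a))) \<le> emeasure lebesgue A + ennreal e"
proof -
  obtain T where T: "open T" "A \<subseteq> T" "emeasure lebesgue (T - A) < ennreal e"
    using sets_lebesgue_outer_open[OF A(1) e] by blast
  obtain N where N: "0 < N" "A \<subseteq> cbox (- (N *\<^sub>R One)) (N *\<^sub>R One)"
  proof -
    obtain b where b: "\<And>x. x \<in> A \<Longrightarrow> norm x \<le> b" using A(2) by (auto simp: bounded_iff)
    have "\<bar>x \<bullet> i\<bar> \<le> \<bar>b\<bar> + 1" if "x \<in> A" "i \<in> Basis" for x i
      using Basis_le_norm[OF that(2), of x] b[OF that(1)] by linarith
    then have "A \<subseteq> cbox (- ((\<bar>b\<bar> + 1) *\<^sub>R One)) ((\<bar>b\<bar> + 1) *\<^sub>R One)"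
      by (force simp: mem_box abs_le_iff)
    then show ?thesis by (intro that[of "\<bar>b\<bar> + 1"]) auto
  qed
  \<comment> \<open>The gauge forces each cube tagged by a point of A into T and into a ball of
    diameter \<delta>.\<close>
  define \<gamma> where "\<gamma> x = (if x \<in> T then T \<inter> ball x (\<delta>/2) else ball x (\<delta>/2))" for x
  have \<gamma>: "gauge \<gamma>" unfolding gauge_def \<gamma>_def using T(1) \<delta> by auto
  have ne: "box (- (N *\<^sub>R One)) (N *\<^sub>R One :: 'a) \<noteq> {}" using N(1) by (simp add: box_ne_empty)
  obtain \<D> where D: "countable \<D>"
    "\<And>K. K \<in> \<D> \<Longrightarrow> interior K \<noteq> {} \<and> (\<exists>c d. K = cbox c d)"
    "pairwise (\<lambda>A B. interior A \<inter> interior B = {}) \<D>"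
    "\<And>K. K \<in> \<D> \<Longrightarrow> \<exists>x \<in> A \<inter> K. K \<subseteq> \<gamma> x"
    "\<And>u v. cbox u v \<in> \<D> \<Longrightarrow> \<exists>n. \<forall>i \<in> Basis. v \<bullet> i - u \<bullet> i = ((N *\<^sub>R One) \<bullet> i - (- (N *\<^sub>R One)) \<bullet> i) / 2^n"
    "A \<subseteq> \<Union>\<D>"
    by (rule covering_lemma[OF N(2) ne \<gamma>]) blast
  \<comment> \<open>The family of cubes may be finite; indices that enumerate no cube receive the
    empty set and side length 0.\<close>
  define P where "P i \<longleftrightarrow> i \<in> to_nat_on \<D> ` \<D>" for i
  define U where "U i = (if P i then from_nat_into \<D> i else {})" for i
  have UP: "U i \<in> \<D>" if "P i" for i using that D(1) by (auto simp: P_def U_def)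
  have Uinj: "i = j" if "P i" "P j" "U i = U j" for i j
    using that D(1) by (auto simp: P_def U_def)
  have "\<exists>l::real. 0 \<le> l \<and> diameter (U i) \<le> DIM('a) * l \<and> ennreal (l ^ DIM('a)) \<le> emeasure lebesgue (interior (U i))" for i
  proof (cases "P i")
    case True
    from D(2)[OF UP[OF this]] obtain c d where cd: "U i = cbox c d" "interior (U i) \<noteq> {}" by blast
    obtain n where n: "\<And>j. j \<in> Basis \<Longrightarrow> d \<bullet> j - c \<bullet> j = 2 * N / 2^n"
      using D(5)[of c d] UP[OF True] cd(1) by fastforce
    \<comment> \<open>The initial box is a cube of side 2N, so each dyadic piece of it has equal
      sides as well.\<close>
    define l where "l = 2 * N / 2^n"
    have l: "0 \<le> l" using N(1) by (simp add: l_def)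
    have "diameter (U i) \<le> DIM('a) * l"
    proof (rule diameter_le)
      show "U i \<noteq> {} \<or> 0 \<le> DIM('a) * l" using l by simp
      fix x y assume xy: "x \<in> U i" "y \<in> U i"
      have "norm (x - y) \<le> (\<Sum>b\<in>Basis. \<bar>(x - y) \<bullet> b\<bar>)" by (rule norm_le_l1)
      also have "\<dots> \<le> (\<Sum>b\<in>(Basis::'a set). l)"
      proof (rule sum_mono)
        fix b :: 'a assume b: "b \<in> Basis"
        then have "c \<bullet> b \<le> x \<bullet> b" "x \<bullet> b \<le> d \<bullet> b" "c \<bullet> b \<le> y \<bullet> b" "y \<bullet> b \<le> d \<bullet> b"
          using xy cd(1) by (auto simp: mem_box)
        then show "\<bar>(x - y) \<bullet> b\<bar> \<le> l" using n[OF b] by (simp add: inner_diff_left l_def)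
      qed
      finally show "norm (x - y) \<le> DIM('a) * l" by simp
    qed
    moreover have "emeasure lebesgue (interior (U i)) = ennreal (l ^ DIM('a))"
    proof -
      have "emeasure lebesgue (box c d) = ennreal (\<Prod>b\<in>Basis. (d - c) \<bullet> b)"
        using n l by (simp, subst emeasure_lborel_box) (auto simp: l_def algebra_simps)
      also have "(\<Prod>b\<in>Basis. (d - c) \<bullet> b) = (\<Prod>b\<in>(Basis::'a set). l)"
        using n by (intro prod.cong) (auto simp: l_def inner_diff_left)
      finally show ?thesis using cd(1) by simp
    qed
    ultimately show ?thesis using l by (intro exI[of _ l]) simp
  next
    case False
    then show ?thesis by (intro exI[of _ 0]) (simp add: U_def)
  qed
  then obtain l :: "nat \<Rightarrow> real" where l: "\<And>i. 0 \<le> l i" "\<And>i. diameter (U i) \<le> DIM('a) * l i"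
    "\<And>i. ennreal (l i ^ DIM('a)) \<le> emeasure lebesgue (interior (U i))" by metis
  have UT: "\<exists>x\<in>T. U i \<subseteq> T \<inter> ball x (\<delta>/2)" if P: "P i" for i
  proof -
    obtain x where x: "x \<in> A" "U i \<subseteq> \<gamma> x" using D(4)[OF UP[OF P]] by blast
    then have "x \<in> T" using T(2) by blast
    then show ?thesis using x by (intro bexI[of _ x]) (simp_all add: \<gamma>_def)
  qed
  have bd: "bounded (U i) \<and> diameter (U i) \<le> \<delta>" for i
  proof (cases "P i")
    case True
    then obtain x where x: "U i \<subseteq> ball x (\<delta>/2)" using UT by blast
    then have "diameter (U i) \<le> diameter (ball x (\<delta>/2))" by (intro diameter_subset) auto
    then show ?thesis using x \<delta> by (auto intro: bounded_subset)
  qed (use \<delta> in \<open>simp add: U_def\<close>)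
  have "(\<Sum>i. ennreal (l i ^ DIM('a))) \<le> (\<Sum>i. emeasure lebesgue (interior (U i)))"
    by (intro suminf_le l) auto
  also have "\<dots> = emeasure lebesgue (\<Union>i. interior (U i))"
  proof (rule suminf_emeasure)
    show "disjoint_family (\<lambda>i. interior (U i))"
      unfolding disjoint_family_on_def
    proof (intro ballI impI)
      fix i j :: nat assume "i \<noteq> j"
      show "interior (U i) \<inter> interior (U j) = {}"
      proof (cases "P i \<and> P j")
        case True
        then show ?thesis using D(3) UP Uinj[of i j] \<open>i \<noteq> j\<close> unfolding pairwise_def by blast
      qed (auto simp: U_def)
    qed
  qed (auto intro: borel_open sets_completionI_sets)
  also have "\<dots> \<le> emeasure lebesgue T"
  proof (rule emeasure_mono)
    show "(\<Union>i. interior (U i)) \<subseteq> T"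
    proof (rule UN_least)
      fix i
      show "interior (U i) \<subseteq> T"
        using UT[of i] interior_subset[of "U i"] by (cases "P i") (auto simp: U_def)
    qed
  qed (use T(1) in \<open>auto intro: borel_open sets_completionI_sets\<close>)
  also have "\<dots> = emeasure lebesgue (A \<union> (T - A))" using T(2) by (simp add: Un_absorb1)
  also have "\<dots> \<le> emeasure lebesgue A + emeasure lebesgue (T - A)"
    using A(1) T(1) by (intro emeasure_subadditive) (auto intro: borel_open sets_completionI_sets)
  also have "\<dots> \<le> emeasure lebesgue A + ennreal e" using T(3) by (intro add_left_mono) simp
  finally have "(\<Sum>i. ennreal (l i ^ DIM('a))) \<le> emeasure lebesgue A + ennreal e" .
  moreover have "A \<subseteq> (\<Union>i. U i)"
  proof
    fix x assume "x \<in> A"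
    then obtain K where K: "x \<in> K" "K \<in> \<D>" using D(6) by blast
    then have "U (to_nat_on \<D> K) = K" using D(1) by (simp add: U_def P_def)
    then show "x \<in> (\<Union>i. U i)" using K(1) by blast
  qed
  ultimately show ?thesis using that l bd by blast
qed

text \<open>No line in a direction of the cone of aperture kappa around e meets E twice, so that E is a
  piece of a Lipschitz graph over the hyperplane orthogonal to e.\<close>

definition transversal :: "'a::real_normed_vector \<Rightarrow> real \<Rightarrow> 'a set \<Rightarrow> bool" where
  "transversal e \<kappa> E \<longleftrightarrow> (\<forall>z\<in>E. \<forall>z'\<in>E. \<forall>t>0. \<kappa> * t \<le> norm (z - z' - t *\<^sub>R e))"

lemma transversalD:
  assumes "transversal e \<kappa> E" "z \<in> E" "z' \<in> E"
  shows "\<kappa> * \<bar>s - s'\<bar> \<le> norm (z + s *\<^sub>R e - (z' + s' *\<^sub>R e))"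
proof (cases s s' rule: linorder_cases)
  case less
  then have "\<kappa> * (s' - s) \<le> norm (z - z' - (s' - s) *\<^sub>R e)" using assms by (auto simp: transversal_def)
  then show ?thesis using less by (simp add: algebra_simps)
next
  case greater
  then have "\<kappa> * (s - s') \<le> norm (z' - z - (s - s') *\<^sub>R e)" using assms by (auto simp: transversal_def)
  also have "\<dots> = norm (- (z' - z - (s - s') *\<^sub>R e))" by (rule norm_minus_cancel[symmetric])
  finally show ?thesis using greater by (simp add: algebra_simps)
qed simp

text \<open>A slicing argument. For each height s in (0, h), the cubes covering A that meet E + s e,
  moved back by s e, cover E. By transversality a set of diameter d meets these translates only for
  s in an interval of length 2 d / \<kappa>. Integrating the gauge sums over s therefore gains one
  power of the diameter, and the resulting full power is bounded by a multiple of the volume of the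
  cube.\<close>

theorem hausdorff_outer_le_thickening:
  fixes E A :: "'a::euclidean_space set"
  assumes \<kappa>: "0 < \<kappa>" and h: "0 < h" and tr: "transversal e \<kappa> E"
    and A: "A \<in> sets lebesgue" "bounded A"
    and EA: "\<And>z s. z \<in> E \<Longrightarrow> 0 < s \<Longrightarrow> s < h \<Longrightarrow> z + s *\<^sub>R e \<in> A"
  defines "m \<equiv> DIM('a) - 1"
  shows "ennreal h * hausdorff_outer m E
    \<le> ennreal (2 * unit_ball_vol (real m) / 2 ^ m / \<kappa> * DIM('a) ^ DIM('a)) * emeasure lebesgue A"
    (is "_ \<le> ennreal ?c * _")
proof -
  have m: "DIM('a) = Suc m" using DIM_positive[where 'a='a] by (simp add: m_def)
  have c: "0 \<le> ?c" using \<kappa> by simp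
  have key: "ennreal h * hausdorff_pre m \<delta> E \<le> ennreal ?c * (emeasure lebesgue A + ennreal \<epsilon>)"
    if \<delta>: "0 < \<delta>" and \<epsilon>: "0 < \<epsilon>" for \<delta> \<epsilon>
  proof -
    obtain U :: "nat \<Rightarrow> 'a set" and l :: "nat \<Rightarrow> real" where U: "A \<subseteq> (\<Union>i. U i)" "\<And>i. 0 \<le> l i" "\<And>i. bounded (U i)"
      "\<And>i. diameter (U i) \<le> \<delta>" "\<And>i. diameter (U i) \<le> DIM('a) * l i"
      "(\<Sum>i. ennreal (l i ^ DIM('a))) \<le> emeasure lebesgue A + ennreal \<epsilon>"
      by (rule cube_cover[OF A \<delta> \<epsilon>]) (rule that)
    define d where "d i = diameter (U i)" for i
    have d: "0 \<le> d i" for i unfolding d_def by (rule diameter_ge_0) (rule U)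
    define J where "J i = {s. \<exists>z\<in>E. z + s *\<^sub>R e \<in> U i}" for i
    have "\<exists>s0. J i \<subseteq> {s0 - d i / \<kappa>..s0 + d i / \<kappa>}" for i
    proof (cases "J i = {}")
      case False
      then obtain s0 where s0: "s0 \<in> J i" by blast
      have near: "\<bar>s0 - s\<bar> \<le> d i / \<kappa>" if s: "s \<in> J i" for s
      proof -
        obtain z z' where z: "z \<in> E" "z + s *\<^sub>R e \<in> U i" "z' \<in> E" "z' + s0 *\<^sub>R e \<in> U i"
          using s s0 by (auto simp: J_def)
        have "\<kappa> * \<bar>s - s0\<bar> \<le> norm (z + s *\<^sub>R e - (z' + s0 *\<^sub>R e))"
          by (rule transversalD[OF tr z(1,3)])
        also have "\<dots> \<le> d i"
          unfolding d_def dist_norm[symmetric] by (rule diameter_bounded_bound[OF U(3) z(2,4)])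
        finally show ?thesis using \<kappa> by (simp add: field_simps abs_minus_commute)
      qed
      have "J i \<subseteq> {s0 - d i / \<kappa>..s0 + d i / \<kappa>}"
      proof
        fix s assume "s \<in> J i"
        then have "\<bar>s0 - s\<bar> \<le> d i / \<kappa>" by (rule near)
        then show "s \<in> {s0 - d i / \<kappa>..s0 + d i / \<kappa>}" unfolding atLeastAtMost_iff by linarith
      qed
      then show ?thesis by blast
    qed auto
    then obtain s0 where s0: "\<And>i. J i \<subseteq> {s0 i - d i / \<kappa>..s0 i + d i / \<kappa>}" by metis
    \<comment> \<open>\<open>J i\<close>, the set of heights at which \<open>U i\<close> is met,
      could fail to be measurable; it is replaced by an enclosing interval.\<close>
    define I where "I i = {s0 i - d i / \<kappa>..s0 i + d i / \<kappa>}" for i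
    define G where "G i = unit_ball_vol (real m) / 2 ^ m * d i ^ m" for i
    have G: "0 \<le> G i" for i unfolding G_def using d[of i] by simp
    \<comment> \<open>At a fixed height only those cubes contribute whose interval contains
      s.\<close>
    have slice: "hausdorff_pre m \<delta> E \<le> (\<Sum>i. indicator (I i) s * ennreal (G i))" if s: "0 < s" "s < h" for s
    proof -
      define V where "V i = (if s \<in> I i then (\<lambda>y. y - s *\<^sub>R e) ` U i else {})" for i
      have dV: "diameter (V i) \<le> d i" for i
      proof (rule diameter_le)
        fix x y assume "x \<in> V i" "y \<in> V i"
        then obtain x' y' where "x' \<in> U i" "y' \<in> U i" "x = x' - s *\<^sub>R e" "y = y' - s *\<^sub>R e"
          by (auto simp: V_def split: if_splits)
        then show "norm (x - y) \<le> d i"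
          using diameter_bounded_bound[OF U(3), of x' i y'] by (simp add: d_def dist_norm)
      qed (use d in auto)
      have bV: "bounded (V i)" for i
        unfolding V_def using bounded_translation_minus[OF U(3)] by simp
      have "hausdorff_pre m \<delta> E \<le> (\<Sum>i. ennreal (hausdorff_gauge m (V i)))"
      proof (rule hausdorff_pre_le)
        show "E \<subseteq> (\<Union>i. V i)"
        proof
          fix z assume z: "z \<in> E"
          then have "z + s *\<^sub>R e \<in> A" using EA s by blast
          then obtain i where i: "z + s *\<^sub>R e \<in> U i" using U(1) by blast
          then have "s \<in> I i" using s0[of i] z by (auto simp: J_def I_def)
          then have "z \<in> V i" using i by (auto simp: V_def image_iff intro!: bexI[of _ "z + s *\<^sub>R e"])
          then show "z \<in> (\<Union>i. V i)" by blast
        qed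
        show "bounded (V i) \<and> diameter (V i) \<le> \<delta>" for i
          using bV dV[of i] U(4)[of i] by (simp add: d_def)
      qed
      also have "\<dots> \<le> (\<Sum>i. indicator (I i) s * ennreal (G i))"
      proof (intro suminf_le)
        fix i
        show "ennreal (hausdorff_gauge m (V i)) \<le> indicator (I i) s * ennreal (G i)"
        proof (cases "s \<in> I i \<and> V i \<noteq> {}")
          case True
          have "hausdorff_gauge m (V i) \<le> G i"
            unfolding hausdorff_gauge_def G_def using True
            by (simp only: if_False) (intro mult_left_mono power_mono dV diameter_ge_0 bV, simp)
          then show ?thesis using True by (simp add: ennreal_leI)
        next
          case False
          then have "V i = {}" by (auto simp: V_def)
          then show ?thesis by (simp add: hausdorff_gauge_def)
        qed
      qed auto
      finally show ?thesis .
    qed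
    have "ennreal h * hausdorff_pre m \<delta> E = (\<integral>\<^sup>+s. hausdorff_pre m \<delta> E * indicator {0<..<h} s \<partial>lborel)"
      using h by (simp add: nn_integral_cmult_indicator mult.commute)
    also have "\<dots> \<le> (\<integral>\<^sup>+s. (\<Sum>i. indicator (I i) s * ennreal (G i)) \<partial>lborel)"
      by (intro nn_integral_mono) (auto simp: slice split: split_indicator)
    also have "\<dots> = (\<Sum>i. \<integral>\<^sup>+s. indicator (I i) s * ennreal (G i) \<partial>lborel)"
      by (intro nn_integral_suminf) (auto simp: I_def)
    also have "\<dots> \<le> (\<Sum>i. ennreal ?c * ennreal (l i ^ DIM('a)))"
    proof (intro suminf_le)
      fix i
      have "(\<integral>\<^sup>+s. indicator (I i) s * ennreal (G i) \<partial>lborel) = ennreal (2 * d i / \<kappa>) * ennreal (G i)"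
        using d[of i] \<kappa> by (subst nn_integral_multc) (auto simp: I_def)
      also have "\<dots> = ennreal (2 * unit_ball_vol (real m) / 2 ^ m / \<kappa> * d i ^ Suc m)"
        using d[of i] \<kappa> G[of i] by (simp add: G_def ennreal_mult[symmetric] field_simps)
      also have "\<dots> \<le> ennreal (2 * unit_ball_vol (real m) / 2 ^ m / \<kappa> * (DIM('a) * l i) ^ Suc m)"
        using \<kappa> d[of i] U(5)[of i] by (intro ennreal_leI mult_left_mono power_mono) (auto simp: d_def)
      also have "\<dots> = ennreal (?c * l i ^ DIM('a))"
        by (simp only: m power_mult_distrib mult.assoc of_nat_power)
      also have "\<dots> = ennreal ?c * ennreal (l i ^ DIM('a))"
        using c U(2)[of i] by (intro ennreal_mult) auto
      finally show "(\<integral>\<^sup>+s. indicator (I i) s * ennreal (G i) \<partial>lborel) \<le> ennreal ?c * ennreal (l i ^ DIM('a))" .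
    qed auto
    also have "\<dots> = ennreal ?c * (\<Sum>i. ennreal (l i ^ DIM('a)))" by (rule ennreal_suminf_cmult)
    also have "\<dots> \<le> ennreal ?c * (emeasure lebesgue A + ennreal \<epsilon>)" by (intro mult_left_mono U(6)) simp
    finally show ?thesis .
  qed
  have fin: "emeasure lebesgue A < top"
    using A bounded_set_imp_lmeasurable fmeasurableD2 by (metis less_top)
  have "ennreal h * hausdorff_pre m \<delta> E \<le> ennreal ?c * emeasure lebesgue A" if \<delta>: "0 < \<delta>" for \<delta>
  proof (rule ennreal_le_epsilon)
    fix r :: real assume r: "0 < r"
    \<comment> \<open>Dividing by the constant plus 1 requires only that the constant is
      nonnegative.\<close>
    have aux: "a * (r / (a + 1)) \<le> r" if "0 \<le> a" for a
      using r that by (simp add: field_simps)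
    have "ennreal h * hausdorff_pre m \<delta> E \<le> ennreal ?c * (emeasure lebesgue A + ennreal (r / (?c + 1)))"
      using c r by (intro key[OF \<delta>]) auto
    also have "\<dots> \<le> ennreal ?c * emeasure lebesgue A + ennreal r"
    proof -
      have "ennreal ?c * ennreal (r / (?c + 1)) \<le> ennreal r"
        using c r aux[OF c] by (subst ennreal_mult[symmetric]) (auto intro!: ennreal_leI)
      then show ?thesis by (simp add: distrib_left add_left_mono)
    qed
    finally show "ennreal h * hausdorff_pre m \<delta> E \<le> ennreal ?c * emeasure lebesgue A + ennreal r" .
  qed
  then show ?thesis
    unfolding hausdorff_outer_def by (subst SUP_mult_left_ennreal) (auto intro!: SUP_least)
qed

text \<open>A Vitali covering takes the place of density points. If A had positive measure, choose
  an open T containing A with |T - A| < \<epsilon>^D |A| and disjoint balls in T that cover almost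
  all of A. Their holes fill the fraction \<epsilon>^D of these balls, hence have total measure at
  least \<epsilon>^D |A|, but they lie in T - A.\<close>

lemma porous_imp_negligible:
  fixes A :: "'a::euclidean_space set"
  assumes A: "A \<in> sets lebesgue" "bounded A" and \<epsilon>: "0 < \<epsilon>"
    and hole: "\<And>a d. a \<in> A \<Longrightarrow> 0 < d \<Longrightarrow>
      \<exists>r b. 0 < r \<and> r < d \<and> ball b (\<epsilon> * r) \<subseteq> ball a r \<and> ball b (\<epsilon> * r) \<inter> A = {}"
  shows "negligible A"
proof (rule ccontr)
  assume "\<not> negligible A"
  define D where "D = DIM('a)"
  have lm: "A \<in> lmeasurable" using A by (simp add: bounded_set_imp_lmeasurable)
  have pos: "0 < measure lebesgue A"
    using \<open>\<not> negligible A\<close> lm by (metis measure_nonneg negligible_iff_measure0 less_eq_real_def)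
  have "0 < \<epsilon> ^ D * measure lebesgue A" using \<epsilon> pos by simp
  then obtain T where T: "open T" "A \<subseteq> T" "emeasure lebesgue (T - A) < ennreal (\<epsilon> ^ D * measure lebesgue A)"
    using sets_lebesgue_outer_open[OF A(1)] by blast
  \<comment> \<open>Since holes exist at arbitrarily small scales, these balls form a Vitali cover
    of A.\<close>
  define K where "K = {(a, r). a \<in> A \<and> 0 < r \<and> ball a r \<subseteq> T \<and>
      (\<exists>b. ball b (\<epsilon> * r) \<subseteq> ball a r \<and> ball b (\<epsilon> * r) \<inter> A = {})}"
  have "\<exists>i. i \<in> K \<and> x \<in> ball (fst i) (snd i) \<and> snd i < d" if x: "x \<in> A" and d: "0 < d" for x d
  proof -
    obtain d' where d': "0 < d'" "ball x d' \<subseteq> T" using T x by (meson open_contains_ball subsetD)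
    obtain r b where r: "0 < r" "r < min d d'" "ball b (\<epsilon> * r) \<subseteq> ball x r" "ball b (\<epsilon> * r) \<inter> A = {}"
      using hole[OF x, of "min d d'"] d d'(1) by auto
    have "ball x r \<subseteq> T" using d'(2) r(2) by (meson min_less_iff_conj order_less_imp_le order_trans subset_ball)
    then show ?thesis using r x by (intro exI[of _ "(x, r)"]) (auto simp: K_def)
  qed
  then obtain C where C: "countable C" "C \<subseteq> K"
      "pairwise (\<lambda>i j. disjnt (ball (fst i) (snd i)) (ball (fst j) (snd j))) C"
      "negligible (A - (\<Union>i\<in>C. ball (fst i) (snd i)))"
    by (rule Vitali_covering_theorem_balls)
  define B where "B i = ball (fst i) (snd i)" for i :: "'a \<times> real"
  have "\<exists>b. ball b (\<epsilon> * snd i) \<subseteq> B i \<and> ball b (\<epsilon> * snd i) \<inter> A = {}" if "i \<in> C" for i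
  proof -
    have "i \<in> K" using that C(2) by blast
    then show ?thesis by (cases i) (simp add: K_def B_def)
  qed
  then obtain b where b: "\<And>i. i \<in> C \<Longrightarrow> ball (b i) (\<epsilon> * snd i) \<subseteq> B i"
      "\<And>i. i \<in> C \<Longrightarrow> ball (b i) (\<epsilon> * snd i) \<inter> A = {}" by metis
  define H where "H i = ball (b i) (\<epsilon> * snd i)" for i
  have dB: "disjoint_family_on B C"
    using C(3) by (auto simp: disjoint_family_on_def pairwise_def disjnt_def B_def)
  then have dH: "disjoint_family_on H C"
    using b(1) unfolding disjoint_family_on_def H_def by blast
  have leb: "ball x r \<in> sets lebesgue" for x :: 'a and r by (simp add: lmeasurable_ball fmeasurableD)
  have emH: "emeasure lebesgue (H i) = ennreal (\<epsilon> ^ D) * emeasure lebesgue (B i)" if "i \<in> C" for i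
  proof -
    have r: "0 < snd i" using that C(2) by (auto simp: K_def)
    then show ?thesis
      using \<epsilon> by (simp add: H_def B_def emeasure_ball D_def ennreal_mult[symmetric] power_mult_distrib algebra_simps)
  qed
  have "ennreal (\<epsilon> ^ D) * emeasure lebesgue A \<le> ennreal (\<epsilon> ^ D) * emeasure lebesgue (\<Union>(B ` C))"
  proof (intro mult_left_mono)
    have UB: "\<Union>(B ` C) \<in> sets lebesgue" using C(1) leb by (auto simp: B_def intro!: sets.countable_UN')
    have "emeasure lebesgue A \<le> emeasure lebesgue (\<Union>(B ` C) \<union> (A - \<Union>(B ` C)))"
      using UB A(1) by (intro emeasure_mono) auto
    also have "\<dots> = emeasure lebesgue (\<Union>(B ` C))"
      using UB C(4) by (intro emeasure_Un_null_set) (auto simp: B_def negligible_iff_null_sets)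
    finally show "emeasure lebesgue A \<le> emeasure lebesgue (\<Union>(B ` C))" .
  qed simp
  also have "emeasure lebesgue (\<Union>(B ` C)) = (\<integral>\<^sup>+i. emeasure lebesgue (B i) \<partial>count_space C)"
    using C(1) leb dB by (intro emeasure_UN_countable) (auto simp: B_def)
  also have "ennreal (\<epsilon> ^ D) * \<dots> = (\<integral>\<^sup>+i. ennreal (\<epsilon> ^ D) * emeasure lebesgue (B i) \<partial>count_space C)"
    by (rule nn_integral_cmult[symmetric]) simp
  also have "\<dots> = (\<integral>\<^sup>+i. emeasure lebesgue (H i) \<partial>count_space C)"
    by (intro nn_integral_cong) (simp add: emH)
  also have "\<dots> = emeasure lebesgue (\<Union>(H ` C))"
    using C(1) leb by (intro emeasure_UN_countable[symmetric] dH) (simp_all add: H_def)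
  also have "\<dots> \<le> emeasure lebesgue (T - A)"
  proof (rule emeasure_mono)
    have "B i \<subseteq> T" if "i \<in> C" for i
    proof -
      have "i \<in> K" using that C(2) by blast
      then show ?thesis by (auto simp: K_def B_def)
    qed
    then show "\<Union>(H ` C) \<subseteq> T - A" using b unfolding H_def by blast
  qed (use T(1) A(1) in \<open>auto intro: borel_open sets_completionI_sets\<close>)
  also have "\<dots> < ennreal (\<epsilon> ^ D * measure lebesgue A)" by (rule T)
  also have "\<dots> = ennreal (\<epsilon> ^ D) * emeasure lebesgue A"
    using \<epsilon> lm by (simp add: emeasure_eq_measure2 ennreal_mult)
  finally show False by simp
qed

section \<open>Lipschitz domains\<close>

text \<open>A uniform interior cone condition: with t free, w ranges over an open cone around e
  whose aperture is measured by \<kappa>. Starting points from the closure are included because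
  boundary points have to be pushed inside.\<close>

definition cone_condition ::
    "'a::real_normed_vector set \<Rightarrow> 'a \<Rightarrow> real \<Rightarrow> 'a \<Rightarrow> real \<Rightarrow> bool" where
  "cone_condition \<Omega> x r e \<kappa> \<longleftrightarrow> (\<forall>y w t. y \<in> closure \<Omega> \<longrightarrow> y \<in> ball x r \<longrightarrow> y + w \<in> ball x r \<longrightarrow>
     0 < t \<longrightarrow> norm (w - t *\<^sub>R e) < \<kappa> * t \<longrightarrow> y + w \<in> \<Omega>)"

lemma cone_conditionD:
  assumes "cone_condition \<Omega> x r e \<kappa>" "y \<in> closure \<Omega>" "y \<in> ball x r" "y + w \<in> ball x r"
    "0 < t" "norm (w - t *\<^sub>R e) < \<kappa> * t"
  shows "y + w \<in> \<Omega>"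
  using assms(1)[unfolded cone_condition_def, rule_format, OF assms(2-6)] .

lemma cone_condition_mono:
  assumes "cone_condition \<Omega> x r e \<kappa>" "r' \<le> r" "\<kappa>' \<le> \<kappa>"
  shows "cone_condition \<Omega> x r' e \<kappa>'"
  unfolding cone_condition_def
proof (intro allI impI)
  fix y w t assume *: "y \<in> closure \<Omega>" "y \<in> ball x r'" "y + w \<in> ball x r'" "0 < (t::real)"
    "norm (w - t *\<^sub>R e) < \<kappa>' * t"
  have "\<kappa>' * t \<le> \<kappa> * t" using assms(3) *(4) by (intro mult_right_mono) auto
  then have "norm (w - t *\<^sub>R e) < \<kappa> * t" using *(5) by linarith
  moreover have "y \<in> ball x r" "y + w \<in> ball x r" using * assms(2) by auto
  ultimately show "y + w \<in> \<Omega>" using * assms(1) cone_conditionD by blast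
qed

lemma frontier_not_in_open: "open \<Omega> \<Longrightarrow> x \<in> frontier \<Omega> \<Longrightarrow> x \<notin> \<Omega>"
  by (simp add: frontier_def interior_open)

text \<open>If the difference of two boundary points were in the cone, one of them would lie in the
  open set.\<close>

lemma cone_condition_transversal:
  assumes "cone_condition \<Omega> x r e \<kappa>" "open \<Omega>"
  shows "transversal e \<kappa> (frontier \<Omega> \<inter> ball x r)"
  unfolding transversal_def
proof (intro ballI allI impI)
  fix z z' and t :: real assume z: "z \<in> frontier \<Omega> \<inter> ball x r" "z' \<in> frontier \<Omega> \<inter> ball x r" and t: "0 < t"
  show "\<kappa> * t \<le> norm (z - z' - t *\<^sub>R e)"
  proof (rule ccontr)
    assume "\<not> ?thesis"
    then have "z' + (z - z') \<in> \<Omega>"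
      using z t by (intro cone_conditionD[OF assms(1)]) (auto simp: frontier_def)
    then show False using z frontier_not_in_open[OF assms(2)] by auto
  qed
qed

lemma transversal_subset: "transversal e \<kappa> E \<Longrightarrow> E' \<subseteq> E \<Longrightarrow> transversal e \<kappa> E'"
  unfolding transversal_def by (intro ballI allI impI) (simp add: subset_iff)

lemma norm_orthogonal_part_le:
  fixes e :: "'a::real_inner"
  assumes "norm e = 1"
  shows "norm (w - (w \<bullet> e) *\<^sub>R e) \<le> norm (w - t *\<^sub>R e)"
proof (rule power2_le_imp_le)
  have ee: "e \<bullet> e = 1" using assms by (simp add: norm_eq_1)
  have "0 \<le> (t - w \<bullet> e)\<^sup>2" by simp
  then show "(norm (w - (w \<bullet> e) *\<^sub>R e))\<^sup>2 \<le> (norm (w - t *\<^sub>R e))\<^sup>2"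
    using ee unfolding power2_norm_eq_inner
    by (simp add: inner_diff inner_commute power2_eq_square algebra_simps)
qed simp

text \<open>For w in the cone the height grows by more than (1 - \<kappa>) t, while the graph rises
  by at most C \<kappa> t. A point on or above the graph therefore ends strictly above it.\<close>

lemma lipschitz_domain_local_graph:
  fixes \<Omega> :: "'a::euclidean_space set"
  assumes "lipschitz_domain \<Omega>" "x \<in> frontier \<Omega>"
  obtains e r \<kappa> \<gamma> where "norm e = 1" "0 < r" "0 < \<kappa>" "\<kappa> \<le> 1" "continuous_on UNIV \<gamma>"
    "cone_condition \<Omega> x r e \<kappa>"
    "\<And>z. z \<in> frontier \<Omega> \<Longrightarrow> z \<in> ball x r \<Longrightarrow> \<gamma> (z - (z \<bullet> e) *\<^sub>R e) = z \<bullet> e"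
proof -
  have op: "open \<Omega>" using assms by (simp add: lipschitz_domain_def)
  have "\<forall>x\<in>frontier \<Omega>. \<exists>e r C \<gamma>. norm e = 1 \<and> 0 < r \<and> C-lipschitz_on UNIV \<gamma> \<and>
      (\<forall>y\<in>ball x r. y \<in> \<Omega> \<longleftrightarrow> \<gamma> (y - (y \<bullet> e) *\<^sub>R e) < y \<bullet> e)"
    using assms(1) unfolding lipschitz_domain_def by (elim conjE)
  from bspec[OF this assms(2)] obtain e r C \<gamma> where er: "norm e = 1" "0 < r" "C-lipschitz_on UNIV \<gamma>"
    and graph: "\<And>y. y \<in> ball x r \<Longrightarrow> y \<in> \<Omega> \<longleftrightarrow> \<gamma> (y - (y \<bullet> e) *\<^sub>R e) < y \<bullet> e"
    by (elim exE conjE) blast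
  have C: "0 \<le> C" using er(3) by (rule lipschitz_on_nonneg)
  have cont: "continuous_on UNIV \<gamma>" using er(3) by (rule lipschitz_on_continuous_on)
  have ee: "e \<bullet> e = 1" using er(1) by (simp add: norm_eq_1)
  define f where "f y = \<gamma> (y - (y \<bullet> e) *\<^sub>R e) - y \<bullet> e" for y
  have "continuous_on UNIV f"
    unfolding f_def by (intro continuous_intros continuous_on_compose2[OF cont]) auto
  then have "open (f -` {0<..})" by (intro open_vimage) auto
  \<comment> \<open>By continuity, the strict inequality on \<Omega> becomes a weak one on its
    closure.\<close>
  have above: "f y \<le> 0" if y: "y \<in> closure \<Omega>" "y \<in> ball x r" for y
  proof (rule ccontr)
    assume "\<not> f y \<le> 0"
    then have "y \<in> f -` {0<..} \<inter> ball x r" using y(2) by simp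
    moreover have "open (f -` {0<..} \<inter> ball x r)" using \<open>open (f -` {0<..})\<close> by (rule open_Int) simp
    ultimately have "f -` {0<..} \<inter> ball x r \<inter> \<Omega> \<noteq> {}"
      using y(1) open_Int_closure_eq_empty[of "f -` {0<..} \<inter> ball x r" \<Omega>] by (metis IntI empty_iff)
    then obtain z where "0 < f z" "z \<in> ball x r" "z \<in> \<Omega>" by auto
    then show False using graph[of z] by (simp add: f_def)
  qed
  \<comment> \<open>The solution of C \<kappa> = 1 - \<kappa>, which balances the two growth
    rates.\<close>
  define \<kappa> where "\<kappa> = 1 / (1 + C)"
  have \<kappa>: "0 < \<kappa>" "\<kappa> \<le> 1" "C * \<kappa> = 1 - \<kappa>" using C by (auto simp: \<kappa>_def field_simps)
  have "cone_condition \<Omega> x r e \<kappa>"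
    unfolding cone_condition_def
  proof (intro allI impI)
    fix y w and t :: real
    assume y: "y \<in> closure \<Omega>" "y \<in> ball x r" "y + w \<in> ball x r" "0 < t" and w: "norm (w - t *\<^sub>R e) < \<kappa> * t"
    have "\<bar>(w - t *\<^sub>R e) \<bullet> e\<bar> \<le> norm (w - t *\<^sub>R e)"
      using Cauchy_Schwarz_ineq2[of "w - t *\<^sub>R e" e] er(1) by simp
    then have we: "t - \<kappa> * t < w \<bullet> e" using w ee by (simp add: inner_diff_left)
    have "\<gamma> (y + w - ((y + w) \<bullet> e) *\<^sub>R e) - \<gamma> (y - (y \<bullet> e) *\<^sub>R e)
        \<le> C * dist (y + w - ((y + w) \<bullet> e) *\<^sub>R e) (y - (y \<bullet> e) *\<^sub>R e)"
      using lipschitz_onD[OF er(3), of "y + w - ((y + w) \<bullet> e) *\<^sub>R e" "y - (y \<bullet> e) *\<^sub>R e"]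
      by (simp add: dist_real_def)
    also have "dist (y + w - ((y + w) \<bullet> e) *\<^sub>R e) (y - (y \<bullet> e) *\<^sub>R e) = norm (w - (w \<bullet> e) *\<^sub>R e)"
      by (simp add: dist_norm inner_add_left algebra_simps)
    also have "C * \<dots> \<le> C * (\<kappa> * t)"
      using norm_orthogonal_part_le[OF er(1), of w t] w C by (intro mult_left_mono) auto
    also have "\<dots> = (C * \<kappa>) * t" by simp
    also have "\<dots> = t - \<kappa> * t" unfolding \<kappa>(3) by (simp add: algebra_simps)
    finally have "\<gamma> (y + w - ((y + w) \<bullet> e) *\<^sub>R e) < (y + w) \<bullet> e"
      using above[OF y(1,2)] we by (simp add: f_def inner_add_left)
    then show "y + w \<in> \<Omega>" using graph y by blast
  qed
  moreover have "\<gamma> (z - (z \<bullet> e) *\<^sub>R e) = z \<bullet> e" if z: "z \<in> frontier \<Omega>" "z \<in> ball x r" for z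
  proof -
    have "z \<in> closure \<Omega>" "z \<notin> \<Omega>" using z(1) frontier_not_in_open[OF op] by (auto simp: frontier_def)
    then show ?thesis using above[of z] graph[of z] z(2) by (simp add: f_def)
  qed
  ultimately show ?thesis by (rule that[OF er(1,2) \<kappa>(1,2) cont])
qed

lemma segment_meets_frontier:
  fixes a b :: "'a::real_normed_vector"
  assumes "a \<in> \<Omega>" "b \<notin> \<Omega>"
  obtains u where "0 \<le> u" "u \<le> 1" "a + u *\<^sub>R (b - a) \<in> frontier \<Omega>"
proof -
  have "closed_segment a b \<inter> frontier \<Omega> \<noteq> {}"
    using assms by (intro connected_Int_frontier connected_segment) auto
  then obtain u where u: "0 \<le> u" "u \<le> 1" "(1 - u) *\<^sub>R a + u *\<^sub>R b \<in> frontier \<Omega>"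
    by (auto simp: closed_segment_def)
  moreover have "(1 - u) *\<^sub>R a + u *\<^sub>R b = a + u *\<^sub>R (b - a)" by (simp add: algebra_simps)
  ultimately show ?thesis using that by metis
qed

text \<open>Hypothesis \<open>near\<close> says that T almost fills the frontier of \<Omega> around
  t. Walking from y = t + \<rho> e in direction -e1 leaves \<Omega> within the distance M \<rho>.
  The exit point z is close to some t' in T; as t' is a boundary point of \<Omega>1, the cone around
  e1 at t' contains y. Two disjoint subdomains cannot both satisfy this conclusion.\<close>

lemma above_meets_subdomain:
  fixes t e e1 :: "'a::real_normed_vector"
  assumes op: "open \<Omega>" "open \<Omega>1" and sub: "\<Omega>1 \<subseteq> \<Omega>"
    and cone: "cone_condition \<Omega> x0 r e \<kappa>" "cone_condition \<Omega>1 x0 r e1 \<kappa>"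
    and e: "norm e = 1" "norm e1 = 1" and \<kappa>: "0 < \<kappa>" "\<kappa> \<le> 1"
    and t: "t \<in> frontier \<Omega>" "t \<in> frontier \<Omega>1" and T: "T \<subseteq> frontier \<Omega> \<inter> frontier \<Omega>1"
    and M: "M = 3 / \<kappa>" and N: "N = (M + 2) / \<kappa>" and \<rho>: "0 < \<rho>"
    and loc: "\<And>y. norm (y - t) \<le> (M + N + 3) * \<rho> \<Longrightarrow> y \<in> ball x0 r"
    and near: "\<And>z. z \<in> frontier \<Omega> \<Longrightarrow> norm (z - t) \<le> (M + N + 2) * \<rho> \<Longrightarrow>
      \<exists>t'\<in>T. norm (t' - z) < \<kappa>\<^sup>2 * \<rho>"
  shows "t + \<rho> *\<^sub>R e \<in> \<Omega>1"
proof -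
  \<comment> \<open>The constants are made for two cones: \<kappa> M = 3 beats the error 2 \<rho> in
    the cone around e1, and \<kappa> N = M + 2 beats the distance (M + 1) \<rho> between y' and t in
    the cone around e.\<close>
  have MN: "3 \<le> M" "0 < N" "\<kappa> * M = 3" "\<kappa> * N = M + 2" using \<kappa> by (auto simp: M N field_simps)
  have fr: "frontier \<Omega> \<subseteq> closure \<Omega>" "frontier \<Omega>1 \<subseteq> closure \<Omega>1" by (auto simp: frontier_def)
  have \<kappa>2: "\<kappa>\<^sup>2 * \<rho> \<le> \<rho>"
    using \<kappa> \<rho> mult_right_mono[of "\<kappa>\<^sup>2" 1 \<rho>] power_le_one[of \<kappa> 2] by (simp only: mult_1)
  have t_not: "t \<notin> \<Omega>" using t op frontier_not_in_open by blast
  have loc': "t + y \<in> ball x0 r" if "norm y \<le> (M + N + 3) * \<rho>" for y using loc[of "t + y"] that by simp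
  have small: "c * \<rho> \<le> (M + N + 3) * \<rho>" if "c \<le> M + N + 3" for c using that \<rho> by (intro mult_right_mono) auto
  have tb: "t \<in> ball x0 r" using loc'[of 0] MN \<rho> by simp
  define y where "y = t + \<rho> *\<^sub>R e"
  have y\<Omega>: "y + v \<in> \<Omega>" if "norm v < \<kappa> * \<rho>" for v
  proof -
    have "norm (\<rho> *\<^sub>R e + v) \<le> \<rho> + \<kappa> * \<rho>"
      using norm_triangle_ineq[of "\<rho> *\<^sub>R e" v] e that \<rho> by simp
    also have "\<dots> \<le> 2 * \<rho>" using \<kappa> \<rho> by simp
    finally have "t + (\<rho> *\<^sub>R e + v) \<in> ball x0 r" using small[of 2] MN by (intro loc') linarith
    then have "t + (\<rho> *\<^sub>R e + v) \<in> \<Omega>"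
      using t fr tb \<rho> that by (intro cone_conditionD[OF cone(1), where t = \<rho>]) auto
    then show ?thesis by (simp add: y_def add.assoc)
  qed
  define y' where "y' = y - (M * \<rho>) *\<^sub>R e1"
  have y't: "norm (y' - t) \<le> (M + 1) * \<rho>"
    using norm_triangle_ineq4[of "\<rho> *\<^sub>R e" "(M * \<rho>) *\<^sub>R e1"] e \<rho> MN by (simp add: y'_def y_def algebra_simps)
  \<comment> \<open>If y' were in \<Omega>, the descent from y' along -e would hit the frontier in
    some point g. A point of T near g, pushed by about M \<rho> e1, arrives at t - s e, which would
    thus be in \<Omega>1; the cone of \<Omega> would then lift it to t, a point not in
    \<Omega>.\<close>
  have y'_not: "y' \<notin> \<Omega>"
  proof
    assume "y' \<in> \<Omega>"
    define b where "b = y' - (N * \<rho>) *\<^sub>R e"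
    have "norm (b - t) \<le> (M + 1) * \<rho> + N * \<rho>"
      using norm_triangle_ineq4[of "y' - t" "(N * \<rho>) *\<^sub>R e"] e \<rho> MN y't by (simp add: b_def algebra_simps)
    then have bb: "b \<in> ball x0 r" using small[of "M + 1 + N"] by (intro loc) (simp add: algebra_simps)
    have "b \<notin> \<Omega>"
    proof
      assume "b \<in> \<Omega>"
      have "norm (t - b - (N * \<rho>) *\<^sub>R e) \<le> (M + 1) * \<rho>"
        using y't by (simp add: b_def norm_minus_commute)
      also have "\<dots> < (M + 2) * \<rho>" using \<rho> by simp
      also have "\<dots> = \<kappa> * (N * \<rho>)" using MN(4) by (simp flip: mult.assoc)
      finally have "b + (t - b) \<in> \<Omega>"
        using \<open>b \<in> \<Omega>\<close> closure_subset bb tb MN \<rho> by (intro cone_conditionD[OF cone(1), where t = "N * \<rho>"]) auto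
      then show False using t_not by simp
    qed
    with \<open>y' \<in> \<Omega>\<close> obtain u where u: "0 \<le> u" "u \<le> 1" "y' + u *\<^sub>R (b - y') \<in> frontier \<Omega>"
      by (rule segment_meets_frontier)
    define s where "s = u * (N * \<rho>)"
    define g where "g = y' - s *\<^sub>R e"
    have s: "0 \<le> s" "s \<le> N * \<rho>" using u MN \<rho> by (auto simp: s_def mult_left_le_one_le)
    have g: "g \<in> frontier \<Omega>" using u(3) by (simp add: b_def g_def s_def)
    have "norm (g - t) \<le> norm (y' - t) + norm (s *\<^sub>R e)"
      using norm_triangle_ineq4[of "y' - t" "s *\<^sub>R e"] by (simp add: g_def algebra_simps)
    also have "\<dots> \<le> (M + N + 1) * \<rho>" using s e y't by (simp add: algebra_simps)
    finally have gt: "norm (g - t) \<le> (M + N + 1) * \<rho>" .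
    then have "norm (g - t) \<le> (M + N + 2) * \<rho>" using \<rho> by (simp add: algebra_simps)
    with near[OF g] obtain t' where t': "t' \<in> T" "norm (t' - g) < \<kappa>\<^sup>2 * \<rho>" by blast
    have t'g: "norm (g - t') < \<rho>" using t'(2) \<kappa>2 by (simp add: norm_minus_commute)
    have t'b: "t' \<in> ball x0 r"
    proof (rule loc)
      have "norm (t' - t) \<le> norm (t' - g) + norm (g - t)" using norm_triangle_ineq[of "t' - g" "g - t"] by simp
      then show "norm (t' - t) \<le> (M + N + 3) * \<rho>" using t'g gt \<rho> by (simp add: norm_minus_commute algebra_simps)
    qed
    define w where "w = (g - t') + ((M * \<rho>) *\<^sub>R e1 - \<rho> *\<^sub>R e)"
    have tw: "t' + w = t - s *\<^sub>R e" by (simp add: w_def g_def y'_def y_def algebra_simps)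
    have "norm (w - (M * \<rho>) *\<^sub>R e1) \<le> norm (g - t') + norm (\<rho> *\<^sub>R e)"
      using norm_triangle_ineq4[of "g - t'" "\<rho> *\<^sub>R e"] by (simp add: w_def algebra_simps)
    also have "\<dots> < 2 * \<rho>" using t'g e \<rho> by simp
    also have "\<dots> \<le> \<kappa> * (M * \<rho>)" using MN(3) \<rho> by (simp flip: mult.assoc)
    finally have ws: "norm (w - (M * \<rho>) *\<^sub>R e1) < \<kappa> * (M * \<rho>)" .
    have tsb: "t - s *\<^sub>R e \<in> ball x0 r"
      using s e small[of N] MN by (intro loc) simp
    have "t' + w \<in> \<Omega>1"
    proof (rule cone_conditionD[OF cone(2) _ t'b _ _ ws])
      show "t' \<in> closure \<Omega>1" using t' T fr by blast
      show "t' + w \<in> ball x0 r" using tsb tw by simp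
    qed (use MN \<rho> in simp)
    then have in\<Omega>: "t - s *\<^sub>R e \<in> \<Omega>" using sub tw by auto
    \<comment> \<open>The cone condition needs a positive step; for s = 0 the point is t
      itself.\<close>
    show False
    proof (cases "s = 0")
      case False
      then have "t - s *\<^sub>R e + s *\<^sub>R e \<in> \<Omega>"
        using s \<kappa> tb tsb in\<Omega> closure_subset by (intro cone_conditionD[OF cone(1), where t = s]) auto
      then show False using t_not by simp
    qed (use in\<Omega> t_not in simp)
  qed
  have "y \<in> \<Omega>" using y\<Omega>[of 0] \<kappa> \<rho> by simp
  then obtain u where u: "0 \<le> u" "u \<le> 1" "y + u *\<^sub>R (y' - y) \<in> frontier \<Omega>"
    using y'_not by (rule segment_meets_frontier)
  define s where "s = u * (M * \<rho>)"
  define z where "z = y - s *\<^sub>R e1"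
  have s: "0 \<le> s" "s \<le> M * \<rho>" using u MN \<rho> by (auto simp: s_def mult_left_le_one_le)
  have z: "z \<in> frontier \<Omega>" using u(3) by (simp add: y'_def z_def s_def)
  \<comment> \<open>The ball of radius \<kappa> \<rho> around y lies in \<Omega>, so the exit is at
    least that far away. Hence the error \<kappa>^2 \<rho> in the position of t' is at most \<kappa>
    s, as the cone at t' demands.\<close>
  have s_ge: "\<kappa> * \<rho> \<le> s"
  proof (rule ccontr)
    assume "\<not> ?thesis"
    then have "y + - (s *\<^sub>R e1) \<in> \<Omega>" using s e by (intro y\<Omega>) simp
    then show False using z op frontier_not_in_open by (auto simp: z_def)
  qed
  have "norm (z - t) \<le> \<rho> + s"
    using norm_triangle_ineq4[of "\<rho> *\<^sub>R e" "s *\<^sub>R e1"] e \<rho> s by (simp add: z_def y_def)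
  also have "\<dots> \<le> (M + N + 1) * \<rho>"
    using s mult_pos_pos[OF MN(2) \<rho>] by (simp add: algebra_simps)
  finally have zt: "norm (z - t) \<le> (M + N + 1) * \<rho>" .
  then have "norm (z - t) \<le> (M + N + 2) * \<rho>" using \<rho> by (simp add: algebra_simps)
  with near[OF z] obtain t' where t': "t' \<in> T" "norm (t' - z) < \<kappa>\<^sup>2 * \<rho>" by blast
  have t'b: "t' \<in> ball x0 r"
  proof (rule loc)
    have "norm (t' - t) \<le> norm (t' - z) + norm (z - t)" using norm_triangle_ineq[of "t' - z" "z - t"] by simp
    also have "\<dots> \<le> \<rho> + (M + N + 1) * \<rho>" using t'(2) zt \<kappa>2 by linarith
    finally show "norm (t' - t) \<le> (M + N + 3) * \<rho>" using \<rho> by (simp add: algebra_simps)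
  qed
  have "t' + (y - t') \<in> \<Omega>1"
  proof (rule cone_conditionD[OF cone(2) _ t'b, where t = s])
    show "t' \<in> closure \<Omega>1" using t' T fr by blast
    have "t + \<rho> *\<^sub>R e \<in> ball x0 r" using small[of 1] MN e \<rho> by (intro loc') simp
    then show "t' + (y - t') \<in> ball x0 r" by (simp add: y_def)
    show "0 < s" using s_ge \<kappa> \<rho> by (metis mult_pos_pos order_less_le_trans)
    have "norm (y - t' - s *\<^sub>R e1) = norm (t' - z)" by (simp add: z_def norm_minus_commute algebra_simps)
    also have "\<dots> < \<kappa> * (\<kappa> * \<rho>)" using t'(2) by (simp add: power2_eq_square)
    also have "\<dots> \<le> \<kappa> * s" using s_ge \<kappa> by (intro mult_left_mono) auto
    finally show "norm (y - t' - s *\<^sub>R e1) < \<kappa> * s" .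
  qed
  then show ?thesis by (simp add: y_def)
qed

text \<open>A finite subcover, packaged as an induction rule for properties of sets that pass to
  subsets and to unions of two sets, such as having finite or zero measure.\<close>

lemma compact_local_induct [consumes 1, case_names empty Un subset local]:
  fixes K :: "'a::metric_space set"
  assumes "compact K" and empty: "P {}" and Un: "\<And>A B. P A \<Longrightarrow> P B \<Longrightarrow> P (A \<union> B)"
    and subset: "\<And>A B. P B \<Longrightarrow> A \<subseteq> B \<Longrightarrow> P A"
    and local: "\<And>x. x \<in> K \<Longrightarrow> \<exists>d>0. P (K \<inter> ball x d)"
  shows "P K"
proof -
  obtain d where d: "\<And>x. x \<in> K \<Longrightarrow> 0 < d x" "\<And>x. x \<in> K \<Longrightarrow> P (K \<inter> ball x (d x))"
    using local by metis
  have "K \<subseteq> (\<Union>x\<in>K. ball x (d x))" using d(1) by (auto intro!: bexI)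
  then obtain F where F: "F \<subseteq> K" "finite F" "K \<subseteq> (\<Union>x\<in>F. ball x (d x))"
    using compactE_image[OF assms(1), of K "\<lambda>x. ball x (d x)"] by auto
  have "P (\<Union>x\<in>F. K \<inter> ball x (d x))" using F(2,1)
  proof induction
    case (insert x F)
    then show ?case using Un d(2) by simp
  qed (simp add: empty)
  then show ?thesis by (rule subset) (use F(3) in auto)
qed

lemma compact_frontier_lipschitz_domain:
  "lipschitz_domain \<Omega> \<Longrightarrow> compact (frontier \<Omega>)" for \<Omega> :: "'a::euclidean_space set"
  by (simp add: lipschitz_domain_def compact_frontier_bounded)

text \<open>Locally the frontier is transversal, and its thickening of height 1 stays in a ball,
  whose volume bounds the surface measure.\<close>

theorem hausdorff_outer_frontier_finite:
  fixes \<Omega> :: "'a::euclidean_space set"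
  assumes dom: "lipschitz_domain \<Omega>"
  shows "hausdorff_outer (DIM('a) - 1) (frontier \<Omega>) < top"
  using compact_frontier_lipschitz_domain[OF dom]
proof (induction rule: compact_local_induct)
  case empty
  then show ?case by (simp add: hausdorff_outer_empty)
next
  case (Un A B)
  then have "hausdorff_outer (DIM('a) - 1) A + hausdorff_outer (DIM('a) - 1) B < top" by simp
  then show ?case using hausdorff_outer_Un le_less_trans by blast
next
  case (subset A B)
  then show ?case using hausdorff_outer_mono le_less_trans by blast
next
  case (local x)
  have op: "open \<Omega>" using dom by (simp add: lipschitz_domain_def)
  obtain e r \<kappa> \<gamma> where er: "norm e = 1" "0 < r" "0 < \<kappa>" "cone_condition \<Omega> x r e \<kappa>"
    by (rule lipschitz_domain_local_graph[OF dom local])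
  have "ennreal 1 * hausdorff_outer (DIM('a) - 1) (frontier \<Omega> \<inter> ball x r) \<le>
      ennreal (2 * unit_ball_vol (real (DIM('a) - 1)) / 2 ^ (DIM('a) - 1) / \<kappa> * real (DIM('a) ^ DIM('a)))
      * emeasure lebesgue (ball x (r + 1))"
  proof (rule hausdorff_outer_le_thickening[OF er(3)])
    show "transversal e \<kappa> (frontier \<Omega> \<inter> ball x r)" by (rule cone_condition_transversal[OF er(4) op])
    show "ball x (r + 1) \<in> sets lebesgue" by (simp add: fmeasurableD)
    fix z s assume z: "z \<in> frontier \<Omega> \<inter> ball x r" and s: "0 < s" "s < (1::real)"
    have "dist x (z + s *\<^sub>R e) \<le> dist x z + dist z (z + s *\<^sub>R e)" by (rule dist_triangle)
    moreover have "dist z (z + s *\<^sub>R e) = s" using s er(1) by (simp add: dist_norm)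
    ultimately show "z + s *\<^sub>R e \<in> ball x (r + 1)" using z s by simp
  qed auto
  also have "\<dots> < top" by (intro ennreal_mult_less_top[THEN iffD2]) (simp add: emeasure_ball er(2) less_imp_le)
  finally show ?case using er(2) by auto
qed

text \<open>Thickening a piece T of the triple intersection along e turns a question about surface
  measure into one about volume. If the thickening A failed to be porous at one of its points, then
  at some scale T would almost fill the frontier of \<Omega> around a point t, and both subdomains
  would contain the same point above t. So A is porous, hence null, and then T is null.\<close>

theorem hausdorff_outer_triple_frontier:
  fixes \<Omega> \<Omega>1 \<Omega>2 :: "'a::euclidean_space set"
  assumes dom: "lipschitz_domain \<Omega>" "lipschitz_domain \<Omega>1" "lipschitz_domain \<Omega>2"
    and sub: "\<Omega>1 \<subseteq> \<Omega>" "\<Omega>2 \<subseteq> \<Omega>" and disj: "\<Omega>1 \<inter> \<Omega>2 = {}"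
  shows "hausdorff_outer (DIM('a) - 1) (frontier \<Omega> \<inter> frontier \<Omega>1 \<inter> frontier \<Omega>2) = 0"
proof -
  have op: "open \<Omega>" "open \<Omega>1" "open \<Omega>2" using dom by (auto simp: lipschitz_domain_def)
  have "compact (frontier \<Omega> \<inter> frontier \<Omega>1 \<inter> frontier \<Omega>2)"
    using compact_frontier_lipschitz_domain[OF dom(1)] by (intro compact_Int_closed) auto
  then show ?thesis
  proof (induction rule: compact_local_induct)
    case empty
    then show ?case by (rule hausdorff_outer_empty)
  next
    case (Un A B)
    then show ?case using hausdorff_outer_Un[of "DIM('a) - 1" A B] by simp
  next
    case (subset A B)
    then show ?case using hausdorff_outer_mono[of A B "DIM('a) - 1"] by simp
  next
    case (local x0)
    obtain e r0 \<kappa>0 where c0: "norm e = 1" "0 < r0" "0 < \<kappa>0" "\<kappa>0 \<le> 1" "cone_condition \<Omega> x0 r0 e \<kappa>0"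
      by (rule lipschitz_domain_local_graph[OF dom(1), of x0]) (use local in auto)
    obtain e1 r1 \<kappa>1 where c1: "norm e1 = 1" "0 < r1" "0 < \<kappa>1" "cone_condition \<Omega>1 x0 r1 e1 \<kappa>1"
      by (rule lipschitz_domain_local_graph[OF dom(2), of x0]) (use local in auto)
    obtain e2 r2 \<kappa>2 where c2: "norm e2 = 1" "0 < r2" "0 < \<kappa>2" "cone_condition \<Omega>2 x0 r2 e2 \<kappa>2"
      by (rule lipschitz_domain_local_graph[OF dom(3), of x0]) (use local in auto)
    define r where "r = min r0 (min r1 r2)"
    define \<kappa> where "\<kappa> = min \<kappa>0 (min \<kappa>1 \<kappa>2)"
    have r: "0 < r" and \<kappa>: "0 < \<kappa>" "\<kappa> \<le> 1" using c0 c1 c2 by (auto simp: r_def \<kappa>_def)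
    have cone: "cone_condition \<Omega> x0 r e \<kappa>" "cone_condition \<Omega>1 x0 r e1 \<kappa>" "cone_condition \<Omega>2 x0 r e2 \<kappa>"
      by (auto intro!: cone_condition_mono[OF c0(5)] cone_condition_mono[OF c1(4)]
        cone_condition_mono[OF c2(4)] simp: r_def \<kappa>_def)
    \<comment> \<open>Half of the radius is held back: points within r/2 of a point of T remain in
      the ball where the cone conditions hold.\<close>
    define T where "T = frontier \<Omega> \<inter> frontier \<Omega>1 \<inter> frontier \<Omega>2 \<inter> cball x0 (r/2)"
    have Tb: "z \<in> ball x0 r" if "z \<in> T" for z using that r by (auto simp: T_def)
    have T_sub: "T \<subseteq> frontier \<Omega> \<inter> frontier \<Omega>1" "T \<subseteq> frontier \<Omega> \<inter> frontier \<Omega>2" by (auto simp: T_def)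
    have "compact T" unfolding T_def by (intro closed_Int_compact) auto
    \<comment> \<open>The closed interval of heights makes A compact and thereby measurable.\<close>
    define A where "A = (\<lambda>(z, s). z + s *\<^sub>R e) ` (T \<times> {0..1::real})"
    have "compact A"
      unfolding A_def case_prod_beta using \<open>compact T\<close>
      by (intro compact_continuous_image compact_Times continuous_intros) auto
    define M where "M = 3 / \<kappa>"
    define N where "N = (M + 2) / \<kappa>"
    \<comment> \<open>Chosen so that \<epsilon> R (1 + 1/\<kappa>) = \<kappa>^2 \<rho> for R = (M +
      N + 3) \<rho>, the accuracy demanded by \<open>above_meets_subdomain\<close>. The factor 1 +
      1/\<kappa> is the loss in passing from a point of A back to T along e.\<close>
    define \<epsilon> where "\<epsilon> = \<kappa>\<^sup>2 / ((M + N + 3) * (1 + 1 / \<kappa>))"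
    have MN: "0 < M" "0 < N" "0 < M + N + 3" using \<kappa> by (auto simp: M_def N_def intro!: add_pos_pos divide_pos_pos)
    have "0 < 1 + 1 / \<kappa>" using \<kappa> by (intro add_pos_pos) auto
    have \<epsilon>: "0 < \<epsilon>" unfolding \<epsilon>_def using \<kappa> MN \<open>0 < 1 + 1 / \<kappa>\<close> by simp
    have "negligible A"
    proof (rule porous_imp_negligible[OF _ _ \<epsilon>])
      show "A \<in> sets lebesgue" using \<open>compact A\<close> by (simp add: lmeasurable_compact fmeasurableD)
      show "bounded A" using \<open>compact A\<close> by (rule compact_imp_bounded)
      fix a and d :: real assume "a \<in> A" "0 < d"
      then obtain t s where ts: "t \<in> T" "a = t + s *\<^sub>R e" by (auto simp: A_def)
      define \<rho> where "\<rho> = min d (r/2) / 2 / (M + N + 3)"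
      \<comment> \<open>Large enough for every point z + s e with |z - t| at most (M + N + 2)
        \<rho>, together with its ball of radius \<rho>.\<close>
      define R where "R = (M + N + 3) * \<rho>"
      have \<rho>: "0 < \<rho>" using MN \<open>0 < d\<close> r by (simp add: \<rho>_def)
      have "R = min d (r/2) / 2" using MN(3) unfolding R_def \<rho>_def by (intro nonzero_mult_div_cancel_left[THEN trans[OF times_divide_eq_right]]) simp
      then have R: "0 < R" "R < d" "R < r/2" using \<open>0 < d\<close> r by auto
      have \<epsilon>R: "\<epsilon> * R * (1 + 1 / \<kappa>) = \<kappa>\<^sup>2 * \<rho>"
        using MN \<open>0 < 1 + 1 / \<kappa>\<close> by (simp add: \<epsilon>_def R_def)
      have "\<epsilon> * R \<le> \<epsilon> * R * (1 + 1 / \<kappa>)" using \<epsilon> R \<kappa> by (simp add: distrib_left)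
      also have "\<dots> \<le> 1 * \<rho>" unfolding \<epsilon>R using \<kappa> \<rho> by (intro mult_right_mono power_le_one) auto
      finally have \<epsilon>R_le: "\<epsilon> * R \<le> \<rho>" by simp
      show "\<exists>r b. 0 < r \<and> r < d \<and> ball b (\<epsilon> * r) \<subseteq> ball a r \<and> ball b (\<epsilon> * r) \<inter> A = {}"
      proof (rule ccontr)
        assume no_hole: "\<not> ?thesis"
        \<comment> \<open>The absence of holes becomes density of T: the ball around z + s e is not
          a hole, so it contains a point of A, whose foot point in T is close to z.\<close>
        have near: "\<exists>t'\<in>T. norm (t' - z) < \<kappa>\<^sup>2 * \<rho>"
          if z: "z \<in> frontier \<Omega>" "norm (z - t) \<le> (M + N + 2) * \<rho>" for z
        proof -
          have "ball (z + s *\<^sub>R e) (\<epsilon> * R) \<subseteq> ball a R"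
          proof
            fix y assume "y \<in> ball (z + s *\<^sub>R e) (\<epsilon> * R)"
            then have "dist (z + s *\<^sub>R e) y < \<rho>" using \<epsilon>R_le by simp
            moreover have "dist a (z + s *\<^sub>R e) = norm (z - t)" by (simp add: ts(2) dist_norm norm_minus_commute)
            ultimately have "dist a y < (M + N + 2) * \<rho> + \<rho>"
              using z(2) dist_triangle[of a y "z + s *\<^sub>R e"] by linarith
            then show "y \<in> ball a R" by (simp add: R_def algebra_simps)
          qed
          with no_hole R have "ball (z + s *\<^sub>R e) (\<epsilon> * R) \<inter> A \<noteq> {}" by blast
          then obtain t' s' where t': "t' \<in> T" "dist (z + s *\<^sub>R e) (t' + s' *\<^sub>R e) < \<epsilon> * R"
            by (auto simp: A_def)
          define \<eta> where "\<eta> = norm (t' + s' *\<^sub>R e - (z + s *\<^sub>R e))"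
          have \<eta>: "\<eta> < \<epsilon> * R" using t'(2) by (simp add: \<eta>_def dist_norm norm_minus_commute)
          have zb: "z \<in> ball x0 r"
          proof -
            have "dist x0 z \<le> dist x0 t + norm (z - t)"
              using dist_triangle[of x0 z t] by (simp add: dist_norm norm_minus_commute)
            also have "norm (z - t) \<le> R" using z(2) \<rho> by (simp add: R_def algebra_simps)
            finally show ?thesis using ts(1) R(3) by (simp add: T_def)
          qed
          \<comment> \<open>Transversality of the whole frontier near x0 is used here, since z need
            not be in T: nearby thickened points have nearby heights.\<close>
          have "\<kappa> * \<bar>s' - s\<bar> \<le> \<eta>"
            unfolding \<eta>_def
            by (rule transversalD[OF cone_condition_transversal[OF cone(1) op(1)]])
              (use t'(1) Tb z(1) zb in \<open>auto simp: T_def\<close>)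
          then have s's: "\<bar>s' - s\<bar> \<le> \<eta> / \<kappa>" using \<kappa> by (simp add: field_simps)
          have "norm (t' - z) \<le> \<eta> + norm ((s' - s) *\<^sub>R e)"
            using norm_triangle_ineq4[of "t' + s' *\<^sub>R e - (z + s *\<^sub>R e)" "(s' - s) *\<^sub>R e"]
            by (simp add: \<eta>_def algebra_simps)
          also have "\<dots> \<le> \<eta> * (1 + 1 / \<kappa>)" using s's c0(1) by (simp add: distrib_left)
          also have "\<dots> < \<epsilon> * R * (1 + 1 / \<kappa>)" using \<eta> \<open>0 < 1 + 1 / \<kappa>\<close> by (intro mult_strict_right_mono)
          finally show ?thesis using t'(1) \<epsilon>R by auto
        qed
        have loc: "y \<in> ball x0 r" if "norm (y - t) \<le> (M + N + 3) * \<rho>" for y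
        proof -
          have "dist x0 y \<le> dist x0 t + norm (y - t)"
            using dist_triangle[of x0 y t] by (simp add: dist_norm norm_minus_commute)
          then show ?thesis using that ts(1) R(3) by (simp add: T_def R_def)
        qed
        have fr: "t \<in> frontier \<Omega>" "t \<in> frontier \<Omega>1" "t \<in> frontier \<Omega>2" using ts(1) by (auto simp: T_def)
        have "t + \<rho> *\<^sub>R e \<in> \<Omega>1"
          by (rule above_meets_subdomain[OF op(1,2) sub(1) cone(1,2) c0(1) c1(1) \<kappa> fr(1,2) T_sub(1) M_def N_def \<rho> loc near])
        moreover have "t + \<rho> *\<^sub>R e \<in> \<Omega>2"
          by (rule above_meets_subdomain[OF op(1,3) sub(2) cone(1,3) c0(1) c2(1) \<kappa> fr(1,3) T_sub(2) M_def N_def \<rho> loc near])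
        ultimately show False using disj by blast
      qed
    qed
    then have null: "emeasure lebesgue A = 0" by (simp add: negligible_iff_emeasure0 negligible_iff_null_sets null_setsD1)
    have "ennreal 1 * hausdorff_outer (DIM('a) - 1) T \<le>
        ennreal (2 * unit_ball_vol (real (DIM('a) - 1)) / 2 ^ (DIM('a) - 1) / \<kappa> * real (DIM('a) ^ DIM('a)))
        * emeasure lebesgue A"
    proof (rule hausdorff_outer_le_thickening[OF \<kappa>(1)])
      show "transversal e \<kappa> T"
        by (rule transversal_subset[OF cone_condition_transversal[OF cone(1) op(1)]]) (use Tb in \<open>auto simp: T_def\<close>)
      show "A \<in> sets lebesgue" using \<open>compact A\<close> by (simp add: lmeasurable_compact fmeasurableD)
      show "bounded A" using \<open>compact A\<close> by (rule compact_imp_bounded)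
      fix z s assume "z \<in> T" "0 < s" "s < (1::real)"
      then show "z + s *\<^sub>R e \<in> A" unfolding A_def by (intro image_eqI[of _ _ "(z, s)"]) auto
    qed simp
    then have "hausdorff_outer (DIM('a) - 1) T = 0" using null by simp
    moreover have "frontier \<Omega> \<inter> frontier \<Omega>1 \<inter> frontier \<Omega>2 \<inter> ball x0 (r/2) \<subseteq> T" by (auto simp: T_def)
    ultimately have "hausdorff_outer (DIM('a) - 1) (frontier \<Omega> \<inter> frontier \<Omega>1 \<inter> frontier \<Omega>2 \<inter> ball x0 (r/2)) = 0"
      using hausdorff_outer_mono[of _ T "DIM('a) - 1"] by (metis le_zero_eq)
    then show ?case using r by (intro exI[of _ "r/2"]) simp
  qed
qed

text \<open>Directly below a boundary point x of \<Omega>1, against the cone axis, there are no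
  points of the closure of \<Omega>1, because the cone would lift them to x. Inside \<Omega> such
  points must belong to the closure of \<Omega>2.\<close>

lemma frontier_subdomain_interior:
  fixes \<Omega> \<Omega>1 \<Omega>2 :: "'a::euclidean_space set"
  assumes dom: "lipschitz_domain \<Omega>1" and op: "open \<Omega>" "open \<Omega>2"
    and dec: "closure \<Omega> = closure \<Omega>1 \<union> closure \<Omega>2" and disj: "\<Omega>1 \<inter> \<Omega>2 = {}"
  shows "frontier \<Omega>1 \<inter> \<Omega> \<subseteq> frontier \<Omega>2"
proof
  fix x assume x: "x \<in> frontier \<Omega>1 \<inter> \<Omega>"
  have op1: "open \<Omega>1" using dom by (simp add: lipschitz_domain_def)
  obtain e r \<kappa> where c: "norm e = 1" "0 < r" "0 < \<kappa>" "cone_condition \<Omega>1 x r e \<kappa>"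
    by (rule lipschitz_domain_local_graph[OF dom, of x]) (use x in auto)
  obtain d where d: "0 < d" "ball x d \<subseteq> \<Omega>" using op(1) x by (meson IntD2 open_contains_ball)
  have "x \<in> closure \<Omega>2"
    unfolding closure_approachable
  proof (intro allI impI)
    fix \<epsilon> :: real assume "0 < \<epsilon>"
    define t where "t = min (\<epsilon>/2) (min r d) / 2"
    have t: "0 < t" "t < \<epsilon>/2" "t < r" "t < d" using \<open>0 < \<epsilon>\<close> c d by (auto simp: t_def)
    have "x - t *\<^sub>R e \<notin> closure \<Omega>1"
    proof
      assume "x - t *\<^sub>R e \<in> closure \<Omega>1"
      then have "x - t *\<^sub>R e + t *\<^sub>R e \<in> \<Omega>1"
        using c t by (intro cone_conditionD[OF c(4), where t = t]) auto
      then show False using x frontier_not_in_open[OF op1] by auto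
    qed
    moreover have "x - t *\<^sub>R e \<in> closure \<Omega>" using d t c by (intro closure_subset[THEN subsetD] subsetD[OF d(2)]) simp
    ultimately have "x - t *\<^sub>R e \<in> closure \<Omega>2" using dec by blast
    then obtain y where "y \<in> \<Omega>2" "dist y (x - t *\<^sub>R e) < \<epsilon>/2"
      using \<open>0 < \<epsilon>\<close> closure_approachable by (metis half_gt_zero)
    moreover have "dist (x - t *\<^sub>R e) x = t" using t c by (simp add: dist_norm)
    ultimately show "\<exists>y\<in>\<Omega>2. dist y x < \<epsilon>"
      using t dist_triangle[of y x "x - t *\<^sub>R e"] by (intro bexI[of _ y]) auto
  qed
  moreover have "x \<notin> \<Omega>2"
  proof
    assume "x \<in> \<Omega>2"
    then have "\<Omega>2 \<inter> closure \<Omega>1 \<noteq> {}" using x by (auto simp: frontier_def)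
    then show False using open_Int_closure_eq_empty[OF op(2), of \<Omega>1] disj by (simp add: Int_commute)
  qed
  ultimately show "x \<in> frontier \<Omega>2" using op(2) by (simp add: frontier_def interior_open)
qed

section \<open>A Poincare inequality\<close>

text \<open>Squared norms with values in \<open>ennreal\<close> over \<open>lborel\<close>: up to
  the Poincare inequality only measurability is required, and translation invariance and Tonelli
  apply directly.\<close>

definition mass :: "'a::euclidean_space set \<Rightarrow> ('a \<Rightarrow> real) \<Rightarrow> ennreal" where
  "mass A \<phi> = (\<integral>\<^sup>+x. ennreal ((\<phi> x)\<^sup>2) * indicator A x \<partial>lborel)"

definition energy :: "'a::euclidean_space set \<Rightarrow> ('a \<Rightarrow> real) \<Rightarrow> ennreal" where
  "energy A \<phi> = (\<integral>\<^sup>+x. ennreal ((norm (grad \<phi> x))\<^sup>2) * indicator A x \<partial>lborel)"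

lemma nn_integral_lborel_translate:
  fixes c :: "'a::euclidean_space"
  assumes [measurable]: "f \<in> borel_measurable borel"
  shows "(\<integral>\<^sup>+x. f (x + c) \<partial>lborel) = (\<integral>\<^sup>+x. f x \<partial>lborel)"
proof -
  have "(\<integral>\<^sup>+x. f x \<partial>lborel) = (\<integral>\<^sup>+x. f x \<partial>(distr lborel borel ((+) c)))" by (simp add: lborel_distr_plus)
  also have "\<dots> = (\<integral>\<^sup>+x. f (c + x) \<partial>lborel)" by (subst nn_integral_distr) auto
  finally show ?thesis by (simp add: add.commute)
qed

lemma nn_integral_lborel_swap:
  fixes f :: "'a::euclidean_space \<Rightarrow> 'b::euclidean_space \<Rightarrow> ennreal"
  assumes "(\<lambda>(x, y). f x y) \<in> borel_measurable (borel \<Otimes>\<^sub>M borel)"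
  shows "(\<integral>\<^sup>+x. \<integral>\<^sup>+y. f x y \<partial>lborel \<partial>lborel) = (\<integral>\<^sup>+y. \<integral>\<^sup>+x. f x y \<partial>lborel \<partial>lborel)"
proof -
  have "(\<lambda>(x, y). f x y) \<in> borel_measurable (lborel \<Otimes>\<^sub>M lborel)"
    using assms by (simp cong: measurable_cong_sets sets_pair_measure_cong)
  from lborel_pair.Fubini'[OF this] show ?thesis by simp
qed

lemma borel_measurable_C1_borel [measurable]:
  assumes "\<phi> \<in> C1_functions"
  shows "\<phi> \<in> borel_measurable borel" "grad \<phi> \<in> borel_measurable borel"
  using borel_measurable_C1[OF assms, of borel] by simp_all

lemma mass_mono: "A \<subseteq> B \<Longrightarrow> mass A \<phi> \<le> mass B \<phi>"
  unfolding mass_def by (intro nn_integral_mono mult_left_mono) (auto simp: indicator_def)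

lemma mass_Un:
  assumes "\<phi> \<in> C1_functions" "A \<in> sets borel" "B \<in> sets borel"
  shows "mass (A \<union> B) \<phi> \<le> mass A \<phi> + mass B \<phi>"
proof -
  have [measurable]: "\<phi> \<in> borel_measurable borel" "A \<in> sets borel" "B \<in> sets borel"
    using assms borel_measurable_C1_borel by auto
  have "mass (A \<union> B) \<phi> \<le> (\<integral>\<^sup>+x. ennreal ((\<phi> x)\<^sup>2) * indicator A x + ennreal ((\<phi> x)\<^sup>2) * indicator B x \<partial>lborel)"
    unfolding mass_def by (intro nn_integral_mono) (auto simp: indicator_def)
  also have "\<dots> = mass A \<phi> + mass B \<phi>" unfolding mass_def by (rule nn_integral_add) measurable
  finally show ?thesis .
qed

text \<open>The line estimate is integrated over x. For each fixed t, the translation by t v maps A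
  into \<Omega>, so this slice contributes at most the whole energy, and t runs over an interval of
  length 1.\<close>

lemma translation_estimate:
  fixes v :: "'a::euclidean_space"
  assumes \<phi>: "\<phi> \<in> C1_functions" and \<Omega>: "\<Omega> \<in> sets borel"
    and seg: "\<And>x t. x \<in> A \<Longrightarrow> 0 \<le> t \<Longrightarrow> t \<le> 1 \<Longrightarrow> x + t *\<^sub>R v \<in> \<Omega>"
  shows "(\<integral>\<^sup>+x. ennreal ((\<phi> (x + v) - \<phi> x)\<^sup>2) * indicator A x \<partial>lborel) \<le> ennreal ((norm v)\<^sup>2) * energy \<Omega> \<phi>"
proof -
  have [measurable]: "grad \<phi> \<in> borel_measurable borel" "\<Omega> \<in> sets borel"
    using \<Omega> borel_measurable_C1_borel[OF \<phi>] by auto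
  define H where "H x = ennreal ((norm (grad \<phi> x))\<^sup>2) * indicator \<Omega> x" for x
  have [measurable]: "H \<in> borel_measurable borel" unfolding H_def by measurable
  have "(\<integral>\<^sup>+x. ennreal ((\<phi> (x + v) - \<phi> x)\<^sup>2) * indicator A x \<partial>lborel)
      \<le> (\<integral>\<^sup>+x. ennreal ((norm v)\<^sup>2) * (\<integral>\<^sup>+t. H (x + t *\<^sub>R v) * indicator {0..1} t \<partial>lborel) \<partial>lborel)"
  proof (rule nn_integral_mono)
    fix x
    show "ennreal ((\<phi> (x + v) - \<phi> x)\<^sup>2) * indicator A x
        \<le> ennreal ((norm v)\<^sup>2) * (\<integral>\<^sup>+t. H (x + t *\<^sub>R v) * indicator {0..1} t \<partial>lborel)"
    proof (cases "x \<in> A")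
      case True
      have "ennreal ((\<phi> (x + v) - \<phi> x)\<^sup>2) \<le> ennreal ((norm v)\<^sup>2) *
          (\<integral>\<^sup>+t. ennreal ((norm (grad \<phi> (x + t *\<^sub>R v)))\<^sup>2) * indicator {0..1} t \<partial>lborel)"
        using C1_line_estimate[OF \<phi>, of 1 x v] by simp
      also have "(\<integral>\<^sup>+t. ennreal ((norm (grad \<phi> (x + t *\<^sub>R v)))\<^sup>2) * indicator {0..1} t \<partial>lborel)
          = (\<integral>\<^sup>+t. H (x + t *\<^sub>R v) * indicator {0..1} t \<partial>lborel)"
        using seg[OF True] by (intro nn_integral_cong) (auto simp: H_def indicator_def)
      finally show ?thesis using True by simp
    qed simp
  qed
  also have "\<dots> = ennreal ((norm v)\<^sup>2) * (\<integral>\<^sup>+x. \<integral>\<^sup>+t. H (x + t *\<^sub>R v) * indicator {0..1} t \<partial>lborel \<partial>lborel)"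
    by (rule nn_integral_cmult) measurable
  also have "(\<integral>\<^sup>+x. \<integral>\<^sup>+t. H (x + t *\<^sub>R v) * indicator {0..1} t \<partial>lborel \<partial>lborel)
      = (\<integral>\<^sup>+t. \<integral>\<^sup>+x. H (x + t *\<^sub>R v) * indicator {0..1::real} t \<partial>lborel \<partial>lborel)"
    by (rule nn_integral_lborel_swap) measurable
  also have "\<dots> = (\<integral>\<^sup>+t. energy \<Omega> \<phi> * indicator {0..1::real} t \<partial>lborel)"
  proof (intro nn_integral_cong)
    fix t :: real
    have "(\<integral>\<^sup>+x. H (x + t *\<^sub>R v) * indicator {0..1::real} t \<partial>lborel) = (\<integral>\<^sup>+x. H (x + t *\<^sub>R v) \<partial>lborel) * indicator {0..1::real} t"
      by (rule nn_integral_multc) measurable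
    then show "(\<integral>\<^sup>+x. H (x + t *\<^sub>R v) * indicator {0..1::real} t \<partial>lborel) = energy \<Omega> \<phi> * indicator {0..1::real} t"
      using nn_integral_lborel_translate[of H "t *\<^sub>R v"] by (simp add: energy_def H_def)
  qed
  also have "\<dots> = energy \<Omega> \<phi>" by (subst nn_integral_cmult_indicator) auto
  finally show ?thesis .
qed

section \<open>Propagating control of the mass through a domain\<close>

lemma ennreal_square_le_double: "ennreal (a\<^sup>2) \<le> 2 * ennreal (b\<^sup>2) + 2 * ennreal ((b - a)\<^sup>2)"
proof -
  have "0 \<le> (2 * b - a)\<^sup>2" by simp
  then have "a\<^sup>2 \<le> 2 * b\<^sup>2 + 2 * (b - a)\<^sup>2" by (simp add: power2_eq_square algebra_simps)
  then have "ennreal (a\<^sup>2) \<le> ennreal (2 * b\<^sup>2 + 2 * (b - a)\<^sup>2)" by (rule ennreal_leI)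
  also have "\<dots> = 2 * ennreal (b\<^sup>2) + 2 * ennreal ((b - a)\<^sup>2)" by (simp add: ennreal_mult)
  finally show ?thesis .
qed

text \<open>The relation is transitive in A and B, so the Poincare inequality can be assembled by
  moving mass from set to set until it reaches a place where the function is known. The energy is
  always that of the whole of \<Omega>.\<close>

definition controlled :: "'a::euclidean_space set \<Rightarrow> 'a set \<Rightarrow> 'a set \<Rightarrow> bool" where
  "controlled \<Omega> A B \<longleftrightarrow> (\<exists>C\<ge>0. \<forall>\<phi>\<in>C1_functions. mass A \<phi> \<le> ennreal C * (mass B \<phi> + energy \<Omega> \<phi>))"

lemma controlledI:
  assumes "0 \<le> a" "0 \<le> b" "\<And>\<phi>. \<phi> \<in> C1_functions \<Longrightarrow> mass A \<phi> \<le> ennreal a * mass B \<phi> + ennreal b * energy \<Omega> \<phi>"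
  shows "controlled \<Omega> A B"
  unfolding controlled_def
proof (intro exI[of _ "a + b"] conjI ballI)
  fix \<phi> :: "'a \<Rightarrow> real" assume "\<phi> \<in> C1_functions"
  then have "mass A \<phi> \<le> ennreal a * mass B \<phi> + ennreal b * energy \<Omega> \<phi>" by (rule assms)
  also have "\<dots> \<le> ennreal (a + b) * mass B \<phi> + ennreal (a + b) * energy \<Omega> \<phi>"
    using assms by (intro add_mono mult_right_mono ennreal_leI) auto
  finally show "mass A \<phi> \<le> ennreal (a + b) * (mass B \<phi> + energy \<Omega> \<phi>)" by (simp add: distrib_left)
qed (use assms in auto)

lemma controlled_subset: "A \<subseteq> B \<Longrightarrow> controlled \<Omega> A B"
  by (rule controlledI[of 1 0]) (auto intro: mass_mono)

lemma controlled_trans: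
  assumes "controlled \<Omega> A B" "controlled \<Omega> B D"
  shows "controlled \<Omega> A D"
proof -
  obtain a where a: "0 \<le> a" "\<And>\<phi>. \<phi> \<in> C1_functions \<Longrightarrow> mass A \<phi> \<le> ennreal a * (mass B \<phi> + energy \<Omega> \<phi>)"
    using assms(1) unfolding controlled_def by blast
  obtain b where b: "0 \<le> b" "\<And>\<phi>. \<phi> \<in> C1_functions \<Longrightarrow> mass B \<phi> \<le> ennreal b * (mass D \<phi> + energy \<Omega> \<phi>)"
    using assms(2) unfolding controlled_def by blast
  show ?thesis
  proof (rule controlledI[of "a * b" "a * (b + 1)"])
    fix \<phi> :: "'a \<Rightarrow> real" assume \<phi>: "\<phi> \<in> C1_functions"
    have "mass A \<phi> \<le> ennreal a * (ennreal b * (mass D \<phi> + energy \<Omega> \<phi>) + energy \<Omega> \<phi>)"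
      using a(2)[OF \<phi>] b(2)[OF \<phi>] by (meson add_right_mono mult_left_mono order_trans zero_le)
    also have "\<dots> = ennreal (a * b) * mass D \<phi> + ennreal (a * (b + 1)) * energy \<Omega> \<phi>"
      using a(1) b(1) by (simp add: ennreal_mult distrib_left distrib_right mult.assoc add.assoc)
    finally show "mass A \<phi> \<le> ennreal (a * b) * mass D \<phi> + ennreal (a * (b + 1)) * energy \<Omega> \<phi>" .
  qed (use a b in auto)
qed

lemma controlled_Un:
  assumes "controlled \<Omega> A D" "controlled \<Omega> B D" "A \<in> sets borel" "B \<in> sets borel"
  shows "controlled \<Omega> (A \<union> B) D"
proof -
  obtain a where a: "0 \<le> a" "\<And>\<phi>. \<phi> \<in> C1_functions \<Longrightarrow> mass A \<phi> \<le> ennreal a * (mass D \<phi> + energy \<Omega> \<phi>)"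
    using assms(1) unfolding controlled_def by blast
  obtain b where b: "0 \<le> b" "\<And>\<phi>. \<phi> \<in> C1_functions \<Longrightarrow> mass B \<phi> \<le> ennreal b * (mass D \<phi> + energy \<Omega> \<phi>)"
    using assms(2) unfolding controlled_def by blast
  show ?thesis unfolding controlled_def
  proof (intro exI[of _ "a + b"] conjI ballI)
    fix \<phi> :: "'a \<Rightarrow> real" assume \<phi>: "\<phi> \<in> C1_functions"
    have "mass (A \<union> B) \<phi> \<le> mass A \<phi> + mass B \<phi>" by (rule mass_Un[OF \<phi> assms(3,4)])
    also have "\<dots> \<le> ennreal a * (mass D \<phi> + energy \<Omega> \<phi>) + ennreal b * (mass D \<phi> + energy \<Omega> \<phi>)"
      by (intro add_mono a b \<phi>)
    finally show "mass (A \<union> B) \<phi> \<le> ennreal (a + b) * (mass D \<phi> + energy \<Omega> \<phi>)"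
      using a b by (simp add: distrib_right)
  qed (use a b in auto)
qed

text \<open>Compares \<phi> x with \<phi> (x + v). This is the tool near the boundary, where no ball
  around the point fits into \<Omega>.\<close>

lemma controlled_translate:
  fixes v :: "'a::euclidean_space"
  assumes \<Omega>: "\<Omega> \<in> sets borel" and A: "A \<in> sets borel" and B: "B \<in> sets borel"
    and AB: "\<And>x. x \<in> A \<Longrightarrow> x + v \<in> B"
    and seg: "\<And>x t. x \<in> A \<Longrightarrow> 0 \<le> t \<Longrightarrow> t \<le> 1 \<Longrightarrow> x + t *\<^sub>R v \<in> \<Omega>"
  shows "controlled \<Omega> A B"
proof (rule controlledI[of 2 "2 * (norm v)\<^sup>2"])
  fix \<phi> :: "'a \<Rightarrow> real" assume \<phi>: "\<phi> \<in> C1_functions"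
  have [measurable]: "\<phi> \<in> borel_measurable borel" "A \<in> sets borel" "B \<in> sets borel"
    using assms borel_measurable_C1_borel[OF \<phi>] by auto
  have "mass A \<phi> \<le> (\<integral>\<^sup>+x. 2 * (ennreal ((\<phi> (x + v))\<^sup>2) * indicator B (x + v))
      + 2 * (ennreal ((\<phi> (x + v) - \<phi> x)\<^sup>2) * indicator A x) \<partial>lborel)"
    unfolding mass_def
  proof (rule nn_integral_mono)
    fix x
    show "ennreal ((\<phi> x)\<^sup>2) * indicator A x \<le> 2 * (ennreal ((\<phi> (x + v))\<^sup>2) * indicator B (x + v))
      + 2 * (ennreal ((\<phi> (x + v) - \<phi> x)\<^sup>2) * indicator A x)"
      using ennreal_square_le_double[of "\<phi> x" "\<phi> (x + v)"] AB[of x] by (cases "x \<in> A") auto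
  qed
  also have "\<dots> = 2 * (\<integral>\<^sup>+x. ennreal ((\<phi> (x + v))\<^sup>2) * indicator B (x + v) \<partial>lborel)
      + 2 * (\<integral>\<^sup>+x. ennreal ((\<phi> (x + v) - \<phi> x)\<^sup>2) * indicator A x \<partial>lborel)"
    by (subst nn_integral_add, measurable, subst (1 2) nn_integral_cmult, measurable)
  also have "(\<integral>\<^sup>+x. ennreal ((\<phi> (x + v))\<^sup>2) * indicator B (x + v) \<partial>lborel) = mass B \<phi>"
    unfolding mass_def by (rule nn_integral_lborel_translate[where f = "\<lambda>x. ennreal ((\<phi> x)\<^sup>2) * indicator B x"]) measurable
  also have "2 * mass B \<phi> + 2 * (\<integral>\<^sup>+x. ennreal ((\<phi> (x + v) - \<phi> x)\<^sup>2) * indicator A x \<partial>lborel)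
      \<le> 2 * mass B \<phi> + 2 * (ennreal ((norm v)\<^sup>2) * energy \<Omega> \<phi>)"
    by (intro add_left_mono mult_left_mono translation_estimate[OF \<phi> \<Omega> seg]) auto
  finally show "mass A \<phi> \<le> ennreal 2 * mass B \<phi> + ennreal (2 * (norm v)\<^sup>2) * energy \<Omega> \<phi>"
    by (simp add: ennreal_mult mult.assoc)
qed auto

text \<open>The differences \<phi> y - \<phi> x are squared and integrated over pairs x in K, y in
  B. After the substitution y = x + v, convexity keeps the segments in \<Omega> and
  \<open>translation_estimate\<close> applies for each fixed v; only v of norm at most the diameter
  D occur. Division by the measure of B gives the constants.\<close>

lemma controlled_convex:
  fixes K :: "'a::euclidean_space set"
  assumes \<Omega>: "\<Omega> \<in> sets borel" and K: "convex K" "bounded K" "K \<in> sets borel" "K \<subseteq> \<Omega>"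
    and B: "B \<in> sets borel" "B \<subseteq> K" "0 < emeasure lborel B"
  shows "controlled \<Omega> K B"
proof -
  have fin: "emeasure lborel K < top" "emeasure lborel B < top"
    using emeasure_bounded_finite[OF K(2)] emeasure_bounded_finite[OF bounded_subset[OF K(2) B(2)]] by simp_all
  define k where "k = measure lborel K"
  define b where "b = measure lborel B"
  have k: "emeasure lborel K = ennreal k" "0 \<le> k" and b: "emeasure lborel B = ennreal b"
    using fin by (simp_all add: k_def b_def emeasure_eq_ennreal_measure less_top)
  have bpos: "0 < b" using B(3) b by (simp add: ennreal_less_zero_iff)
  define D where "D = diameter K"
  define c where "c = measure lborel (cball (0::'a) D)"
  have c: "emeasure lborel (cball (0::'a) D) = ennreal c" "0 \<le> c"
    using emeasure_bounded_finite[OF bounded_cball, of "0::'a" D]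
    by (simp_all add: c_def emeasure_eq_ennreal_measure less_top)
  show ?thesis
  proof (rule controlledI[of "1 / b * (2 * k)" "1 / b * (2 * (D\<^sup>2 * c))"])
    fix \<phi> :: "'a \<Rightarrow> real" assume \<phi>: "\<phi> \<in> C1_functions"
    have [measurable]: "\<phi> \<in> borel_measurable borel" "K \<in> sets borel" "B \<in> sets borel"
      using assms borel_measurable_C1_borel[OF \<phi>] by auto
    define Z where "Z x y = ennreal ((\<phi> y - \<phi> x)\<^sup>2) * indicator K x * indicator B y" for x y
    have [measurable]: "(\<lambda>(x, y). Z x y) \<in> borel_measurable (borel \<Otimes>\<^sub>M borel)"
      "(\<lambda>(x, v). Z x (x + v)) \<in> borel_measurable (borel \<Otimes>\<^sub>M borel)"
      unfolding Z_def by measurable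
    have Zx [measurable]: "Z x \<in> borel_measurable borel" for x unfolding Z_def by measurable
    have "mass K \<phi> * emeasure lborel B = (\<integral>\<^sup>+x. ennreal ((\<phi> x)\<^sup>2) * indicator K x * emeasure lborel B \<partial>lborel)"
      unfolding mass_def by (rule nn_integral_multc[symmetric]) measurable
    also have "\<dots> = (\<integral>\<^sup>+x. \<integral>\<^sup>+y. ennreal ((\<phi> x)\<^sup>2) * indicator K x * indicator B y \<partial>lborel \<partial>lborel)"
      by (intro nn_integral_cong) (subst nn_integral_cmult_indicator, auto)
    also have "\<dots> \<le> (\<integral>\<^sup>+x. \<integral>\<^sup>+y. 2 * indicator K x * (ennreal ((\<phi> y)\<^sup>2) * indicator B y) + 2 * Z x y \<partial>lborel \<partial>lborel)"
    proof (intro nn_integral_mono)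
      fix x y
      show "ennreal ((\<phi> x)\<^sup>2) * indicator K x * indicator B y
          \<le> 2 * indicator K x * (ennreal ((\<phi> y)\<^sup>2) * indicator B y) + 2 * Z x y"
        using ennreal_square_le_double[of "\<phi> x" "\<phi> y"] by (simp add: Z_def indicator_def)
    qed
    also have "\<dots> = (\<integral>\<^sup>+x. 2 * mass B \<phi> * indicator K x + 2 * (\<integral>\<^sup>+y. Z x y \<partial>lborel) \<partial>lborel)"
    proof (intro nn_integral_cong)
      fix x
      have "(\<integral>\<^sup>+y. 2 * indicator K x * (ennreal ((\<phi> y)\<^sup>2) * indicator B y) + 2 * Z x y \<partial>lborel)
          = (\<integral>\<^sup>+y. 2 * indicator K x * (ennreal ((\<phi> y)\<^sup>2) * indicator B y) \<partial>lborel) + (\<integral>\<^sup>+y. 2 * Z x y \<partial>lborel)"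
        by (rule nn_integral_add) measurable
      also have "(\<integral>\<^sup>+y. 2 * indicator K x * (ennreal ((\<phi> y)\<^sup>2) * indicator B y) \<partial>lborel) = 2 * indicator K x * mass B \<phi>"
        unfolding mass_def by (rule nn_integral_cmult) measurable
      also have "(\<integral>\<^sup>+y. 2 * Z x y \<partial>lborel) = 2 * (\<integral>\<^sup>+y. Z x y \<partial>lborel)"
        by (rule nn_integral_cmult) measurable
      finally show "(\<integral>\<^sup>+y. 2 * indicator K x * (ennreal ((\<phi> y)\<^sup>2) * indicator B y) + 2 * Z x y \<partial>lborel)
          = 2 * mass B \<phi> * indicator K x + 2 * (\<integral>\<^sup>+y. Z x y \<partial>lborel)" by (simp add: mult_ac)
    qed
    also have "\<dots> = (\<integral>\<^sup>+x. 2 * mass B \<phi> * indicator K x \<partial>lborel) + (\<integral>\<^sup>+x. 2 * (\<integral>\<^sup>+y. Z x y \<partial>lborel) \<partial>lborel)"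
      by (rule nn_integral_add) measurable
    also have "(\<integral>\<^sup>+x. 2 * mass B \<phi> * indicator K x \<partial>lborel) = 2 * mass B \<phi> * ennreal k"
      by (subst nn_integral_cmult_indicator) (auto simp: k)
    also have "(\<integral>\<^sup>+x. 2 * (\<integral>\<^sup>+y. Z x y \<partial>lborel) \<partial>lborel) = 2 * (\<integral>\<^sup>+x. \<integral>\<^sup>+y. Z x y \<partial>lborel \<partial>lborel)"
      by (rule nn_integral_cmult) measurable
    also have "(\<integral>\<^sup>+x. \<integral>\<^sup>+y. Z x y \<partial>lborel \<partial>lborel) = (\<integral>\<^sup>+x. \<integral>\<^sup>+v. Z x (x + v) \<partial>lborel \<partial>lborel)"
    proof (rule nn_integral_cong)
      fix x show "(\<integral>\<^sup>+y. Z x y \<partial>lborel) = (\<integral>\<^sup>+v. Z x (x + v) \<partial>lborel)"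
        using nn_integral_lborel_translate[OF Zx, of x x] by (simp add: add.commute)
    qed
    also have "\<dots> = (\<integral>\<^sup>+v. \<integral>\<^sup>+x. Z x (x + v) \<partial>lborel \<partial>lborel)"
      by (rule nn_integral_lborel_swap) measurable
    also have "\<dots> \<le> (\<integral>\<^sup>+v. ennreal (D\<^sup>2) * energy \<Omega> \<phi> * indicator (cball (0::'a) D) v \<partial>lborel)"
    proof (rule nn_integral_mono)
      fix v :: 'a
      define A where "A = {x \<in> K. x + v \<in> B}"
      have ZA: "Z x (x + v) = ennreal ((\<phi> (x + v) - \<phi> x)\<^sup>2) * indicator A x" for x
        by (auto simp: Z_def A_def indicator_def)
      show "(\<integral>\<^sup>+x. Z x (x + v) \<partial>lborel) \<le> ennreal (D\<^sup>2) * energy \<Omega> \<phi> * indicator (cball 0 D) v"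
      proof (cases "A = {}")
        case False
        then obtain x where x: "x \<in> K" "x + v \<in> K" using B(2) by (auto simp: A_def)
        have "norm v \<le> D" using diameter_bounded_bound[OF K(2) x] by (simp add: D_def dist_norm)
        have "(\<integral>\<^sup>+x. Z x (x + v) \<partial>lborel) \<le> ennreal ((norm v)\<^sup>2) * energy \<Omega> \<phi>"
          unfolding ZA
        proof (rule translation_estimate[OF \<phi> \<Omega>])
          fix x and t :: real assume "x \<in> A" "0 \<le> t" "t \<le> 1"
          then have "x \<in> K" "x + v \<in> K" using B(2) by (auto simp: A_def)
          then have "(1 - t) *\<^sub>R x + t *\<^sub>R (x + v) \<in> K"
            using \<open>0 \<le> t\<close> \<open>t \<le> 1\<close> by (intro convexD[OF K(1)]) auto
          then show "x + t *\<^sub>R v \<in> \<Omega>" using K(4) by (auto simp: algebra_simps)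
        qed
        also have "\<dots> \<le> ennreal (D\<^sup>2) * energy \<Omega> \<phi>"
          using \<open>norm v \<le> D\<close> by (intro mult_right_mono ennreal_leI power_mono) auto
        finally show ?thesis using \<open>norm v \<le> D\<close> by simp
      qed (simp add: ZA)
    qed
    also have "\<dots> = ennreal (D\<^sup>2) * energy \<Omega> \<phi> * ennreal c"
      by (subst nn_integral_cmult_indicator) (auto simp: c)
    finally have "mass K \<phi> * ennreal b \<le> 2 * mass B \<phi> * ennreal k + 2 * (ennreal (D\<^sup>2) * energy \<Omega> \<phi> * ennreal c)"
      by (simp add: b add_left_mono mult_left_mono)
    then have "ennreal (1 / b) * (mass K \<phi> * ennreal b) \<le>
        ennreal (1 / b) * (2 * mass B \<phi> * ennreal k + 2 * (ennreal (D\<^sup>2) * energy \<Omega> \<phi> * ennreal c))"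
      by (rule mult_left_mono) simp
    moreover have "ennreal (1 / b) * (mass K \<phi> * ennreal b) = mass K \<phi>"
    proof -
      have "ennreal (1 / b) * ennreal b = 1" using bpos by (simp flip: ennreal_mult)
      then show ?thesis by (metis mult.commute mult.left_commute mult_1)
    qed
    moreover have "ennreal (1 / b) * (2 * mass B \<phi> * ennreal k + 2 * (ennreal (D\<^sup>2) * energy \<Omega> \<phi> * ennreal c))
        = ennreal (1 / b * (2 * k)) * mass B \<phi> + ennreal (1 / b * (2 * (D\<^sup>2 * c))) * energy \<Omega> \<phi>"
    proof -
      have "ennreal (1 / b * (2 * k)) = ennreal (1 / b) * (2 * ennreal k)"
        "ennreal (1 / b * (2 * (D\<^sup>2 * c))) = ennreal (1 / b) * (2 * (ennreal (D\<^sup>2) * ennreal c))"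
        using bpos k(2) c(2) by (simp_all only: ennreal_mult ennreal_numeral zero_le_power2
          divide_nonneg_pos zero_le_one mult_nonneg_nonneg zero_le_numeral)
      then show ?thesis by (simp add: distrib_left mult_ac)
    qed
    ultimately show "mass K \<phi> \<le> ennreal (1 / b * (2 * k)) * mass B \<phi> + ennreal (1 / b * (2 * (D\<^sup>2 * c))) * energy \<Omega> \<phi>"
      by simp
  qed (use bpos k c in auto)
qed

text \<open>A smaller ball around y fits into both given balls, and \<open>controlled_convex\<close>
  applies to it inside the first.\<close>

lemma controlled_ball_inner:
  assumes "open \<Omega>" "ball x e \<subseteq> \<Omega>" "y \<in> ball x e" "ball y d \<subseteq> \<Omega>" "0 < d"
  shows "controlled \<Omega> (ball x e) (ball y d)"
proof -
  obtain r where r: "0 < r" "ball y r \<subseteq> ball x e" using assms(3) by (meson open_ball open_contains_ball)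
  define s where "s = min r d"
  have s: "0 < s" "ball y s \<subseteq> ball x e" "ball y s \<subseteq> ball y d"
    using r assms(5) subset_ball[of s r y] subset_ball[of s d y] by (auto simp: s_def)
  have "controlled \<Omega> (ball x e) (ball y s)"
  proof (rule controlled_convex)
    show "0 < emeasure lborel (ball y s)" using s(1) by (simp add: emeasure_ball less_imp_le ennreal_less_zero_iff)
  qed (use assms s in auto)
  then show ?thesis using controlled_trans controlled_subset[OF s(3)] by blast
qed

text \<open>Having a controlled ball around it is a locally constant property of a point, since
  overlapping balls control each other. Connectedness then carries it from y to all of
  \<Omega>.\<close>

lemma controlled_ball_ball:
  assumes \<Omega>: "open \<Omega>" "connected \<Omega>" and x: "x \<in> \<Omega>" and y: "y \<in> \<Omega>" "0 < d" "ball y d \<subseteq> \<Omega>"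
  shows "\<exists>e>0. ball x e \<subseteq> \<Omega> \<and> controlled \<Omega> (ball x e) (ball y d)"
proof -
  define P where "P x \<longleftrightarrow> (\<exists>e>0. ball x e \<subseteq> \<Omega> \<and> controlled \<Omega> (ball x e) (ball y d))" for x
  have near: "\<exists>e>0. ball x e \<subseteq> \<Omega> \<and> (\<forall>z\<in>ball x e. P z \<longleftrightarrow> P x)" if x: "x \<in> \<Omega>" for x
  proof -
    obtain e where e: "0 < e" "ball x e \<subseteq> \<Omega>" using \<Omega>(1) x open_contains_ball by blast
    \<comment> \<open>With half of the radius, the ball of radius e/2 around z lies in
      \<open>ball x e\<close> and contains x, so control can be passed in both directions.\<close>
    have "P z \<longleftrightarrow> P x" if z: "z \<in> ball x (e/2)" for z
    proof
      assume "P z"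
      then obtain r where r: "0 < r" "ball z r \<subseteq> \<Omega>" "controlled \<Omega> (ball z r) (ball y d)" unfolding P_def by blast
      have "controlled \<Omega> (ball x e) (ball z r)"
        using z r e by (intro controlled_ball_inner[OF \<Omega>(1)]) auto
      then show "P x" unfolding P_def using e r(3) controlled_trans by blast
    next
      assume "P x"
      then obtain r where r: "0 < r" "ball x r \<subseteq> \<Omega>" "controlled \<Omega> (ball x r) (ball y d)" unfolding P_def by blast
      have zb: "ball z (e/2) \<subseteq> \<Omega>"
      proof
        fix w assume "w \<in> ball z (e/2)"
        then have "w \<in> ball x e" using z dist_triangle[of x w z] by simp
        then show "w \<in> \<Omega>" using e by blast
      qed
      have "controlled \<Omega> (ball z (e/2)) (ball x r)"
        using z r e zb by (intro controlled_ball_inner[OF \<Omega>(1)]) (auto simp: dist_commute)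
      then show "P z" unfolding P_def using e r(3) zb controlled_trans half_gt_zero by blast
    qed
    moreover have "ball x (e/2) \<subseteq> \<Omega>" using e subset_ball[of "e/2" e x] by auto
    ultimately show ?thesis using e(1) half_gt_zero by blast
  qed
  have op: "openin (top_of_set \<Omega>) {z \<in> \<Omega>. P z \<longleftrightarrow> b}" for b
  proof -
    have "open {z \<in> \<Omega>. P z \<longleftrightarrow> b}"
      unfolding open_contains_ball
    proof
      fix x assume "x \<in> {z \<in> \<Omega>. P z \<longleftrightarrow> b}"
      then show "\<exists>e>0. ball x e \<subseteq> {z \<in> \<Omega>. P z \<longleftrightarrow> b}" using near[of x] by blast
    qed
    then show ?thesis by (auto simp: openin_open intro!: exI[of _ "{z \<in> \<Omega>. P z \<longleftrightarrow> b}"])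
  qed
  have "{z \<in> \<Omega>. P z \<longleftrightarrow> False} = {}"
  proof (rule ccontr)
    assume ne: "{z \<in> \<Omega>. P z \<longleftrightarrow> False} \<noteq> {}"
    have "P y" unfolding P_def using y(2,3) controlled_subset by blast
    then have "{z \<in> \<Omega>. P z \<longleftrightarrow> True} \<noteq> {}" using y(1) by blast
    moreover have "\<Omega> \<subseteq> {z \<in> \<Omega>. P z \<longleftrightarrow> True} \<union> {z \<in> \<Omega>. P z \<longleftrightarrow> False}" by blast
    ultimately show False
      using \<Omega>(2) op[of True] op[of False] ne unfolding connected_openin by blast
  qed
  then show ?thesis using x unfolding P_def by blast
qed

text \<open>The compact set is separate from A in order to allow A = \<Omega> with K its closure, so
  that neighbourhoods of boundary points take part in the covering.\<close>

lemma controlled_local_compact: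
  fixes K :: "'a::euclidean_space set"
  assumes K: "compact K" and A: "A \<in> sets borel" "A \<subseteq> K"
    and loc: "\<And>x. x \<in> K \<Longrightarrow> \<exists>d>0. controlled \<Omega> (A \<inter> ball x d) B"
  shows "controlled \<Omega> A B"
proof -
  obtain d where d: "\<And>x. x \<in> K \<Longrightarrow> 0 < d x" "\<And>x. x \<in> K \<Longrightarrow> controlled \<Omega> (A \<inter> ball x (d x)) B"
    using loc by metis
  have "K \<subseteq> (\<Union>x\<in>K. ball x (d x))" using d(1) by (auto intro!: bexI)
  then obtain F where F: "F \<subseteq> K" "finite F" "K \<subseteq> (\<Union>x\<in>F. ball x (d x))"
    using compactE_image[OF K, of K "\<lambda>x. ball x (d x)"] by auto
  have "controlled \<Omega> (\<Union>x\<in>F. A \<inter> ball x (d x)) B" using F(2,1)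
  proof induction
    case empty
    then show ?case by (simp add: controlled_subset)
  next
    case (insert x F)
    have "controlled \<Omega> ((A \<inter> ball x (d x)) \<union> (\<Union>x\<in>F. A \<inter> ball x (d x))) B"
      using insert d(2) A(1) by (intro controlled_Un sets.finite_UN sets.Int) auto
    then show ?case by simp
  qed
  moreover have "A \<subseteq> (\<Union>x\<in>F. A \<inter> ball x (d x))" using F(3) A(2) by blast
  ultimately show ?thesis using controlled_trans controlled_subset by blast
qed

lemma controlled_compact:
  assumes \<Omega>: "open \<Omega>" "connected \<Omega>" and K: "compact K" "K \<subseteq> \<Omega>" and y: "y \<in> \<Omega>" "0 < d" "ball y d \<subseteq> \<Omega>"
  shows "controlled \<Omega> K (ball y d)"
proof (rule controlled_local_compact[OF K(1)])
  fix x assume "x \<in> K"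
  then obtain e where e: "0 < e" "controlled \<Omega> (ball x e) (ball y d)"
    using controlled_ball_ball[OF \<Omega> _ y] K(2) by blast
  have "controlled \<Omega> (K \<inter> ball x e) (ball y d)"
    by (rule controlled_trans[OF controlled_subset e(2)]) simp
  then show "\<exists>e>0. controlled \<Omega> (K \<inter> ball x e) (ball y d)" using e(1) by blast
qed (use K in \<open>auto intro: borel_compact\<close>)

text \<open>Near the boundary the cone condition allows pushing Omega into a compact subset of itself.\<close>

lemma controlled_domain:
  fixes \<Omega> :: "'a::euclidean_space set"
  assumes dom: "lipschitz_domain \<Omega>" and y: "y \<in> \<Omega>" "0 < d" "ball y d \<subseteq> \<Omega>"
  shows "controlled \<Omega> \<Omega> (ball y d)"
proof -
  have \<Omega>: "open \<Omega>" "connected \<Omega>" "bounded \<Omega>" using dom by (auto simp: lipschitz_domain_def)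
  have borel: "\<Omega> \<in> sets borel" using \<Omega>(1) by simp
  show ?thesis
  proof (rule controlled_local_compact[of "closure \<Omega>"])
    show "compact (closure \<Omega>)" using \<Omega>(3) by simp
    show "\<Omega> \<in> sets borel" "\<Omega> \<subseteq> closure \<Omega>" using borel closure_subset by auto
    fix x assume x: "x \<in> closure \<Omega>"
    show "\<exists>d'>0. controlled \<Omega> (\<Omega> \<inter> ball x d') (ball y d)"
    proof (cases "x \<in> \<Omega>")
      case True
      obtain e where e: "0 < e" "controlled \<Omega> (ball x e) (ball y d)"
        using controlled_ball_ball[OF \<Omega>(1,2) True y] by blast
      have "controlled \<Omega> (\<Omega> \<inter> ball x e) (ball y d)"
        by (rule controlled_trans[OF controlled_subset e(2)]) simp
      then show ?thesis using e(1) by blast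
    next
      case False
      then have fr: "x \<in> frontier \<Omega>" using x \<Omega>(1) by (simp add: frontier_def interior_open)
      obtain e r \<kappa> where c: "norm e = 1" "0 < r" "0 < \<kappa>" "cone_condition \<Omega> x r e \<kappa>"
        by (rule lipschitz_domain_local_graph[OF dom fr])
      \<comment> \<open>The radius r/4 of the piece and the shift by r/2 add up to less than r, so
        the whole path stays where the cone condition holds, and the shifted closed piece is a
        compact subset of \<Omega>.\<close>
      define v where "v = (r/2) *\<^sub>R e"
      define K0 where "K0 = closure \<Omega> \<inter> cball x (r/4)"
      define K where "K = (+) v ` K0"
      have in\<Omega>: "z + t *\<^sub>R v \<in> \<Omega>" if z: "z \<in> K0" and t: "0 < t" "t \<le> 1" for z t
      proof -
        have "dist x (z + t *\<^sub>R v) \<le> dist x z + dist z (z + t *\<^sub>R v)" by (rule dist_triangle)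
        moreover have "dist z (z + t *\<^sub>R v) = t * (r/2)" using c t by (simp add: v_def dist_norm)
        moreover have "t * (r/2) \<le> 1 * (r/2)" using t c by (intro mult_right_mono) auto
        moreover have "dist x z \<le> r/4" using z by (simp add: K0_def)
        ultimately have "dist x (z + t *\<^sub>R v) < r" using c(2) by linarith
        then show ?thesis
          using z t c by (intro cone_conditionD[OF c(4), where t = "t * (r/2)"]) (auto simp: K0_def v_def)
      qed
      have "compact K0" unfolding K0_def using \<Omega>(3) by (intro compact_Int) auto
      then have "compact K" unfolding K_def by (rule compact_translation)
      moreover have "K \<subseteq> \<Omega>" using in\<Omega>[of _ 1] by (auto simp: K_def add.commute)
      ultimately have K: "compact K" "K \<subseteq> \<Omega>" by auto
      have sub: "\<Omega> \<inter> ball x (r/4) \<subseteq> K0" using closure_subset by (auto simp: K0_def)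
      have "controlled \<Omega> (\<Omega> \<inter> ball x (r/4)) K"
      proof (rule controlled_translate[where v = v])
        show "K \<in> sets borel" using K(1) by (rule borel_compact)
        fix z assume z: "z \<in> \<Omega> \<inter> ball x (r/4)"
        then show "z + v \<in> K" using sub by (auto simp: K_def add.commute)
        fix t :: real assume "0 \<le> t" "t \<le> 1"
        then show "z + t *\<^sub>R v \<in> \<Omega>" using z sub in\<Omega>[of z t] by (cases "t = 0") auto
      qed (use borel in auto)
      then have "controlled \<Omega> (\<Omega> \<inter> ball x (r/4)) (ball y d)"
        using controlled_trans controlled_compact[OF \<Omega>(1,2) K y] by blast
      then show ?thesis using c(2) by (intro exI[of _ "r/4"]) simp
    qed
  qed
qed

text \<open>By Lindelof, a set of positive measure already has positive measure inside some ball
  contained in \<Omega>. That part controls the ball, which is convex, and the ball controls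
  \<Omega>.\<close>

lemma controlled_domain_positive_measure:
  fixes \<Omega> :: "'a::euclidean_space set"
  assumes dom: "lipschitz_domain \<Omega>" and A: "A \<in> sets borel" "A \<subseteq> \<Omega>" "0 < emeasure lborel A"
  shows "controlled \<Omega> \<Omega> A"
proof -
  have \<Omega>: "open \<Omega>" using dom by (simp add: lipschitz_domain_def)
  define F where "F = {ball x d | x d. 0 < d \<and> ball x d \<subseteq> \<Omega>}"
  obtain F' where F': "F' \<subseteq> F" "countable F'" "\<Union>F' = \<Union>F" by (rule Lindelof[of F]) (auto simp: F_def)
  have "\<Omega> \<subseteq> \<Union>F"
  proof
    fix x assume "x \<in> \<Omega>"
    then obtain d where "0 < d" "ball x d \<subseteq> \<Omega>" using \<Omega> open_contains_ball by blast
    then show "x \<in> \<Union>F" unfolding F_def using centre_in_ball by blast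
  qed
  have "\<exists>\<beta>\<in>F'. emeasure lborel (\<beta> \<inter> A) \<noteq> 0"
  proof (rule ccontr)
    assume "\<not> ?thesis"
    then have "\<beta> \<inter> A \<in> null_sets lborel" if "\<beta> \<in> F'" for \<beta>
      using that F'(1) A(1) by (auto simp: F_def null_sets_def)
    then have "(\<Union>\<beta>\<in>F'. \<beta> \<inter> A) \<in> null_sets lborel" by (intro null_sets_UN' F'(2))
    moreover have "(\<Union>\<beta>\<in>F'. \<beta> \<inter> A) = \<Union>F' \<inter> A" by auto
    moreover have "\<Union>F' \<inter> A = A" using order_trans[OF A(2) \<open>\<Omega> \<subseteq> \<Union>F\<close>] F'(3) by (simp add: Int_absorb1)
    ultimately show False using A(3) by auto
  qed
  then obtain x d where b: "0 < d" "ball x d \<subseteq> \<Omega>" "emeasure lborel (ball x d \<inter> A) \<noteq> 0"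
    using F'(1) by (auto simp: F_def)
  have "x \<in> \<Omega>" using b centre_in_ball by blast
  have 1: "controlled \<Omega> \<Omega> (ball x d)" by (rule controlled_domain[OF dom \<open>x \<in> \<Omega>\<close> b(1,2)])
  have 2: "controlled \<Omega> (ball x d) (ball x d \<inter> A)"
    using b \<Omega> A by (intro controlled_convex) (auto simp: zero_less_iff_neq_zero)
  show ?thesis using controlled_trans[OF controlled_trans[OF 1 2] controlled_subset] by simp
qed

text \<open>Each point of A descends along e inside \<Omega> to a zero of \<phi>. One factor h comes
  from Cauchy-Schwarz on this segment, the other from integrating the translated energy over segment
  parameters in {0..h}.\<close>

lemma mass_graph_layer:
  fixes e :: "'a::euclidean_space"
  assumes \<phi>: "\<phi> \<in> C1_functions" and \<Omega>: "\<Omega> \<in> sets borel" and h: "0 \<le> h"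
    and A: "\<And>y. y \<in> A \<Longrightarrow> \<exists>s. 0 \<le> s \<and> s \<le> h \<and> \<phi> (y - s *\<^sub>R e) = 0 \<and> (\<forall>t. 0 \<le> t \<longrightarrow> t < s \<longrightarrow> y - t *\<^sub>R e \<in> \<Omega>)"
    and e: "norm e = 1"
  shows "mass A \<phi> \<le> ennreal (h\<^sup>2) * energy \<Omega> \<phi>"
proof -
  have [measurable]: "grad \<phi> \<in> borel_measurable borel" "\<Omega> \<in> sets borel"
    using \<Omega> borel_measurable_C1_borel[OF \<phi>] by auto
  define H where "H x = ennreal ((norm (grad \<phi> x))\<^sup>2) * indicator \<Omega> x" for x
  have [measurable]: "H \<in> borel_measurable borel" unfolding H_def by measurable
  have "mass A \<phi> \<le> (\<integral>\<^sup>+y. ennreal h * (\<integral>\<^sup>+t. H (y + t *\<^sub>R (- e)) * indicator {0..h} t \<partial>lborel) \<partial>lborel)"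
    unfolding mass_def
  proof (rule nn_integral_mono)
    fix y
    show "ennreal ((\<phi> y)\<^sup>2) * indicator A y \<le> ennreal h * (\<integral>\<^sup>+t. H (y + t *\<^sub>R (- e)) * indicator {0..h} t \<partial>lborel)"
    proof (cases "y \<in> A")
      case True
      then obtain s where s: "0 \<le> s" "s \<le> h" "\<phi> (y - s *\<^sub>R e) = 0"
        "\<And>t. 0 \<le> t \<Longrightarrow> t < s \<Longrightarrow> y - t *\<^sub>R e \<in> \<Omega>" using A by blast
      have "ennreal ((\<phi> y)\<^sup>2) = ennreal ((\<phi> (y + s *\<^sub>R (- e)) - \<phi> y)\<^sup>2)" using s(3) by simp
      also have "\<dots> \<le> ennreal s *
          (\<integral>\<^sup>+t. ennreal ((norm (grad \<phi> (y + t *\<^sub>R (- e))))\<^sup>2) * indicator {0..s} t \<partial>lborel)"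
        using C1_line_estimate[OF \<phi> s(1), of y "- e"] e by simp
      also have "\<dots> \<le> ennreal h * (\<integral>\<^sup>+t. H (y + t *\<^sub>R (- e)) * indicator {0..h} t \<partial>lborel)"
      proof (intro mult_mono ennreal_leI s(2) nn_integral_mono_AE)
        \<comment> \<open>The end point of the segment is not assumed to lie in \<Omega>; a single
          parameter value does not affect the integral.\<close>
        have "AE t in lborel. t \<noteq> s" by (rule AE_lborel_singleton)
        then show "AE t in lborel. ennreal ((norm (grad \<phi> (y + t *\<^sub>R (- e))))\<^sup>2) * indicator {0..s} t
            \<le> H (y + t *\<^sub>R (- e)) * indicator {0..h} t"
        proof eventually_elim
          case (elim t)
          then show ?case using s(2) s(4)[of t] by (auto simp: H_def indicator_def)
        qed
      qed auto
      finally show ?thesis using True by simp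
    qed simp
  qed
  also have "\<dots> = ennreal h * (\<integral>\<^sup>+y. \<integral>\<^sup>+t. H (y + t *\<^sub>R (- e)) * indicator {0..h} t \<partial>lborel \<partial>lborel)"
    by (rule nn_integral_cmult) measurable
  also have "(\<integral>\<^sup>+y. \<integral>\<^sup>+t. H (y + t *\<^sub>R (- e)) * indicator {0..h} t \<partial>lborel \<partial>lborel)
      = (\<integral>\<^sup>+t. \<integral>\<^sup>+y. H (y + t *\<^sub>R (- e)) * indicator {0..h} t \<partial>lborel \<partial>lborel)"
    by (rule nn_integral_lborel_swap) measurable
  also have "\<dots> = (\<integral>\<^sup>+t. energy \<Omega> \<phi> * indicator {0..h} t \<partial>lborel)"
  proof (rule nn_integral_cong)
    fix t :: real
    have "(\<integral>\<^sup>+y. H (y + t *\<^sub>R (- e)) * indicator {0..h} t \<partial>lborel) = (\<integral>\<^sup>+y. H (y + t *\<^sub>R (- e)) \<partial>lborel) * indicator {0..h} t"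
      by (rule nn_integral_multc) measurable
    then show "(\<integral>\<^sup>+y. H (y + t *\<^sub>R (- e)) * indicator {0..h} t \<partial>lborel) = energy \<Omega> \<phi> * indicator {0..h} t"
      using nn_integral_lborel_translate[of H "t *\<^sub>R (- e)"] by (simp add: energy_def H_def)
  qed
  also have "\<dots> = energy \<Omega> \<phi> * ennreal h" using h by (subst nn_integral_cmult_indicator) auto
  finally show ?thesis using h by (simp add: power2_eq_square ennreal_mult mult_ac)
qed

text \<open>By compactness there is a boundary point around which E has positive surface measure in
  every ball. The layer of height h above this part of E has positive volume, by the thickening
  estimate. In the layer the function is bounded by its energy because it vanishes at the foot of
  each segment, and the layer controls \<Omega>.\<close>

theorem poincare_inequality:
  fixes \<Omega> :: "'a::euclidean_space set"
  assumes dom: "lipschitz_domain \<Omega>" and E: "E \<in> sets borel" "E \<subseteq> frontier \<Omega>" "0 < hausdorff_outer (DIM('a) - 1) E"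
  obtains C where "0 \<le> C"
    "\<And>\<phi>. \<phi> \<in> C1_functions \<Longrightarrow> (\<And>z. z \<in> E \<Longrightarrow> \<phi> z = 0) \<Longrightarrow> mass \<Omega> \<phi> \<le> ennreal C * energy \<Omega> \<phi>"
proof -
  have op: "open \<Omega>" and borel: "\<Omega> \<in> sets borel" using dom by (auto simp: lipschitz_domain_def)
  have "\<exists>x\<in>frontier \<Omega>. \<forall>d>0. hausdorff_outer (DIM('a) - 1) (E \<inter> ball x d) \<noteq> 0"
  proof (rule ccontr)
    assume neg: "\<not> ?thesis"
    have "hausdorff_outer (DIM('a) - 1) (E \<inter> frontier \<Omega>) = 0"
      using compact_frontier_lipschitz_domain[OF dom]
    proof (induction rule: compact_local_induct)
      case (Un A B)
      then show ?case using hausdorff_outer_Un[of "DIM('a) - 1" "E \<inter> A" "E \<inter> B"] by (simp add: Int_Un_distrib)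
    next
      case (subset A B)
      then show ?case using hausdorff_outer_mono[of "E \<inter> A" "E \<inter> B" "DIM('a) - 1"] by auto
    next
      case (local x)
      then obtain d where "0 < d" "hausdorff_outer (DIM('a) - 1) (E \<inter> ball x d) = 0" using neg by blast
      then show ?case
        using hausdorff_outer_mono[of "E \<inter> (frontier \<Omega> \<inter> ball x d)" "E \<inter> ball x d" "DIM('a) - 1"]
        by (intro exI[of _ d]) auto
    qed (simp add: hausdorff_outer_empty)
    then show False using E by (simp add: Int_absorb2)
  qed
  then obtain x where x: "x \<in> frontier \<Omega>" "\<And>d. 0 < d \<Longrightarrow> hausdorff_outer (DIM('a) - 1) (E \<inter> ball x d) \<noteq> 0"
    by blast
  obtain e r \<kappa> \<gamma> where c: "norm e = 1" "0 < r" "0 < \<kappa>" "\<kappa> \<le> 1" "continuous_on UNIV \<gamma>" "cone_condition \<Omega> x r e \<kappa>"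
    and graph: "\<And>z. z \<in> frontier \<Omega> \<Longrightarrow> z \<in> ball x r \<Longrightarrow> \<gamma> (z - (z \<bullet> e) *\<^sub>R e) = z \<bullet> e"
    using lipschitz_domain_local_graph[OF dom x(1)] by metis
  have ee: "e \<bullet> e = 1" using c(1) by (simp add: norm_eq_1)
  define h where "h = r/2"
  have h: "0 < h" using c by (simp add: h_def)
  define E' where "E' = E \<inter> ball x h"
  have E': "E' \<in> sets borel" "E' \<subseteq> frontier \<Omega> \<inter> ball x h" "hausdorff_outer (DIM('a) - 1) E' \<noteq> 0"
    using E x(2)[OF h] by (auto simp: E'_def)
  \<comment> \<open>\<open>s\<close> is the height above the local graph and \<tau> the foot point
    on it. Both are Borel because \<gamma> is continuous, so the layer A, described by preimages, is
    a Borel set.\<close>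
  define s where "s y = y \<bullet> e - \<gamma> (y - (y \<bullet> e) *\<^sub>R e)" for y
  define \<tau> where "\<tau> y = y - s y *\<^sub>R e" for y
  have conts: "continuous_on UNIV s" unfolding s_def
    by (intro continuous_intros continuous_on_compose2[OF c(5)]) auto
  then have [measurable]: "s \<in> borel_measurable borel" by (rule borel_measurable_continuous_onI)
  have [measurable]: "\<tau> \<in> borel_measurable borel" unfolding \<tau>_def by measurable
  have [measurable]: "E' \<in> sets borel" by (rule E')
  define A where "A = {y. \<tau> y \<in> E' \<and> 0 < s y \<and> s y < h}"
  have A: "A \<in> sets borel" unfolding A_def by measurable
  have line: "\<tau> y + t *\<^sub>R e \<in> \<Omega>" if y: "y \<in> A" and t: "0 < t" "t \<le> s y" for y t
  proof -
    have \<tau>: "\<tau> y \<in> frontier \<Omega>" "\<tau> y \<in> ball x h" and "s y < h" using y E' by (auto simp: A_def)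
    have "dist x (\<tau> y + t *\<^sub>R e) \<le> dist x (\<tau> y) + dist (\<tau> y) (\<tau> y + t *\<^sub>R e)" by (rule dist_triangle)
    moreover have "dist (\<tau> y) (\<tau> y + t *\<^sub>R e) = t" using t c by (simp add: dist_norm)
    ultimately have "dist x (\<tau> y + t *\<^sub>R e) < r" using \<tau>(2) t \<open>s y < h\<close> by (simp add: h_def)
    then show ?thesis
      using \<tau> t c by (intro cone_conditionD[OF c(6), where t = t]) (auto simp: frontier_def h_def)
  qed
  have A\<Omega>: "A \<subseteq> \<Omega>"
  proof
    fix y assume "y \<in> A"
    then show "y \<in> \<Omega>" using line[of y "s y"] by (simp add: A_def \<tau>_def)
  qed
  have bA: "bounded A" using A\<Omega> dom bounded_subset by (auto simp: lipschitz_domain_def)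
  have "0 < emeasure lborel A"
  proof (rule ccontr)
    assume "\<not> ?thesis"
    then have null: "emeasure lebesgue A = 0" using A by simp
    have "ennreal h * hausdorff_outer (DIM('a) - 1) E' \<le>
        ennreal (2 * unit_ball_vol (real (DIM('a) - 1)) / 2 ^ (DIM('a) - 1) / \<kappa> * real (DIM('a) ^ DIM('a)))
        * emeasure lebesgue A"
    proof (rule hausdorff_outer_le_thickening[OF c(3) h])
      show "transversal e \<kappa> E'"
        by (rule transversal_subset[OF cone_condition_transversal[OF c(6) op]]) (use E'(2) h in \<open>auto simp: h_def\<close>)
      show "A \<in> sets lebesgue" using A by simp
      show "bounded A" by (rule bA)
      fix z t assume z: "z \<in> E'" and t: "0 < t" "t < h"
      have "\<gamma> (z - (z \<bullet> e) *\<^sub>R e) = z \<bullet> e" using z E'(2) h by (intro graph) (auto simp: h_def)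
      moreover have te: "(z + t *\<^sub>R e) \<bullet> e = z \<bullet> e + t" using ee by (simp add: inner_add_left)
      moreover have "z + t *\<^sub>R e - (z \<bullet> e + t) *\<^sub>R e = z - (z \<bullet> e) *\<^sub>R e"
        by (simp add: algebra_simps)
      ultimately have "s (z + t *\<^sub>R e) = t" by (simp only: s_def)
      then show "z + t *\<^sub>R e \<in> A" using z t by (simp add: A_def \<tau>_def)
    qed
    then have "ennreal h * hausdorff_outer (DIM('a) - 1) E' = 0" using null by simp
    then show False using E'(3) h by simp
  qed
  then have "controlled \<Omega> \<Omega> A" by (rule controlled_domain_positive_measure[OF dom A A\<Omega>])
  then obtain C where C: "0 \<le> C" "\<And>\<phi>. \<phi> \<in> C1_functions \<Longrightarrow> mass \<Omega> \<phi> \<le> ennreal C * (mass A \<phi> + energy \<Omega> \<phi>)"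
    unfolding controlled_def by blast
  show ?thesis
  proof (rule that[of "C * (h\<^sup>2 + 1)"])
    fix \<phi> :: "'a \<Rightarrow> real" assume \<phi>: "\<phi> \<in> C1_functions" "\<And>z. z \<in> E \<Longrightarrow> \<phi> z = 0"
    have "mass A \<phi> \<le> ennreal (h\<^sup>2) * energy \<Omega> \<phi>"
    proof (rule mass_graph_layer[OF \<phi>(1) borel less_imp_le[OF h] _ c(1)])
      fix y assume y: "y \<in> A"
      have "\<phi> (y - s y *\<^sub>R e) = 0" using y \<phi>(2) by (auto simp: A_def \<tau>_def E'_def)
      moreover have "y - t *\<^sub>R e \<in> \<Omega>" if "0 \<le> t" "t < s y" for t
        using line[OF y, of "s y - t"] that by (simp add: \<tau>_def algebra_simps)
      ultimately show "\<exists>s. 0 \<le> s \<and> s \<le> h \<and> \<phi> (y - s *\<^sub>R e) = 0 \<and> (\<forall>t. 0 \<le> t \<longrightarrow> t < s \<longrightarrow> y - t *\<^sub>R e \<in> \<Omega>)"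
        using y by (intro exI[of _ "s y"]) (auto simp: A_def)
    qed
    then have "mass \<Omega> \<phi> \<le> ennreal C * (ennreal (h\<^sup>2) * energy \<Omega> \<phi> + energy \<Omega> \<phi>)"
      using C(2)[OF \<phi>(1)] by (meson add_right_mono mult_left_mono order_trans zero_le)
    then show "mass \<Omega> \<phi> \<le> ennreal (C * (h\<^sup>2 + 1)) * energy \<Omega> \<phi>"
      using C(1) by (simp add: ennreal_mult distrib_left distrib_right mult.assoc)
  qed (use C(1) in simp)
qed

section \<open>A bounded right inverse of the divergence\<close>

lemma nn_integral_lebesgue_on:
  assumes "f \<in> borel_measurable borel" "\<Omega> \<in> sets borel"
  shows "(\<integral>\<^sup>+x. f x \<partial>lebesgue_on \<Omega>) = (\<integral>\<^sup>+x. f x * indicator \<Omega> x \<partial>lborel)"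
proof -
  have "(\<integral>\<^sup>+x. f x \<partial>lebesgue_on \<Omega>) = (\<integral>\<^sup>+x. f x * indicator \<Omega> x \<partial>lebesgue)"
    using assms by (intro nn_integral_restrict_space) auto
  also have "\<dots> = (\<integral>\<^sup>+x. f x * indicator \<Omega> x \<partial>lborel)"
    using assms by (intro nn_integral_completion)
  finally show ?thesis .
qed

theorem poincare_inequality_L2:
  fixes \<Omega> :: "'a::euclidean_space set"
  assumes dom: "lipschitz_domain \<Omega>" and E: "E \<in> sets borel" "E \<subseteq> frontier \<Omega>" "0 < hausdorff_outer (DIM('a) - 1) E"
  obtains C where "0 \<le> C"
    "\<And>\<phi>. \<phi> \<in> C1_functions \<Longrightarrow> (\<And>z. z \<in> E \<Longrightarrow> \<phi> z = 0) \<Longrightarrow>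
      L2_norm (lebesgue_on \<Omega>) \<phi> \<le> C * L2_norm (lebesgue_on \<Omega>) (grad \<phi>)"
proof -
  have \<Omega>: "open \<Omega>" "bounded \<Omega>" using dom by (auto simp: lipschitz_domain_def)
  obtain C where C: "0 \<le> C" "\<And>\<phi>. \<phi> \<in> C1_functions \<Longrightarrow> (\<And>z. z \<in> E \<Longrightarrow> \<phi> z = 0) \<Longrightarrow>
      mass \<Omega> \<phi> \<le> ennreal C * energy \<Omega> \<phi>"
    using poincare_inequality[OF dom E] by metis
  show ?thesis
  proof (rule that[of "sqrt C"])
    fix \<phi> :: "'a \<Rightarrow> real" assume \<phi>: "\<phi> \<in> C1_functions" "\<And>z. z \<in> E \<Longrightarrow> \<phi> z = 0"
    let ?M = "lebesgue_on \<Omega>"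
    have [measurable]: "\<phi> \<in> borel_measurable borel" "grad \<phi> \<in> borel_measurable borel"
      using borel_measurable_C1_borel[OF \<phi>(1)] by auto
    have "mass \<Omega> \<phi> = ennreal ((L2_norm ?M \<phi>)\<^sup>2)" "energy \<Omega> \<phi> = ennreal ((L2_norm ?M (grad \<phi>))\<^sup>2)"
      unfolding mass_def energy_def
      using nn_integral_L2[OF C1_in_L2[OF \<phi>(1) \<Omega>(2,1)]] nn_integral_L2[OF grad_in_L2[OF \<phi>(1) \<Omega>(2,1)]]
        nn_integral_lebesgue_on[of "\<lambda>x. ennreal ((norm (\<phi> x))\<^sup>2)" \<Omega>]
        nn_integral_lebesgue_on[of "\<lambda>x. ennreal ((norm (grad \<phi> x))\<^sup>2)" \<Omega>] \<Omega>(1) by simp_all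
    then have "ennreal ((L2_norm ?M \<phi>)\<^sup>2) \<le> ennreal (C * (L2_norm ?M (grad \<phi>))\<^sup>2)"
      using C(2)[OF \<phi>] C(1) by (simp add: ennreal_mult)
    then have "(L2_norm ?M \<phi>)\<^sup>2 \<le> C * (L2_norm ?M (grad \<phi>))\<^sup>2"
      using C(1) by (subst (asm) ennreal_le_iff) auto
    then have "(L2_norm ?M \<phi>)\<^sup>2 \<le> (sqrt C * L2_norm ?M (grad \<phi>))\<^sup>2"
      using C(1) by (simp add: power_mult_distrib)
    then show "L2_norm ?M \<phi> \<le> sqrt C * L2_norm ?M (grad \<phi>)"
      by (rule power2_le_imp_le) (use C(1) in simp)
  qed (use C(1) in simp)
qed

text \<open>The field is the limit of the gradients of a minimising sequence of the Dirichlet functional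
  J; the parallelogram identity makes these gradients a Cauchy sequence.\<close>

theorem weak_laplace_flux:
  fixes \<Omega> :: "'a::euclidean_space set"
  assumes \<Omega>: "open \<Omega>" "bounded \<Omega>" and f: "f \<in> L2_space (lebesgue_on \<Omega>)" and C: "0 \<le> C"
    and poincare: "\<And>\<phi>. \<phi> \<in> C1_functions \<Longrightarrow> (\<And>z. z \<in> E \<Longrightarrow> \<phi> z = 0) \<Longrightarrow>
      L2_norm (lebesgue_on \<Omega>) \<phi> \<le> C * L2_norm (lebesgue_on \<Omega>) (grad \<phi>)"
  obtains v where "v \<in> L2_space (lebesgue_on \<Omega>)"
    "\<And>\<phi>. \<phi> \<in> C1_functions \<Longrightarrow> (\<And>z. z \<in> E \<Longrightarrow> \<phi> z = 0) \<Longrightarrow>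
      L2_inner (lebesgue_on \<Omega>) v (grad \<phi>) + L2_inner (lebesgue_on \<Omega>) f \<phi> = 0"
    "L2_norm (lebesgue_on \<Omega>) v \<le> C * L2_norm (lebesgue_on \<Omega>) f"
proof -
  let ?M = "lebesgue_on \<Omega>"
  \<comment> \<open>Only the gradients of a minimising sequence are shown to converge; no minimiser
    in W is required.\<close>
  define W where "W = {\<phi> \<in> C1_functions. \<forall>z\<in>E. \<phi> z = 0}"
  define N where "N v = L2_norm ?M v" for v :: "'a \<Rightarrow> 'a"
  define J where "J \<phi> = (N (grad \<phi>))\<^sup>2 / 2 + L2_inner ?M f \<phi>" for \<phi>
  have W: "\<phi> \<in> C1_functions" if "\<phi> \<in> W" for \<phi> using that by (simp add: W_def)
  have W0: "(\<lambda>x. 0) \<in> W" by (simp add: W_def C1_const)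
  have Wcomb: "(\<lambda>x. a * \<phi> x + b * \<psi> x) \<in> W" if "\<phi> \<in> W" "\<psi> \<in> W" for a b \<phi> \<psi>
    using that by (auto simp: W_def intro!: C1_add C1_scale)
  have L2: "\<phi> \<in> L2_space ?M" "grad \<phi> \<in> L2_space ?M" if "\<phi> \<in> W" for \<phi>
    using C1_in_L2 grad_in_L2 \<Omega> W[OF that] by blast+
  have P: "L2_norm ?M \<phi> \<le> C * N (grad \<phi>)" if "\<phi> \<in> W" for \<phi>
    using that poincare by (auto simp: W_def N_def)
  have J_comb: "J (\<lambda>x. a * \<phi> x + b * \<psi> x) = (a\<^sup>2 * (N (grad \<phi>))\<^sup>2 + 2 * (a * b * L2_inner ?M (grad \<phi>) (grad \<psi>))
      + b\<^sup>2 * (N (grad \<psi>))\<^sup>2) / 2 + (a * L2_inner ?M f \<phi> + b * L2_inner ?M f \<psi>)"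
    if "\<phi> \<in> W" "\<psi> \<in> W" for a b \<phi> \<psi>
  proof -
    have g: "grad (\<lambda>x. a * \<phi> x + b * \<psi> x) = (\<lambda>x. a *\<^sub>R grad \<phi> x + b *\<^sub>R grad \<psi> x)"
      using that W by (simp add: grad_add grad_scale C1_scale)
    have "(N (grad (\<lambda>x. a * \<phi> x + b * \<psi> x)))\<^sup>2 = a\<^sup>2 * (N (grad \<phi>))\<^sup>2
        + 2 * (a * b * L2_inner ?M (grad \<phi>) (grad \<psi>)) + b\<^sup>2 * (N (grad \<psi>))\<^sup>2"
      unfolding g N_def
      by (subst L2_norm_power2_add[OF L2_space_scaleR[OF L2(2)[OF that(1)]] L2_space_scaleR[OF L2(2)[OF that(2)]]])
        (simp add: L2_norm_scaleR L2_inner_scaleR_left L2_inner_scaleR_right power_mult_distrib mult_ac)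
    moreover have "L2_inner ?M f (\<lambda>x. a * \<phi> x + b * \<psi> x) = a * L2_inner ?M f \<phi> + b * L2_inner ?M f \<psi>"
      by (subst L2_inner_add_right[OF L2_space_mult[OF L2(1)[OF that(1)]] L2_space_mult[OF L2(1)[OF that(2)]] f])
        (simp add: L2_inner_mult_right)
    ultimately show ?thesis by (simp add: J_def)
  qed
  have Nn: "0 \<le> N v" for v by (simp add: N_def)
  \<comment> \<open>The Poincare inequality bounds the linear term by C |f| times the gradient norm,
    and completing the square does the rest.\<close>
  have J_lower: "- (C * L2_norm ?M f)\<^sup>2 / 2 \<le> J \<phi>" if "\<phi> \<in> W" for \<phi>
  proof -
    have "\<bar>L2_inner ?M f \<phi>\<bar> \<le> L2_norm ?M f * (C * N (grad \<phi>))"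
      using L2_Cauchy_Schwarz[OF f L2(1)[OF that]] mult_left_mono[OF P[OF that], of "L2_norm ?M f"] by simp
    moreover have "0 \<le> (N (grad \<phi>) - C * L2_norm ?M f)\<^sup>2" by simp
    ultimately show ?thesis by (simp add: J_def power2_diff mult_ac)
  qed
  define m where "m = Inf (J ` W)"
  have bdd: "bdd_below (J ` W)" using J_lower by (intro bdd_belowI2) auto
  have m_le: "m \<le> J \<phi>" if "\<phi> \<in> W" for \<phi> unfolding m_def using bdd that by (intro cInf_lower) auto
  define \<delta> where "\<delta> n = inverse (real (Suc n))" for n
  have \<delta>: "\<delta> \<longlonglongrightarrow> 0" unfolding \<delta>_def by (rule LIMSEQ_inverse_real_of_nat)
  have "\<exists>\<phi>\<in>W. J \<phi> < m + \<delta> n" for n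
    using W0 cInf_lessD[of "J ` W" "m + \<delta> n"] by (auto simp: m_def \<delta>_def)
  then obtain \<phi> where \<phi>: "\<And>n. \<phi> n \<in> W" "\<And>n. J (\<phi> n) < m + \<delta> n" by metis
  define G where "G i j = L2_norm ?M (\<lambda>x. grad (\<phi> i) x - grad (\<phi> j) x)" for i j
  have cauchy: "(G i j)\<^sup>2 \<le> 4 * \<delta> i + 4 * \<delta> j" for i j
  proof -
    have "(G i j)\<^sup>2
        = (N (grad (\<phi> i)))\<^sup>2 - 2 * L2_inner ?M (grad (\<phi> i)) (grad (\<phi> j)) + (N (grad (\<phi> j)))\<^sup>2"
      unfolding N_def G_def using L2_norm_power2_add[OF L2(2)[OF \<phi>(1)[of i]] L2_space_scaleR[OF L2(2)[OF \<phi>(1)[of j]], of "-1"]]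
      by (simp add: L2_norm_scaleR[of ?M "-1", simplified] L2_inner_scaleR_right[of ?M _ "-1", simplified])
    \<comment> \<open>The midpoint cannot go below the infimum. The mean of the two values of J
      exceeds its value at the midpoint by exactly |grad (\<phi> i) - grad (\<phi> j)|^2 / 8, which
      explains the factor 4 in the estimate.\<close>
    moreover have "m \<le> J (\<lambda>x. 1/2 * \<phi> i x + 1/2 * \<phi> j x)" by (intro m_le Wcomb \<phi>)
    then have "m \<le> (N (grad (\<phi> i)))\<^sup>2 / 8 + L2_inner ?M (grad (\<phi> i)) (grad (\<phi> j)) / 4 + (N (grad (\<phi> j)))\<^sup>2 / 8
        + L2_inner ?M f (\<phi> i) / 2 + L2_inner ?M f (\<phi> j) / 2"
      unfolding J_comb[OF \<phi>(1) \<phi>(1)] by (simp add: power_divide add_divide_distrib)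
    ultimately show ?thesis
      using \<phi>(2)[of i] \<phi>(2)[of j] unfolding J_def by linarith
  qed
  obtain v where v: "v \<in> L2_space ?M" "(\<lambda>n. L2_norm ?M (\<lambda>x. grad (\<phi> n) x - v x)) \<longlonglongrightarrow> 0"
  proof (rule L2_complete)
    show "grad (\<phi> n) \<in> L2_space ?M" for n by (rule L2(2)[OF \<phi>(1)])
    fix e :: real assume "0 < e"
    then have "0 < e\<^sup>2 / 8" by simp
    then obtain K where K: "\<delta> K < e\<^sup>2 / 8" unfolding \<delta>_def using reals_Archimedean by blast
    have "G i j < e" if ij: "K \<le> i" "K \<le> j" for i j
    proof -
      have "\<delta> n \<le> \<delta> K" if "K \<le> n" for n using that by (simp add: \<delta>_def)
      from this[OF ij(1)] this[OF ij(2)]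
      have "(G i j)\<^sup>2 < e\<^sup>2"
        using cauchy[of i j] K by linarith
      then show ?thesis by (rule power2_less_imp_less) (use \<open>0 < e\<close> in simp)
    qed
    then show "\<exists>N. \<forall>m\<ge>N. \<forall>n\<ge>N. L2_norm ?M (\<lambda>x. grad (\<phi> m) x - grad (\<phi> n) x) < e" unfolding G_def by blast
  qed (rule that)
  have euler: "L2_inner ?M v (grad \<psi>) + L2_inner ?M f \<psi> = 0" if \<psi>: "\<psi> \<in> W" for \<psi>
  proof -
    define b where "b = L2_inner ?M v (grad \<psi>) + L2_inner ?M f \<psi>"
    define a where "a = (N (grad \<psi>))\<^sup>2 / 2"
    have lim: "(\<lambda>n. L2_inner ?M (grad (\<phi> n)) (grad \<psi>)) \<longlonglongrightarrow> L2_inner ?M v (grad \<psi>)"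
    proof (rule LIM_zero_cancel, rule tendsto_0_le[OF v(2), where K = "N (grad \<psi>)"], intro always_eventually allI)
      fix n
      have "L2_inner ?M (grad (\<phi> n)) (grad \<psi>) - L2_inner ?M v (grad \<psi>) = L2_inner ?M (\<lambda>x. grad (\<phi> n) x - v x) (grad \<psi>)"
        by (rule L2_inner_diff_left[symmetric]) (intro L2(2) \<phi> \<psi> v)+
      then show "norm (L2_inner ?M (grad (\<phi> n)) (grad \<psi>) - L2_inner ?M v (grad \<psi>))
          \<le> norm (L2_norm ?M (\<lambda>x. grad (\<phi> n) x - v x)) * N (grad \<psi>)"
        using L2_Cauchy_Schwarz[OF L2_space_diff[OF L2(2)[OF \<phi>(1)[of n]] v(1)] L2(2)[OF \<psi>]] by (simp add: N_def)
    qed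
    \<comment> \<open>\<open>J (\<phi> n)\<close> is within \<open>\<delta> n\<close> of the
      infimum, so a step by t \<psi> lowers J by at most \<open>\<delta> n\<close>; in the limit the
      quadratic polynomial in t is nonnegative.\<close>
    have t: "0 \<le> t * b + t\<^sup>2 * a" for t
    proof -
      have "- \<delta> n \<le> t * (L2_inner ?M (grad (\<phi> n)) (grad \<psi>) + L2_inner ?M f \<psi>) + t\<^sup>2 * a" for n
      proof -
        have "m \<le> J (\<lambda>x. 1 * \<phi> n x + t * \<psi> x)" by (intro m_le Wcomb \<phi> \<psi>)
        then have "m \<le> J (\<phi> n) + (t * (L2_inner ?M (grad (\<phi> n)) (grad \<psi>) + L2_inner ?M f \<psi>) + t\<^sup>2 * a)"
          unfolding J_comb[OF \<phi>(1) \<psi>] J_def a_def by (simp add: algebra_simps add_divide_distrib)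
        then show ?thesis using \<phi>(2)[of n] by linarith
      qed
      moreover have "(\<lambda>n. - \<delta> n) \<longlonglongrightarrow> - 0" by (intro tendsto_minus \<delta>)
      moreover have "(\<lambda>n. t * (L2_inner ?M (grad (\<phi> n)) (grad \<psi>) + L2_inner ?M f \<psi>) + t\<^sup>2 * a) \<longlonglongrightarrow> t * b + t\<^sup>2 * a"
        unfolding b_def by (intro tendsto_intros lim)
      ultimately have "- 0 \<le> t * b + t\<^sup>2 * a" by (intro LIMSEQ_le[where X = "\<lambda>n. - \<delta> n"]) auto
      then show ?thesis by simp
    qed
    have a0: "0 \<le> a" by (simp add: a_def)
    \<comment> \<open>Instead of the minimiser -b / (2 a), this choice needs no separate case for a
      = 0.\<close>
    define s where "s = - b / (a + 1)"
    have sa: "s * (a + 1) = - b" using a0 by (simp add: s_def)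
    have "0 \<le> (a + 1)\<^sup>2 * (s * b + s\<^sup>2 * a)" using t[of s] by simp
    also have "\<dots> = (a + 1) * b * (s * (a + 1)) + a * (s * (a + 1))\<^sup>2"
      by (simp add: power2_eq_square algebra_simps)
    also have "\<dots> = - b\<^sup>2" unfolding sa by (simp add: power2_eq_square algebra_simps)
    finally have "b = 0" by simp
    then show ?thesis by (simp add: b_def)
  qed
  \<comment> \<open>v is merely a limit of gradients, so the Euler equation is tested with
    \<open>\<phi> n\<close> and the error is sent to zero.\<close>
  have "N v \<le> C * L2_norm ?M f"
  proof (cases "N v = 0")
    case False
    then have pos: "0 < N v" using Nn[of v] by simp
    define d where "d n = L2_norm ?M (\<lambda>x. grad (\<phi> n) x - v x)" for n
    have "(N v)\<^sup>2 \<le> N v * d n + L2_norm ?M f * (C * (N v + d n))" for n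
    proof -
      have gn: "grad (\<phi> n) \<in> L2_space ?M" by (rule L2(2)[OF \<phi>(1)])
      have dn: "(\<lambda>x. grad (\<phi> n) x - v x) \<in> L2_space ?M" by (intro L2_space_diff gn v)
      have "(N v)\<^sup>2 = L2_inner ?M v (grad (\<phi> n)) - L2_inner ?M v (\<lambda>x. grad (\<phi> n) x - v x)"
        by (simp add: N_def L2_norm_power2 L2_inner_diff_right[OF gn v(1) v(1)])
      also have "L2_inner ?M v (grad (\<phi> n)) = - L2_inner ?M f (\<phi> n)" using euler[OF \<phi>(1)[of n]] by simp
      finally have "(N v)\<^sup>2 \<le> \<bar>L2_inner ?M f (\<phi> n)\<bar> + \<bar>L2_inner ?M v (\<lambda>x. grad (\<phi> n) x - v x)\<bar>" by linarith
      moreover have "\<bar>L2_inner ?M v (\<lambda>x. grad (\<phi> n) x - v x)\<bar> \<le> N v * d n"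
        unfolding N_def d_def by (rule L2_Cauchy_Schwarz[OF v(1) dn])
      moreover have "\<bar>L2_inner ?M f (\<phi> n)\<bar> \<le> L2_norm ?M f * (C * N (grad (\<phi> n)))"
        using L2_Cauchy_Schwarz[OF f L2(1)[OF \<phi>(1)[of n]]] mult_left_mono[OF P[OF \<phi>(1)[of n]], of "L2_norm ?M f"] by simp
      moreover have "N (grad (\<phi> n)) \<le> N v + d n"
        using L2_norm_triangle[OF v(1) dn] by (simp add: N_def d_def)
      then have "L2_norm ?M f * (C * N (grad (\<phi> n))) \<le> L2_norm ?M f * (C * (N v + d n))"
        using C by (intro mult_left_mono) auto
      ultimately show ?thesis by linarith
    qed
    moreover have "(\<lambda>n. N v * d n + L2_norm ?M f * (C * (N v + d n))) \<longlonglongrightarrow> N v * 0 + L2_norm ?M f * (C * (N v + 0))"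
      unfolding d_def by (intro tendsto_intros v(2))
    ultimately have "(N v)\<^sup>2 \<le> N v * 0 + L2_norm ?M f * (C * (N v + 0))"
      by (intro LIMSEQ_le_const[where X = "\<lambda>n. N v * d n + L2_norm ?M f * (C * (N v + d n))"]) auto
    then have "N v * N v \<le> N v * (C * L2_norm ?M f)" by (simp add: power2_eq_square mult_ac)
    then show ?thesis using pos by simp
  qed (use C in simp)
  then show ?thesis using that[of v] v(1) euler by (auto simp: W_def N_def)
qed

text \<open>The Euler equation holds for all C1 functions vanishing on E, not just for compactly
  supported ones. It therefore contains, besides the divergence, the natural boundary condition of
  zero flux through every part of the boundary disjoint from E, in particular through \<Gamma> and
  \<Gamma>N.\<close>

theorem (in trace_domain) flux_with_divergence:
  assumes dom: "lipschitz_domain \<Omega>"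
    and E: "E \<in> sets borel" "E \<subseteq> frontier \<Omega> - (\<Gamma> \<union> \<Gamma>N)" "0 < hausdorff_outer (DIM('a) - 1) E"
  obtains C where "0 \<le> C" "\<And>f :: 'a \<Rightarrow> real. f \<in> L2_space (lebesgue_on \<Omega>) \<Longrightarrow>
    \<exists>v\<in>flux_space \<Omega> \<Gamma> \<Gamma>N. (AE x in lebesgue_on \<Omega>. weak_div \<Omega> v x = f x) \<and>
      (AE x in surface_measure \<Gamma>. normal_trace \<Omega> \<Gamma> v x = 0) \<and>
      L2_norm (lebesgue_on \<Omega>) v \<le> C * L2_norm (lebesgue_on \<Omega>) f"
proof -
  have E': "E \<subseteq> frontier \<Omega>" using E(2) by blast
  obtain C where C: "0 \<le> C" "\<And>\<phi>. \<phi> \<in> C1_functions \<Longrightarrow> (\<And>z. z \<in> E \<Longrightarrow> \<phi> z = 0) \<Longrightarrow>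
      L2_norm (lebesgue_on \<Omega>) \<phi> \<le> C * L2_norm (lebesgue_on \<Omega>) (grad \<phi>)"
    using poincare_inequality_L2[OF dom E(1) E' E(3)] by metis
  show ?thesis
  proof (rule that[OF C(1)])
    fix f :: "'a \<Rightarrow> real" assume f: "f \<in> L2_space (lebesgue_on \<Omega>)"
    obtain v where v: "v \<in> L2_space (lebesgue_on \<Omega>)"
      "\<And>\<phi>. \<phi> \<in> C1_functions \<Longrightarrow> (\<And>z. z \<in> E \<Longrightarrow> \<phi> z = 0) \<Longrightarrow>
        L2_inner (lebesgue_on \<Omega>) v (grad \<phi>) + L2_inner (lebesgue_on \<Omega>) f \<phi> = 0"
      "L2_norm (lebesgue_on \<Omega>) v \<le> C * L2_norm (lebesgue_on \<Omega>) f"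
      using weak_laplace_flux[OF \<Omega> f C] by metis
    have not\<Omega>: "z \<notin> \<Omega>" if "z \<in> E" for z using that E' frontier_not_in_open[OF \<Omega>(1)] by blast
    have "has_weak_divergence \<Omega> v f"
      unfolding has_weak_divergence_def
    proof
      fix \<phi> :: "'a \<Rightarrow> real" assume \<phi>: "\<phi> \<in> test_functions \<Omega>"
      have "L2_inner (lebesgue_on \<Omega>) v (grad \<phi>) + L2_inner (lebesgue_on \<Omega>) f \<phi> = 0"
        using test_functions_zero[OF \<phi>] not\<Omega> by (intro v(2) test_functions_C1[OF \<phi>]) blast
      then show "L2_inner (lebesgue_on \<Omega>) v (grad \<phi>) = - L2_inner (lebesgue_on \<Omega>) f \<phi>" by simp
    qed
    note Hdiv = H_divI[OF \<Omega> v(1) f this] and div = weak_div_eq[OF \<Omega> v(1) f this]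
    \<comment> \<open>For E disjoint from \<Sigma>, a function vanishing on the frontier off
      \<Sigma> vanishes on E and is admissible in the Euler equation.\<close>
    have tr: "has_normal_trace \<Omega> \<Sigma> v (\<lambda>x. 0)" if \<Sigma>: "E \<inter> \<Sigma> = {}" for \<Sigma>
      unfolding has_normal_trace_def
    proof (intro conjI ballI impI)
      fix \<phi> assume \<phi>: "\<phi> \<in> C1_functions" "\<forall>x\<in>frontier \<Omega> - \<Sigma>. \<phi> x = 0"
      have "L2_inner (lebesgue_on \<Omega>) (weak_div \<Omega> v) \<phi> = L2_inner (lebesgue_on \<Omega>) f \<phi>"
        by (rule L2_inner_cong_AE_left[OF div H_divD(2)[OF Hdiv] f C1_in_L2[OF \<phi>(1) \<Omega>(2,1)]])
      moreover have "L2_inner (lebesgue_on \<Omega>) v (grad \<phi>) + L2_inner (lebesgue_on \<Omega>) f \<phi> = 0"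
        using \<phi>(2) E' \<Sigma> by (intro v(2) \<phi>(1)) blast
      ultimately show "L2_inner (lebesgue_on \<Omega>) v (grad \<phi>) + L2_inner (lebesgue_on \<Omega>) (weak_div \<Omega> v) \<phi>
          = L2_inner (surface_measure \<Sigma>) (\<lambda>x. 0) \<phi>" by simp
    qed simp
    have tr\<Gamma>: "has_normal_trace \<Omega> \<Gamma> v (\<lambda>x. 0)" and trN: "has_normal_trace \<Omega> (\<Gamma>N \<inter> frontier \<Omega>) v (\<lambda>x. 0)"
      using E(2) by (intro tr; blast)+
    have "v \<in> flux_space \<Omega> \<Gamma> \<Gamma>N"
      unfolding flux_space_def using Hdiv tr\<Gamma> trN by (intro CollectI conjI exI)
    then show "\<exists>v\<in>flux_space \<Omega> \<Gamma> \<Gamma>N. (AE x in lebesgue_on \<Omega>. weak_div \<Omega> v x = f x) \<and>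
        (AE x in surface_measure \<Gamma>. normal_trace \<Omega> \<Gamma> v x = 0) \<and>
        L2_norm (lebesgue_on \<Omega>) v \<le> C * L2_norm (lebesgue_on \<Omega>) f"
      using div normal_trace_eq[OF tr\<Gamma>] v(3) by (intro bexI[of _ v] conjI)
  qed
qed

section \<open>Error estimate for one iteration\<close>

text \<open>The exchange condition is given only weakly. Testing with a and with b yields <a, a> =
  <b, a> = <b, b>.\<close>

lemma L2_inner_eq_imp_norm_eq:
  assumes "a \<in> L2_space M" "b \<in> L2_space M" "\<And>w. w \<in> L2_space M \<Longrightarrow> L2_inner M a w = L2_inner M b w"
  shows "L2_norm M a = L2_norm M b"
  using assms(3)[OF assms(1)] assms(3)[OF assms(2)] L2_inner_commute[of M b a] by (simp add: L2_norm_def)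

text \<open>One iteration on one subdomain: \<open>p0\<close> is the pressure of the previous
  iterate, \<open>(q, p, g)\<close> the new iterate and \<open>(qn, pn, gn)\<close> the limit. The
  exchange condition is left out because it couples different subdomains; the interface variables
  are merely given functions here.\<close>

locale linearised_step = trace_domain \<Omega> \<Gamma> U for \<Omega> \<Gamma> U :: "'a::euclidean_space set" +
  fixes \<Gamma>N :: "'a set" and \<alpha> \<tau> L m M Lk LS Mq :: real and k S :: "real \<Rightarrow> real"
    and D :: "'a \<Rightarrow> 'a" and F pprev :: "'a \<Rightarrow> real"
    and qn :: "'a \<Rightarrow> 'a" and pn gn :: "'a \<Rightarrow> real"
    and q :: "'a \<Rightarrow> 'a" and p0 p g :: "'a \<Rightarrow> real"
  assumes pos: "0 < \<alpha>" "0 < \<tau>" "0 < L" "0 < m" "0 < Lk" "0 < LS" "0 < Mq"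
    and kinv: "\<And>s. s \<in> {0..1} \<Longrightarrow> m \<le> 1 / k s \<and> 1 / k s \<le> M" "Lk-lipschitz_on {0..1} (\<lambda>s. 1 / k s)"
    and S: "\<And>s. S s \<in> {0..1}" "mono S" "LS-lipschitz_on UNIV S"
    and D: "D \<in> L2_space (lebesgue_on \<Omega>)"
    and F: "F \<in> L2_space (lebesgue_on \<Omega>)" and pprev: "pprev \<in> L2_space (lebesgue_on \<Omega>)"
    and qn: "qn \<in> flux_space \<Omega> \<Gamma> \<Gamma>N" and pn: "pn \<in> L2_space (lebesgue_on \<Omega>)"
    and gn: "gn \<in> L2_space (surface_measure \<Gamma>)"
    and qn_bound: "AE x in lebesgue_on \<Omega>. norm (qn x) \<le> Mq"
    and q: "q \<in> flux_space \<Omega> \<Gamma> \<Gamma>N" and p: "p \<in> L2_space (lebesgue_on \<Omega>)" "p0 \<in> L2_space (lebesgue_on \<Omega>)"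
    and g: "g \<in> L2_space (surface_measure \<Gamma>)"
    and flux_n: "flux_equation \<Omega> \<Gamma> \<Gamma>N \<alpha> D (\<lambda>x. 1 / k (S (pn x))) qn pn gn"
    and flux_i: "flux_equation \<Omega> \<Gamma> \<Gamma>N \<alpha> D (\<lambda>x. 1 / k (S (p0 x))) q p g"
    and mass_n: "\<And>w. w \<in> L2_space (lebesgue_on \<Omega>) \<Longrightarrow>
        L2_inner (lebesgue_on \<Omega>) (\<lambda>x. S (pn x)) w + \<tau> * L2_inner (lebesgue_on \<Omega>) (weak_div \<Omega> qn) w
        = \<tau> * L2_inner (lebesgue_on \<Omega>) F w + L2_inner (lebesgue_on \<Omega>) (\<lambda>x. S (pprev x)) w"
    and mass_i: "\<And>w. w \<in> L2_space (lebesgue_on \<Omega>) \<Longrightarrow>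
        L * L2_inner (lebesgue_on \<Omega>) p w + \<tau> * L2_inner (lebesgue_on \<Omega>) (weak_div \<Omega> q) w
        = \<tau> * L2_inner (lebesgue_on \<Omega>) F w
          - L2_inner (lebesgue_on \<Omega>) (\<lambda>x. S (p0 x) - S (pprev x)) w + L * L2_inner (lebesgue_on \<Omega>) p0 w"
begin

abbreviation "\<mu> \<equiv> lebesgue_on \<Omega>"
abbreviation "\<sigma> \<equiv> surface_measure \<Gamma>"

definition "eq x = qn x - q x"
definition "ep x = pn x - p x"
definition "ep0 x = pn x - p0 x"
definition "eg x = gn x - g x"
definition "dS x = S (pn x) - S (p0 x)"
text \<open>A difference of two chosen traces; the chosen trace of \<open>eq\<close> agrees with it
  only almost everywhere.\<close>

definition "T x = normal_trace \<Omega> \<Gamma> qn x - normal_trace \<Omega> \<Gamma> q x"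
definition "kap r x = 1 / k (S (r x))"
text \<open>The difference of \<open>kap pn\<close> times \<open>qn\<close> and
  \<open>kap p0\<close> times \<open>q\<close> equals \<open>dK\<close> plus \<open>kap p0\<close>
  times \<open>eq\<close>. In this splitting the coefficient difference multiplies the limit flux,
  for which a uniform bound is available, and not the iterate.\<close>

definition "dK x = (kap pn x - kap p0 x) *\<^sub>R qn x"

section \<open>Square integrability of the errors and of the nonlinear terms\<close>

lemma finite_\<mu>: "finite_measure \<mu>"
  by (rule finite_measure_lebesgue_on_bounded[OF \<Omega>(2,1)])

lemma cont_S: "continuous_on UNIV S"
  using S(3) by (rule lipschitz_on_continuous_on)

lemma saturation_L2:
  assumes "r \<in> L2_space \<mu>"
  shows "(\<lambda>x. S (r x)) \<in> L2_space \<mu>"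
proof (rule L2_space_dominated[OF L2_space_const[OF finite_\<mu>, of 1]])
  show "(\<lambda>x. S (r x)) \<in> borel_measurable \<mu>"
    using measurable_compose[OF L2_spaceD(1)[OF assms] borel_measurable_continuous_onI[OF cont_S]] .
  show "AE x in \<mu>. norm (S (r x)) \<le> 1 * norm (1::real)" using S(1) by (intro AE_I2) auto
qed

lemma kap_bounds: "m \<le> kap r x" "kap r x \<le> M"
  using kinv(1)[OF S(1)] by (auto simp: kap_def)

lemma kap_measurable:
  assumes "r \<in> L2_space \<mu>"
  shows "kap r \<in> borel_measurable \<mu>"
proof -
  have "continuous_on UNIV (\<lambda>t. (\<lambda>s. 1 / k s) (S t))"
    by (rule continuous_on_compose2[OF lipschitz_on_continuous_on[OF kinv(2)] cont_S]) (use S(1) in auto)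
  then have "(\<lambda>t. 1 / k (S t)) \<in> borel_measurable borel" by (intro borel_measurable_continuous_onI)
  then show ?thesis unfolding kap_def[abs_def] using measurable_compose[OF L2_spaceD(1)[OF assms]] by blast
qed

lemma kap_scaleR_L2:
  assumes "r \<in> L2_space \<mu>" "v \<in> L2_space \<mu>"
  shows "(\<lambda>x. kap r x *\<^sub>R v x) \<in> L2_space \<mu>"
proof (rule L2_space_bounded_scaleR[OF assms(2) kap_measurable[OF assms(1)], of M])
  show "\<bar>kap r x\<bar> \<le> M" for x using kap_bounds[of r x] pos(4) by simp
qed

lemmas qn_props = flux_space_normal_trace[OF qn] and q_props = flux_space_normal_trace[OF q]

lemma error_L2: "eq \<in> L2_space \<mu>" "ep \<in> L2_space \<mu>" "ep0 \<in> L2_space \<mu>" "eg \<in> L2_space \<sigma>"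
    "dS \<in> L2_space \<mu>" "T \<in> L2_space \<sigma>"
  unfolding eq_def[abs_def] ep_def[abs_def] ep0_def[abs_def] eg_def[abs_def] dS_def[abs_def] T_def[abs_def]
  using H_divD(1)[OF qn_props(1)] H_divD(1)[OF q_props(1)] qn_props(3) q_props(3) pn p gn g
  by (auto intro: L2_space_diff saturation_L2)

lemma dK_L2: "dK \<in> L2_space \<mu>"
  using L2_space_diff[OF kap_scaleR_L2[OF pn H_divD(1)[OF qn_props(1)]] kap_scaleR_L2[OF p(2) H_divD(1)[OF qn_props(1)]]]
  by (simp add: dK_def[abs_def] scaleR_diff_left)

lemma eq_flux: "eq \<in> flux_space \<Omega> \<Gamma> \<Gamma>N"
  unfolding eq_def[abs_def] by (rule flux_space_diff[OF qn q])

section \<open>Error equations and bounds for their terms\<close>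

lemma flux_error:
  assumes v: "v \<in> flux_space \<Omega> \<Gamma> \<Gamma>N"
  shows "L2_inner \<mu> dK v + L2_inner \<mu> (\<lambda>x. kap p0 x *\<^sub>R eq x) v - L2_inner \<mu> ep (weak_div \<Omega> v)
    + \<alpha> * L2_inner \<sigma> T (normal_trace \<Omega> \<Gamma> v) = - L2_inner \<sigma> eg (normal_trace \<Omega> \<Gamma> v)"
proof -
  note vp = flux_space_normal_trace[OF v]
  note vL = H_divD(1,2)[OF vp(1)]
  let ?a = "\<lambda>x. kap pn x *\<^sub>R qn x" and ?b = "\<lambda>x. kap p0 x *\<^sub>R q x"
  have L: "?a \<in> L2_space \<mu>" "?b \<in> L2_space \<mu>" "(\<lambda>x. kap p0 x *\<^sub>R eq x) \<in> L2_space \<mu>"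
    using kap_scaleR_L2 pn p(2) H_divD(1)[OF qn_props(1)] H_divD(1)[OF q_props(1)] error_L2(1) by auto
  have "(\<lambda>x. dK x + kap p0 x *\<^sub>R eq x) = (\<lambda>x. ?a x - ?b x)"
    by (auto simp: dK_def eq_def algebra_simps)
  then have "L2_inner \<mu> dK v + L2_inner \<mu> (\<lambda>x. kap p0 x *\<^sub>R eq x) v = L2_inner \<mu> ?a v - L2_inner \<mu> ?b v"
    using L2_inner_add_left[OF dK_L2 L(3) vL(1)] L2_inner_diff_left[OF L(1,2) vL(1)] by simp
  moreover have "L2_inner \<mu> ep (weak_div \<Omega> v) = L2_inner \<mu> pn (weak_div \<Omega> v) - L2_inner \<mu> p (weak_div \<Omega> v)"
    unfolding ep_def[abs_def] by (rule L2_inner_diff_left[OF pn p(1) vL(2)])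
  moreover have "\<alpha> * L2_inner \<sigma> T (normal_trace \<Omega> \<Gamma> v)
      = \<alpha> * L2_inner \<sigma> (normal_trace \<Omega> \<Gamma> qn) (normal_trace \<Omega> \<Gamma> v) - \<alpha> * L2_inner \<sigma> (normal_trace \<Omega> \<Gamma> q) (normal_trace \<Omega> \<Gamma> v)"
    unfolding T_def[abs_def]
    by (simp add: L2_inner_diff_left[OF qn_props(3) q_props(3) vp(3)] right_diff_distrib)
  moreover have "L2_inner \<sigma> eg (normal_trace \<Omega> \<Gamma> v)
      = L2_inner \<sigma> gn (normal_trace \<Omega> \<Gamma> v) - L2_inner \<sigma> g (normal_trace \<Omega> \<Gamma> v)"
    unfolding eg_def[abs_def] by (rule L2_inner_diff_left[OF gn g vp(3)])
  ultimately show ?thesis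
    using flux_n[unfolded flux_equation_def, rule_format, OF v] flux_i[unfolded flux_equation_def, rule_format, OF v]
    unfolding kap_def by linarith
qed

lemma mass_error:
  assumes w: "w \<in> L2_space \<mu>"
  shows "L2_inner \<mu> dS w + L * (L2_inner \<mu> ep w - L2_inner \<mu> ep0 w) + \<tau> * L2_inner \<mu> (weak_div \<Omega> eq) w = 0"
proof -
  note qd = H_divD(2)[OF qn_props(1)] H_divD(2)[OF q_props(1)]
  have "L2_inner \<mu> (weak_div \<Omega> eq) w = L2_inner \<mu> (\<lambda>x. weak_div \<Omega> qn x - weak_div \<Omega> q x) w"
    unfolding eq_def[abs_def]
    by (rule L2_inner_cong_AE_left[OF weak_div_diff(2)[OF qn_props(1) q_props(1)]
          H_divD(2)[OF weak_div_diff(1)[OF qn_props(1) q_props(1)]] L2_space_diff[OF qd] w])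
  also have "\<dots> = L2_inner \<mu> (weak_div \<Omega> qn) w - L2_inner \<mu> (weak_div \<Omega> q) w"
    by (rule L2_inner_diff_left[OF qd w])
  finally have 1: "L2_inner \<mu> (weak_div \<Omega> eq) w = L2_inner \<mu> (weak_div \<Omega> qn) w - L2_inner \<mu> (weak_div \<Omega> q) w" .
  have 2: "L2_inner \<mu> dS w = L2_inner \<mu> (\<lambda>x. S (pn x)) w - L2_inner \<mu> (\<lambda>x. S (p0 x)) w"
    unfolding dS_def[abs_def] by (rule L2_inner_diff_left[OF saturation_L2[OF pn] saturation_L2[OF p(2)] w])
  have 3: "L2_inner \<mu> (\<lambda>x. S (p0 x) - S (pprev x)) w = L2_inner \<mu> (\<lambda>x. S (p0 x)) w - L2_inner \<mu> (\<lambda>x. S (pprev x)) w"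
    by (rule L2_inner_diff_left[OF saturation_L2[OF p(2)] saturation_L2[OF pprev] w])
  have 4: "L2_inner \<mu> ep w - L2_inner \<mu> ep0 w = L2_inner \<mu> p0 w - L2_inner \<mu> p w"
    unfolding ep_def[abs_def] ep0_def[abs_def]
    using L2_inner_diff_left[OF pn p(1) w] L2_inner_diff_left[OF pn p(2) w] by simp
  show ?thesis using mass_n[OF w] mass_i[OF w] unfolding 1 2 3 4 by (simp add: algebra_simps)
qed

lemma dK_norm: "L2_norm \<mu> dK \<le> Lk * Mq * L2_norm \<mu> dS"
proof -
  have "L2_norm \<mu> dK \<le> L2_norm \<mu> (\<lambda>x. (Lk * Mq) *\<^sub>R dS x)"
  proof (rule L2_norm_mono_AE[OF L2_space_scaleR[OF error_L2(5)] dK_L2])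
    show "AE x in \<mu>. norm (dK x) \<le> norm ((Lk * Mq) *\<^sub>R dS x)"
      using qn_bound
    proof eventually_elim
      case (elim x)
      have "\<bar>kap pn x - kap p0 x\<bar> \<le> Lk * \<bar>dS x\<bar>"
        using lipschitz_onD[OF kinv(2) S(1) S(1), of "pn x" "p0 x"] by (simp add: kap_def dS_def dist_real_def)
      then have "\<bar>kap pn x - kap p0 x\<bar> * norm (qn x) \<le> (Lk * \<bar>dS x\<bar>) * Mq"
        using elim pos by (intro mult_mono) auto
      then show ?case using pos by (simp add: dK_def abs_mult mult_ac)
    qed
  qed
  then show ?thesis using pos by (simp only: L2_norm_scaleR) simp
qed

lemma kap_eq_norm: "L2_norm \<mu> (\<lambda>x. kap p0 x *\<^sub>R eq x) \<le> M * L2_norm \<mu> eq"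
proof -
  have M: "0 \<le> M" using kap_bounds[of p0 undefined] pos(4) by linarith
  have "L2_norm \<mu> (\<lambda>x. kap p0 x *\<^sub>R eq x) \<le> L2_norm \<mu> (\<lambda>x. M *\<^sub>R eq x)"
  proof (rule L2_norm_mono_AE[OF L2_space_scaleR[OF error_L2(1)] kap_scaleR_L2[OF p(2) error_L2(1)]])
    have "norm (kap p0 x *\<^sub>R eq x) \<le> norm (M *\<^sub>R eq x)" for x
      using kap_bounds[of p0 x] pos(4) M by (simp add: mult_right_mono)
    then show "AE x in \<mu>. norm (kap p0 x *\<^sub>R eq x) \<le> norm (M *\<^sub>R eq x)" by simp
  qed
  then show ?thesis using M by (simp add: L2_norm_scaleR)
qed

lemma kap_coercive: "m * (L2_norm \<mu> eq)\<^sup>2 \<le> L2_inner \<mu> (\<lambda>x. kap p0 x *\<^sub>R eq x) eq"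
proof -
  have "m * (L2_norm \<mu> eq)\<^sup>2 = L2_inner \<mu> (\<lambda>x. m *\<^sub>R eq x) eq"
    by (simp add: L2_norm_power2 L2_inner_scaleR_left)
  also have "\<dots> \<le> L2_inner \<mu> (\<lambda>x. kap p0 x *\<^sub>R eq x) eq"
    unfolding L2_inner_def
  proof (intro integral_mono integrable_L2_inner L2_space_scaleR error_L2 kap_scaleR_L2 p(2))
    fix x
    show "(m *\<^sub>R eq x) \<bullet> eq x \<le> (kap p0 x *\<^sub>R eq x) \<bullet> eq x"
      using kap_bounds(1)[of p0 x] by (simp add: mult_right_mono)
  qed
  finally show ?thesis .
qed

text \<open>Cocoercivity: a monotone function with Lipschitz constant LS satisfies (S a - S b)^2
  \<le> LS (S a - S b) (a - b), because the two factors on the right have the same sign.\<close>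

lemma dS_monotone: "(L2_norm \<mu> dS)\<^sup>2 / LS \<le> L2_inner \<mu> dS ep0"
proof -
  have "(L2_norm \<mu> dS)\<^sup>2 / LS = L2_inner \<mu> (\<lambda>x. (1 / LS) *\<^sub>R dS x) dS"
    by (subst L2_inner_scaleR_left) (simp add: L2_norm_power2)
  also have "\<dots> \<le> L2_inner \<mu> dS ep0"
    unfolding L2_inner_def
  proof (intro integral_mono integrable_L2_inner L2_space_scaleR error_L2)
    fix x
    have lip: "\<bar>dS x\<bar> \<le> LS * \<bar>ep0 x\<bar>"
      using lipschitz_onD[OF S(3), of "pn x" "p0 x"] by (simp add: dS_def ep0_def dist_real_def)
    have sgn: "0 \<le> dS x * ep0 x"
    proof (cases "p0 x \<le> pn x")
      case True
      then show ?thesis using monoD[OF S(2) True] by (simp add: dS_def ep0_def)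
    next
      case False
      then have "pn x \<le> p0 x" by simp
      then show ?thesis using monoD[OF S(2) \<open>pn x \<le> p0 x\<close>] by (simp add: dS_def ep0_def mult_nonpos_nonpos)
    qed
    have "dS x * dS x = \<bar>dS x\<bar> * \<bar>dS x\<bar>" by simp
    also have "\<dots> \<le> \<bar>dS x\<bar> * (LS * \<bar>ep0 x\<bar>)" by (intro mult_left_mono lip) simp
    also have "\<dots> = LS * \<bar>dS x * ep0 x\<bar>" by (simp add: abs_mult mult_ac)
    also have "\<dots> = LS * (dS x * ep0 x)" using sgn by simp
    finally show "((1 / LS) *\<^sub>R dS x) \<bullet> dS x \<le> dS x \<bullet> ep0 x"
      using pos(6) by (simp add: field_simps)
  qed
  finally show ?thesis .
qed

text \<open>The flux error equation is tested with \<open>eq\<close> and the mass error equation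
  with \<open>ep\<close>, so that the divergence terms cancel. The Robin terms have no sign; they
  are kept as they are for the sum over the subdomains.\<close>

lemma energy_estimate:
  "\<tau> * m / 2 * (L2_norm \<mu> eq)\<^sup>2 + (1 / LS - 1 / (2 * L) - \<tau> * (Lk\<^sup>2 * Mq\<^sup>2) / (2 * m)) * (L2_norm \<mu> dS)\<^sup>2
    + \<tau> * (\<alpha> * (L2_norm \<sigma> T)\<^sup>2 + L2_inner \<sigma> eg T)
    + L / 2 * (L2_norm \<mu> ep)\<^sup>2 \<le> L / 2 * (L2_norm \<mu> ep0)\<^sup>2"
proof -
  define x where "x = L2_norm \<mu> eq"
  define y where "y = L2_norm \<mu> dS"
  define d where "d z = ep z - ep0 z" for z
  have dL2: "d \<in> L2_space \<mu>" unfolding d_def[abs_def] by (intro L2_space_diff error_L2)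
  have nt: "AE z in \<sigma>. normal_trace \<Omega> \<Gamma> eq z = T z"
    using normal_trace_diff[OF qn q] by (simp add: eq_def[abs_def] T_def)
  note nt_eq = flux_space_normal_trace(3)[OF eq_flux]
  have "L2_inner \<sigma> T (normal_trace \<Omega> \<Gamma> eq) = (L2_norm \<sigma> T)\<^sup>2" "L2_inner \<sigma> eg (normal_trace \<Omega> \<Gamma> eq) = L2_inner \<sigma> eg T"
    using L2_inner_cong_AE_left[OF nt nt_eq error_L2(6) error_L2(6)] L2_inner_cong_AE_left[OF nt nt_eq error_L2(6) error_L2(4)]
    by (simp_all add: L2_norm_power2 L2_inner_commute[of \<sigma> _ "normal_trace \<Omega> \<Gamma> eq"] L2_inner_commute[of \<sigma> T eg])
  then have f: "L2_inner \<mu> dK eq + L2_inner \<mu> (\<lambda>x. kap p0 x *\<^sub>R eq x) eq - L2_inner \<mu> ep (weak_div \<Omega> eq)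
      + \<alpha> * (L2_norm \<sigma> T)\<^sup>2 + L2_inner \<sigma> eg T = 0"
    using flux_error[OF eq_flux] by simp
  have dK: "- (Lk * Mq * y * x) \<le> L2_inner \<mu> dK eq"
    using L2_Cauchy_Schwarz[OF dK_L2 error_L2(1)] mult_right_mono[OF dK_norm, of x] by (simp add: x_def y_def)
  \<comment> \<open>Weighted by m, so that half of the coercive term survives to control the flux
    error.\<close>
  have young1: "Lk * Mq * y * x \<le> m / 2 * x\<^sup>2 + (Lk\<^sup>2 * Mq\<^sup>2) / (2 * m) * y\<^sup>2"
  proof -
    have "0 \<le> (m * x - Lk * Mq * y)\<^sup>2" by simp
    then have "2 * m * (Lk * Mq * y * x) \<le> m\<^sup>2 * x\<^sup>2 + Lk\<^sup>2 * Mq\<^sup>2 * y\<^sup>2"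
      by (simp add: power2_eq_square algebra_simps)
    then show ?thesis using pos(4) by (simp add: field_simps power2_eq_square)
  qed
  have kc: "m * x\<^sup>2 \<le> L2_inner \<mu> (\<lambda>x. kap p0 x *\<^sub>R eq x) eq" unfolding x_def by (rule kap_coercive)
  have flux: "m / 2 * x\<^sup>2 - (Lk\<^sup>2 * Mq\<^sup>2) / (2 * m) * y\<^sup>2 + (\<alpha> * (L2_norm \<sigma> T)\<^sup>2 + L2_inner \<sigma> eg T)
      \<le> L2_inner \<mu> ep (weak_div \<Omega> eq)"
    using f dK young1 kc by linarith
  \<comment> \<open>Polarisation turns the stabilisation term into a difference of squares, which
    telescopes over the iterations, plus half of the squared increment.\<close>
  have ep_d: "L2_inner \<mu> ep ep - L2_inner \<mu> ep0 ep = ((L2_norm \<mu> ep)\<^sup>2 - (L2_norm \<mu> ep0)\<^sup>2 + (L2_norm \<mu> d)\<^sup>2) / 2"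
  proof -
    have "(L2_norm \<mu> d)\<^sup>2 = L2_inner \<mu> ep ep - 2 * L2_inner \<mu> ep0 ep + L2_inner \<mu> ep0 ep0"
      unfolding L2_norm_power2 d_def[abs_def]
      using error_L2(2,3) L2_inner_commute[of \<mu> ep ep0]
      by (simp add: L2_inner_diff_left L2_inner_diff_right L2_space_diff)
    then show ?thesis by (simp add: L2_norm_power2)
  qed
  \<comment> \<open>Monotonicity pairs \<open>dS\<close> with the old error \<open>ep0\<close>, but
    the equation is tested with the new error \<open>ep\<close>; the increment \<open>d\<close>
    makes up the difference.\<close>
  have dS_ep: "L2_inner \<mu> dS ep = L2_inner \<mu> dS ep0 + L2_inner \<mu> dS d"
    unfolding d_def[abs_def] using error_L2 by (simp add: L2_inner_diff_right)
  \<comment> \<open>Weighted by L, so that it consumes exactly the term L/2 |d|^2 provided by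
    polarisation.\<close>
  have young2: "- (y\<^sup>2 / (2 * L) + L / 2 * (L2_norm \<mu> d)\<^sup>2) \<le> L2_inner \<mu> dS d"
  proof -
    have "0 \<le> (y - L * L2_norm \<mu> d)\<^sup>2" by simp
    then have "2 * L * (y * L2_norm \<mu> d) \<le> y\<^sup>2 + L\<^sup>2 * (L2_norm \<mu> d)\<^sup>2" by (simp add: power2_eq_square algebra_simps)
    then have "y * L2_norm \<mu> d \<le> y\<^sup>2 / (2 * L) + L / 2 * (L2_norm \<mu> d)\<^sup>2"
      using pos(3) by (simp add: field_simps power2_eq_square)
    then show ?thesis using L2_Cauchy_Schwarz[OF error_L2(5) dL2] by (simp add: y_def)
  qed
  have "L2_inner \<mu> dS ep + L * (L2_inner \<mu> ep ep - L2_inner \<mu> ep0 ep) + \<tau> * L2_inner \<mu> (weak_div \<Omega> eq) ep = 0"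
    by (rule mass_error[OF error_L2(2)])
  then have "L2_inner \<mu> dS ep0 + L2_inner \<mu> dS d + L / 2 * (L2_norm \<mu> ep)\<^sup>2 - L / 2 * (L2_norm \<mu> ep0)\<^sup>2
      + L / 2 * (L2_norm \<mu> d)\<^sup>2 + \<tau> * L2_inner \<mu> ep (weak_div \<Omega> eq) = 0"
    unfolding ep_d dS_ep L2_inner_commute[of \<mu> "weak_div \<Omega> eq"] by (simp add: algebra_simps add_divide_distrib diff_divide_distrib)
  moreover have "\<tau> * (m / 2 * x\<^sup>2 - (Lk\<^sup>2 * Mq\<^sup>2) / (2 * m) * y\<^sup>2 + (\<alpha> * (L2_norm \<sigma> T)\<^sup>2 + L2_inner \<sigma> eg T))
      \<le> \<tau> * L2_inner \<mu> ep (weak_div \<Omega> eq)"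
    using flux pos(2) by (intro mult_left_mono) auto
  moreover have "y\<^sup>2 / LS \<le> L2_inner \<mu> dS ep0" unfolding y_def by (rule dS_monotone)
  ultimately have "y\<^sup>2 / LS - y\<^sup>2 / (2 * L) + L / 2 * (L2_norm \<mu> ep)\<^sup>2 - L / 2 * (L2_norm \<mu> ep0)\<^sup>2
      + \<tau> * (m / 2 * x\<^sup>2 - (Lk\<^sup>2 * Mq\<^sup>2) / (2 * m) * y\<^sup>2 + (\<alpha> * (L2_norm \<sigma> T)\<^sup>2 + L2_inner \<sigma> eg T)) \<le> 0"
    using young2 by linarith
  moreover have "(1 / LS - 1 / (2 * L) - \<tau> * (Lk\<^sup>2 * Mq\<^sup>2) / (2 * m)) * y\<^sup>2
      = y\<^sup>2 / LS - y\<^sup>2 / (2 * L) - \<tau> * ((Lk\<^sup>2 * Mq\<^sup>2) / (2 * m) * y\<^sup>2)"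
    by (simp add: left_diff_distrib)
  moreover have "\<tau> * (m / 2 * x\<^sup>2 - (Lk\<^sup>2 * Mq\<^sup>2) / (2 * m) * y\<^sup>2 + (\<alpha> * (L2_norm \<sigma> T)\<^sup>2 + L2_inner \<sigma> eg T))
      = \<tau> * m / 2 * x\<^sup>2 - \<tau> * ((Lk\<^sup>2 * Mq\<^sup>2) / (2 * m) * y\<^sup>2) + \<tau> * (\<alpha> * (L2_norm \<sigma> T)\<^sup>2 + L2_inner \<sigma> eg T)"
    by (simp only: distrib_left right_diff_distrib) simp
  ultimately show ?thesis unfolding x_def[symmetric] y_def[symmetric] by linarith
qed

text \<open>Duality: <ep, div v> equals |ep|^2, and the interface terms vanish because v has no flux
  through \<Gamma>. The remaining terms are bounded by the saturation and flux errors times |v|, and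
  one factor |ep| cancels.\<close>

lemma pressure_estimate:
  assumes v: "v \<in> flux_space \<Omega> \<Gamma> \<Gamma>N" "AE x in \<mu>. weak_div \<Omega> v x = ep x"
    "AE x in \<sigma>. normal_trace \<Omega> \<Gamma> v x = 0" "L2_norm \<mu> v \<le> C * L2_norm \<mu> ep" and C: "0 \<le> C"
  shows "L2_norm \<mu> ep \<le> C * (Lk * Mq * L2_norm \<mu> dS + M * L2_norm \<mu> eq)"
proof -
  note vp = flux_space_normal_trace[OF v(1)]
  note vL = H_divD(1,2)[OF vp(1)]
  have z: "L2_inner \<sigma> h (normal_trace \<Omega> \<Gamma> v) = 0" if "h \<in> L2_space \<sigma>" for h
    using L2_inner_cong_AE_left[OF v(3) vp(3) L2_space_zero that]
    by (simp add: L2_inner_commute[of \<sigma> h])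
  have "L2_inner \<mu> ep (weak_div \<Omega> v) = (L2_norm \<mu> ep)\<^sup>2"
    using L2_inner_cong_AE_left[OF v(2) vL(2) error_L2(2) error_L2(2)]
    by (simp add: L2_norm_power2 L2_inner_commute[of \<mu> ep "weak_div \<Omega> v"])
  then have "(L2_norm \<mu> ep)\<^sup>2 = L2_inner \<mu> dK v + L2_inner \<mu> (\<lambda>x. kap p0 x *\<^sub>R eq x) v"
    using flux_error[OF v(1)] z[OF error_L2(6)] z[OF error_L2(4)] by simp
  also have "\<dots> \<le> L2_norm \<mu> dK * L2_norm \<mu> v + L2_norm \<mu> (\<lambda>x. kap p0 x *\<^sub>R eq x) * L2_norm \<mu> v"
    using L2_Cauchy_Schwarz[OF dK_L2 vL(1)] L2_Cauchy_Schwarz[OF kap_scaleR_L2[OF p(2) error_L2(1)] vL(1)] by linarith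
  also have "\<dots> \<le> (Lk * Mq * L2_norm \<mu> dS) * L2_norm \<mu> v + (M * L2_norm \<mu> eq) * L2_norm \<mu> v"
    by (intro add_mono mult_right_mono dK_norm kap_eq_norm L2_norm_nonneg)
  also have "\<dots> = (Lk * Mq * L2_norm \<mu> dS + M * L2_norm \<mu> eq) * L2_norm \<mu> v" by (simp add: distrib_right)
  also have "\<dots> \<le> (Lk * Mq * L2_norm \<mu> dS + M * L2_norm \<mu> eq) * (C * L2_norm \<mu> ep)"
  proof (rule mult_left_mono[OF v(4)])
    have "0 \<le> M" using kap_bounds[of p0 undefined] pos(4) by linarith
    then show "0 \<le> Lk * Mq * L2_norm \<mu> dS + M * L2_norm \<mu> eq" using pos by simp
  qed
  finally have "L2_norm \<mu> ep * L2_norm \<mu> ep \<le> L2_norm \<mu> ep * (C * (Lk * Mq * L2_norm \<mu> dS + M * L2_norm \<mu> eq))"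
    by (simp add: power2_eq_square mult_ac)
  moreover have "0 \<le> C * (Lk * Mq * L2_norm \<mu> dS + M * L2_norm \<mu> eq)"
  proof -
    have "0 \<le> M" using kap_bounds[of p0 undefined] pos(4) by linarith
    then show ?thesis using pos C by simp
  qed
  ultimately show ?thesis
    by (cases "L2_norm \<mu> ep = 0") (auto simp: mult_le_cancel_left less_le)
qed

end

section \<open>Convergence\<close>

text \<open>\<Omega> serves as the open set \<open>U\<close>: inside \<Omega> the frontier of either
  subdomain belongs to the interface, and the part of the interface outside \<Omega> lies on three
  frontiers at once, which is a null set.\<close>

lemma trace_domain_subdomain:
  fixes \<Omega> :: "'a::euclidean_space set" and \<Omega>s :: "2 \<Rightarrow> 'a set"
  assumes dom: "lipschitz_domain \<Omega>" "\<And>l. lipschitz_domain (\<Omega>s l)" "\<And>l. \<Omega>s l \<subseteq> \<Omega>"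
    and dec: "closure \<Omega> = closure (\<Omega>s 1) \<union> closure (\<Omega>s 2)" "\<Omega>s 1 \<inter> \<Omega>s 2 = {}"
  shows "trace_domain (\<Omega>s l) (interface \<Omega>s) \<Omega>"
    and "hausdorff_outer (DIM('a) - 1) (interface \<Omega>s - \<Omega>) = 0"
proof -
  have op: "open \<Omega>" "\<And>l. open (\<Omega>s l)" "\<And>l. bounded (\<Omega>s l)" using dom by (auto simp: lipschitz_domain_def)
  have "interface \<Omega>s \<subseteq> closure \<Omega>" using dec(1) by (auto simp: interface_def frontier_def)
  then have "interface \<Omega>s - \<Omega> \<subseteq> frontier \<Omega> \<inter> frontier (\<Omega>s 1) \<inter> frontier (\<Omega>s 2)"
    using op(1) by (auto simp: interface_def frontier_def interior_open)
  then show null: "hausdorff_outer (DIM('a) - 1) (interface \<Omega>s - \<Omega>) = 0"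
    using hausdorff_outer_mono hausdorff_outer_triple_frontier[OF dom(1,2,2,3,3) dec(2)] by (metis le_zero_eq)
  show "trace_domain (\<Omega>s l) (interface \<Omega>s) \<Omega>"
  proof
    show "compact (interface \<Omega>s)"
      unfolding interface_def by (intro compact_Int_closed compact_frontier_lipschitz_domain dom) simp
    have "interface \<Omega>s \<subseteq> frontier (\<Omega>s 1)" by (auto simp: interface_def)
    from hausdorff_outer_mono[OF this, of "DIM('a) - 1"] hausdorff_outer_frontier_finite[OF dom(2), of 1]
    show "hausdorff_outer (DIM('a) - 1) (interface \<Omega>s) < top" by (rule le_less_trans)
    have "frontier (\<Omega>s 1) \<inter> \<Omega> \<subseteq> frontier (\<Omega>s 2)"
      by (rule frontier_subdomain_interior[OF dom(2) op(1) op(2) dec])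
    moreover have "frontier (\<Omega>s 2) \<inter> \<Omega> \<subseteq> frontier (\<Omega>s 1)"
      by (rule frontier_subdomain_interior[OF dom(2) op(1) op(2)]) (use dec in auto)
    ultimately show "frontier (\<Omega>s l) \<inter> \<Omega> \<subseteq> interface \<Omega>s"
      using exhaust_2[of l] by (auto simp: interface_def)
  qed (use op null in auto)
qed

text \<open>The dual field requires a Dirichlet part disjoint from \<Gamma>. Removing \<Gamma> costs
  only a null set, since \<Gamma>D lies on the frontier of \<Omega> and can meet \<Gamma> only in
  \<Gamma> - \<Omega>.\<close>

lemma dirichlet_part:
  fixes \<Omega>1 \<Omega> \<Gamma> \<Gamma>D \<Gamma>N :: "'a::euclidean_space set"
  assumes pos: "0 < emeasure (hausdorff_measure (DIM('a) - 1)) (frontier \<Omega>1 \<inter> \<Gamma>D)"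
    and D: "\<Gamma>D \<subseteq> frontier \<Omega>" "\<Gamma>D \<inter> \<Gamma>N = {}" and \<Omega>: "open \<Omega>"
    and \<Gamma>: "compact \<Gamma>" "hausdorff_outer (DIM('a) - 1) (\<Gamma> - \<Omega>) = 0"
  defines "E \<equiv> frontier \<Omega>1 \<inter> \<Gamma>D - \<Gamma>"
  shows "E \<in> sets borel" "E \<subseteq> frontier \<Omega>1 - (\<Gamma> \<union> \<Gamma>N)" "0 < hausdorff_outer (DIM('a) - 1) E"
proof -
  \<comment> \<open>\<open>emeasure\<close> is 0 by default on sets that are not measurable, so
    positivity already implies that this set is Borel.\<close>
  have b: "frontier \<Omega>1 \<inter> \<Gamma>D \<in> sets borel"
  proof (rule ccontr)
    assume "\<not> ?thesis"
    then have "emeasure (hausdorff_measure (DIM('a) - 1)) (frontier \<Omega>1 \<inter> \<Gamma>D) = 0"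
      by (intro emeasure_notin_sets) simp
    then show False using pos by simp
  qed
  then show "E \<in> sets borel" using \<Gamma>(1) by (auto simp: E_def intro: borel_compact)
  show "E \<subseteq> frontier \<Omega>1 - (\<Gamma> \<union> \<Gamma>N)" using D(2) by (auto simp: E_def)
  have "frontier \<Omega>1 \<inter> \<Gamma>D \<subseteq> E \<union> (\<Gamma> - \<Omega>)"
    using D(1) frontier_not_in_open[OF \<Omega>] by (auto simp: E_def)
  from hausdorff_outer_mono[OF this, of "DIM('a) - 1"] hausdorff_outer_Un[of "DIM('a) - 1" E "\<Gamma> - \<Omega>"] \<Gamma>(2)
  have "hausdorff_outer (DIM('a) - 1) (frontier \<Omega>1 \<inter> \<Gamma>D) \<le> hausdorff_outer (DIM('a) - 1) E" by simp
  then show "0 < hausdorff_outer (DIM('a) - 1) E"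
    using pos emeasure_hausdorff_measure[OF b] by (metis le_zero_eq not_gr_zero order_less_le_trans)
qed

text \<open>The expansion of |2 \<alpha> T + e|^2. The bracket is exactly the Robin contribution in
  \<open>energy_estimate\<close>, which is why the sum over both subdomains telescopes.\<close>

lemma (in trace_domain) exchange_error:
  assumes q: "q \<in> flux_space \<Omega> \<Gamma> \<Gamma>N" "q' \<in> flux_space \<Omega> \<Gamma> \<Gamma>N"
    and g: "g \<in> L2_space (surface_measure \<Gamma>)" "g' \<in> L2_space (surface_measure \<Gamma>)"
      "h \<in> L2_space (surface_measure \<Gamma>)" "h' \<in> L2_space (surface_measure \<Gamma>)"
    and ex: "exchange_equation \<Omega> \<Gamma> \<alpha> q g h" "exchange_equation \<Omega> \<Gamma> \<alpha> q' g' h'"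
  shows "(L2_norm (surface_measure \<Gamma>) (\<lambda>x. h x - h' x))\<^sup>2 = 4 * \<alpha> * (\<alpha> *
      (L2_norm (surface_measure \<Gamma>) (\<lambda>x. normal_trace \<Omega> \<Gamma> q x - normal_trace \<Omega> \<Gamma> q' x))\<^sup>2
      + L2_inner (surface_measure \<Gamma>) (\<lambda>x. g x - g' x) (\<lambda>x. normal_trace \<Omega> \<Gamma> q x - normal_trace \<Omega> \<Gamma> q' x))
      + (L2_norm (surface_measure \<Gamma>) (\<lambda>x. g x - g' x))\<^sup>2"
proof -
  let ?M = "surface_measure \<Gamma>"
  define T where "T x = normal_trace \<Omega> \<Gamma> q x - normal_trace \<Omega> \<Gamma> q' x" for x
  define e where "e x = g x - g' x" for x
  note nt = flux_space_normal_trace(3)[OF q(1)] flux_space_normal_trace(3)[OF q(2)]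
  have T: "T \<in> L2_space ?M" unfolding T_def[abs_def] by (intro L2_space_diff nt)
  have e: "e \<in> L2_space ?M" unfolding e_def[abs_def] by (intro L2_space_diff g)
  have r: "(\<lambda>x. 2 * \<alpha> * normal_trace \<Omega> \<Gamma> q x + g x) \<in> L2_space ?M"
    "(\<lambda>x. 2 * \<alpha> * normal_trace \<Omega> \<Gamma> q' x + g' x) \<in> L2_space ?M"
    by (intro L2_space_add L2_space_mult nt g)+
  have sum: "(\<lambda>x. (2 * \<alpha> * normal_trace \<Omega> \<Gamma> q x + g x) - (2 * \<alpha> * normal_trace \<Omega> \<Gamma> q' x + g' x))
      = (\<lambda>x. (2 * \<alpha>) *\<^sub>R T x + e x)"
    by (auto simp: T_def e_def algebra_simps)
  have "L2_norm ?M (\<lambda>x. h x - h' x) = L2_norm ?M (\<lambda>x. (2 * \<alpha>) *\<^sub>R T x + e x)"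
  proof (rule L2_inner_eq_imp_norm_eq)
    show "(\<lambda>x. h x - h' x) \<in> L2_space ?M" "(\<lambda>x. (2 * \<alpha>) *\<^sub>R T x + e x) \<in> L2_space ?M"
      by (intro L2_space_diff L2_space_add L2_space_scaleR T e g)+
    fix w :: "'a \<Rightarrow> real" assume w: "w \<in> L2_space ?M"
    show "L2_inner ?M (\<lambda>x. h x - h' x) w = L2_inner ?M (\<lambda>x. (2 * \<alpha>) *\<^sub>R T x + e x) w"
      unfolding sum[symmetric] L2_inner_diff_left[OF r w] L2_inner_diff_left[OF g(3,4) w]
      using ex w by (simp add: exchange_equation_def)
  qed
  then have "(L2_norm ?M (\<lambda>x. h x - h' x))\<^sup>2 = (2 * \<alpha>)\<^sup>2 * (L2_norm ?M T)\<^sup>2 + 2 * (2 * \<alpha> * L2_inner ?M T e) + (L2_norm ?M e)\<^sup>2"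
    by (simp only: L2_norm_power2_add[OF L2_space_scaleR[OF T] e] L2_norm_scaleR L2_inner_scaleR_left
        power_mult_distrib power2_abs)
  then show ?thesis
    unfolding T_def[symmetric] e_def[symmetric] L2_inner_commute[of ?M e T]
    by (simp add: power2_eq_square algebra_simps)
qed

section \<open>Vanishing dissipation and convergence of the scheme\<close>

lemma dissipation_tendsto_zero:
  fixes V d :: "nat \<Rightarrow> real"
  assumes "\<And>i. 0 \<le> V i" "\<And>i. 0 \<le> d i" "\<And>i. V (Suc i) + d i \<le> V i"
  shows "d \<longlonglongrightarrow> 0"
proof -
  have "decseq V"
  proof (rule decseq_SucI)
    show "V (Suc i) \<le> V i" for i using assms(2,3)[of i] by linarith
  qed
  then obtain l where l: "V \<longlonglongrightarrow> l" by (rule decseq_convergent[OF _ allI[OF assms(1)]])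
  have "(\<lambda>i. V i - V (Suc i)) \<longlonglongrightarrow> l - l" by (intro tendsto_diff l LIMSEQ_Suc)
  then have lim: "(\<lambda>i. V i - V (Suc i)) \<longlonglongrightarrow> 0" by simp
  show ?thesis
  proof (rule tendsto_sandwich[OF _ _ tendsto_const lim])
    show "\<forall>\<^sub>F i in sequentially. 0 \<le> d i" using assms(2) by simp
    show "\<forall>\<^sub>F i in sequentially. d i \<le> V i - V (Suc i)"
    proof (intro always_eventually allI)
      show "d i \<le> V i - V (Suc i)" for i using assms(3)[of i] by linarith
    qed
  qed
qed

lemma sum_square_tendsto_zero:
  fixes f :: "'b \<Rightarrow> nat \<Rightarrow> real"
  assumes "finite I" "l \<in> I" "\<And>l. l \<in> I \<Longrightarrow> 0 < c l" "(\<lambda>i. \<Sum>l\<in>I. c l * (f l i)\<^sup>2) \<longlonglongrightarrow> 0"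
  shows "f l \<longlonglongrightarrow> 0"
proof -
  have "(\<lambda>i. c l * (f l i)\<^sup>2) \<longlonglongrightarrow> 0"
  proof (rule tendsto_sandwich[OF _ _ tendsto_const assms(4)])
    show "\<forall>\<^sub>F i in sequentially. 0 \<le> c l * (f l i)\<^sup>2"
      using assms(3)[OF assms(2)] by (intro always_eventually allI) simp
    show "\<forall>\<^sub>F i in sequentially. c l * (f l i)\<^sup>2 \<le> (\<Sum>l\<in>I. c l * (f l i)\<^sup>2)"
    proof (intro always_eventually allI)
      fix i
      have "0 \<le> c l' * (f l' i)\<^sup>2" if "l' \<in> I" for l' using assms(3)[OF that] by simp
      then show "c l * (f l i)\<^sup>2 \<le> (\<Sum>l\<in>I. c l * (f l i)\<^sup>2)"
        using assms(1,2) by (intro member_le_sum) auto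
    qed
  qed
  then have "(\<lambda>i. inverse (c l) * (c l * (f l i)\<^sup>2)) \<longlonglongrightarrow> inverse (c l) * 0" by (intro tendsto_mult tendsto_const)
  moreover have "inverse (c l) * (c l * (f l i)\<^sup>2) = (f l i)\<^sup>2" for i using assms(3)[OF assms(2)] by simp
  ultimately have "(\<lambda>i. (f l i)\<^sup>2) \<longlonglongrightarrow> 0" by simp
  then show ?thesis by simp
qed

theorem theorem3p5:
  fixes \<Omega> :: "(real ^ 'd) set"
    and \<Omega>s :: "2 \<Rightarrow> (real ^ 'd) set"
    and \<Gamma>D \<Gamma>N :: "(real ^ 'd) set"
    and \<tau> \<alpha> :: real
    and k S :: "2 \<Rightarrow> real \<Rightarrow> real"
    and L mk Mk mkinv Mkinv Lkinv LS Mq :: "2 \<Rightarrow> real"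
    and F \<eta> pprev :: "2 \<Rightarrow> real ^ 'd \<Rightarrow> real"
    and grad\<eta> :: "2 \<Rightarrow> real ^ 'd \<Rightarrow> real ^ 'd"
    and qn :: "2 \<Rightarrow> real ^ 'd \<Rightarrow> real ^ 'd"
    and pn gn :: "2 \<Rightarrow> real ^ 'd \<Rightarrow> real"
    and q :: "nat \<Rightarrow> 2 \<Rightarrow> real ^ 'd \<Rightarrow> real ^ 'd"
    and p g :: "nat \<Rightarrow> 2 \<Rightarrow> real ^ 'd \<Rightarrow> real"
  assumes dim: "CARD('d) \<in> {2, 3}"
    and domain: "lipschitz_domain \<Omega>"
    and boundary_parts: "frontier \<Omega> = closure \<Gamma>D \<union> closure \<Gamma>N" "\<Gamma>D \<inter> \<Gamma>N = {}"
    and subdomains: "\<And>l. lipschitz_domain (\<Omega>s l)" "\<And>l. \<Omega>s l \<subseteq> \<Omega>"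
    and decomposition: "closure \<Omega> = closure (\<Omega>s 1) \<union> closure (\<Omega>s 2)" "\<Omega>s 1 \<inter> \<Omega>s 2 = {}"
    and interface_manifold: "manifold_with_boundary (CARD('d) - 1) (interface \<Omega>s)"
    and dirichlet: "\<And>l. emeasure (hausdorff_measure (CARD('d) - 1)) (frontier (\<Omega>s l) \<inter> \<Gamma>D) > 0"
    and time_step: "\<tau> > 0"
    and stab_pos: "\<And>l. L l > 0"
    and source: "\<And>l. F l \<in> L2_space (lebesgue_on (\<Omega>s l))"
    and gravity: "\<And>l. has_weak_gradient (\<Omega>s l) (\<eta> l) (grad\<eta> l)"
      "\<And>l. grad\<eta> l \<in> L2_space (lebesgue_on (\<Omega>s l))"
    and previous: "\<And>l. pprev l \<in> L2_space (lebesgue_on (\<Omega>s l))"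
    and k_bounds: "\<And>l. 0 < mk l" "\<And>l. mk l \<le> Mk l" "\<And>l. k l \<in> {0..1} \<rightarrow> {mk l..Mk l}"
    and k_lipschitz: "\<And>l. \<exists>C. C-lipschitz_on {0..1} (k l)"
    and kinv_bounds: "\<And>l. 0 < mkinv l" "\<And>l. mkinv l \<le> Mkinv l"
      "\<And>l. (\<lambda>s. 1 / k l s) \<in> {0..1} \<rightarrow> {mkinv l..Mkinv l}"
    and kinv_lipschitz: "\<And>l. 0 < Lkinv l" "\<And>l. (Lkinv l)-lipschitz_on {0..1} (\<lambda>s. 1 / k l s)"
    and S_range: "\<And>l. S l \<in> UNIV \<rightarrow> {0..1}"
    and S_mono: "\<And>l. mono (S l)"
    and S_lipschitz: "\<And>l. 0 < LS l" "\<And>l. (LS l)-lipschitz_on UNIV (S l)"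
    and limit: "limit_solution \<Omega>s \<Gamma>N \<alpha> \<tau> k S F grad\<eta> pprev qn pn gn"
    and flux_bound: "\<And>l. 0 < Mq l"
      "\<And>l. esssup (lebesgue_on (\<Omega>s l)) (\<lambda>x. ereal (norm (qn l x))) \<le> ereal (Mq l)"
    and stab: "\<And>l. L l > LS l / 2"
    and robin: "\<alpha> > 0"
    and time_step_bound:
      "\<And>l. \<tau> < (1 / LS l - 1 / (2 * L l)) * (2 * mkinv l / ((Lkinv l)\<^sup>2 * (Mq l)\<^sup>2))"
    and scheme: "iterative_scheme \<Omega>s \<Gamma>N \<alpha> \<tau> k S L F grad\<eta> pprev q p g"
  shows "(\<lambda>i. L2_norm_pair \<Omega>s (\<lambda>l x. pn l x - p i l x)) \<longlonglongrightarrow> 0"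
proof -
  let ?\<Gamma> = "interface \<Omega>s"
  let ?\<sigma> = "surface_measure (interface \<Omega>s)"
  let ?\<mu> = "\<lambda>l. lebesgue_on (\<Omega>s l)"
  have dim_eq: "DIM(real ^ 'd) = CARD('d)" by simp
  have op: "open \<Omega>" using domain by (simp add: lipschitz_domain_def)
  have td: "trace_domain (\<Omega>s l) ?\<Gamma> \<Omega>" for l
    by (rule trace_domain_subdomain(1)[OF domain subdomains decomposition])
  have null: "hausdorff_outer (DIM(real ^ 'd) - 1) (?\<Gamma> - \<Omega>) = 0"
    by (rule trace_domain_subdomain(2)[OF domain subdomains decomposition])
  have lim_state: "qn l \<in> flux_space (\<Omega>s l) ?\<Gamma> \<Gamma>N" "pn l \<in> L2_space (?\<mu> l)" "gn l \<in> L2_space ?\<sigma>" for l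
    using limit by (auto simp: limit_solution_def state_space_def)
  have state: "q i l \<in> flux_space (\<Omega>s l) ?\<Gamma> \<Gamma>N" "p i l \<in> L2_space (?\<mu> l)" "g i l \<in> L2_space ?\<sigma>" for i l
    using scheme by (auto simp: iterative_scheme_def state_space_def)
  have qn_bound: "AE x in ?\<mu> l. norm (qn l x) \<le> Mq l" for l
  proof -
    from esssup_AE[where M = "?\<mu> l" and f = "\<lambda>x. ereal (norm (qn l x))"] show ?thesis
    proof eventually_elim
      case (elim x)
      then have "ereal (norm (qn l x)) \<le> ereal (Mq l)" using flux_bound(2)[of l] by (rule order_trans)
      then show ?case by simp
    qed
  qed
  have step: "linearised_step (\<Omega>s l) ?\<Gamma> \<Omega> \<Gamma>N \<alpha> \<tau> (L l) (mkinv l) (Mkinv l) (Lkinv l) (LS l) (Mq l) (k l) (S l)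
      (grad\<eta> l) (F l) (pprev l) (qn l) (pn l) (gn l) (q (Suc i) l) (p i l) (p (Suc i) l) (g (Suc i) l)" for i l
  proof (intro linearised_step.intro[OF td] linearised_step_axioms.intro)
    show "mkinv l \<le> 1 / k l s \<and> 1 / k l s \<le> Mkinv l" if "s \<in> {0..1}" for s
      using kinv_bounds(3)[of l] that by (auto simp: Pi_iff)
    show "S l s \<in> {0..1}" for s using S_range[of l] by (auto simp: Pi_iff)
    show "flux_equation (\<Omega>s l) ?\<Gamma> \<Gamma>N \<alpha> (grad\<eta> l) (\<lambda>x. 1 / k l (S l (pn l x))) (qn l) (pn l) (gn l)"
      using limit by (simp add: limit_solution_def)
    show "flux_equation (\<Omega>s l) ?\<Gamma> \<Gamma>N \<alpha> (grad\<eta> l) (\<lambda>x. 1 / k l (S l (p i l x))) (q (Suc i) l) (p (Suc i) l) (g (Suc i) l)"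
      using scheme unfolding iterative_scheme_def by (elim conjE allE[of _ "Suc i"]) simp
    fix w :: "real ^ 'd \<Rightarrow> real" assume w: "w \<in> L2_space (?\<mu> l)"
    show "L2_inner (?\<mu> l) (\<lambda>x. S l (pn l x)) w + \<tau> * L2_inner (?\<mu> l) (weak_div (\<Omega>s l) (qn l)) w
        = \<tau> * L2_inner (?\<mu> l) (F l) w + L2_inner (?\<mu> l) (\<lambda>x. S l (pprev l x)) w"
      using limit w by (simp add: limit_solution_def)
    show "L l * L2_inner (?\<mu> l) (p (Suc i) l) w + \<tau> * L2_inner (?\<mu> l) (weak_div (\<Omega>s l) (q (Suc i) l)) w
        = \<tau> * L2_inner (?\<mu> l) (F l) w - L2_inner (?\<mu> l) (\<lambda>x. S l (p i l x) - S l (pprev l x)) w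
          + L l * L2_inner (?\<mu> l) (p i l) w"
      using scheme w unfolding iterative_scheme_def by (elim conjE allE[of _ "Suc i"]) simp
  qed (use robin time_step stab_pos kinv_bounds kinv_lipschitz S_mono S_lipschitz flux_bound(1) gravity(2) source previous
      lim_state state qn_bound in auto)
  \<comment> \<open>The index shift matters: at index i, flux and interface errors belong to the
    iterate \<open>Suc i\<close>, pressure and saturation errors to the iterate i on which its
    coefficients are based.\<close>
  define Eq where "Eq l i = L2_norm (?\<mu> l) (\<lambda>x. qn l x - q (Suc i) l x)" for l i
  define Ep where "Ep l i = L2_norm (?\<mu> l) (\<lambda>x. pn l x - p i l x)" for l i
  define Ds where "Ds l i = L2_norm (?\<mu> l) (\<lambda>x. S l (pn l x) - S l (p i l x))" for l i
  define Eg where "Eg l i = L2_norm ?\<sigma> (\<lambda>x. gn l x - g (Suc i) l x)" for l i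
  define c where "c l = 1 / LS l - 1 / (2 * L l) - \<tau> * ((Lkinv l)\<^sup>2 * (Mq l)\<^sup>2) / (2 * mkinv l)" for l
  define R where "R l i = \<alpha> * (L2_norm ?\<sigma> (\<lambda>x. normal_trace (\<Omega>s l) ?\<Gamma> (qn l) x - normal_trace (\<Omega>s l) ?\<Gamma> (q (Suc i) l) x))\<^sup>2
      + L2_inner ?\<sigma> (\<lambda>x. gn l x - g (Suc i) l x)
          (\<lambda>x. normal_trace (\<Omega>s l) ?\<Gamma> (qn l) x - normal_trace (\<Omega>s l) ?\<Gamma> (q (Suc i) l) x)" for l i
  \<comment> \<open>This is the time-step bound after division by 2 mkinv / (Lkinv^2 Mq^2).\<close>
  have c_pos: "0 < c l" for l
  proof -
    have K: "0 < (Lkinv l)\<^sup>2 * (Mq l)\<^sup>2" using kinv_lipschitz(1)[of l] flux_bound(1)[of l] by simp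
    have "\<tau> * ((Lkinv l)\<^sup>2 * (Mq l)\<^sup>2) < (1 / LS l - 1 / (2 * L l)) * (2 * mkinv l)"
      using time_step_bound[of l] K by (simp add: field_simps)
    then show ?thesis using kinv_bounds(1)[of l] unfolding c_def by (simp add: pos_divide_less_eq)
  qed
  have est: "\<tau> * mkinv l / 2 * (Eq l i)\<^sup>2 + c l * (Ds l i)\<^sup>2 + \<tau> * R l i + L l / 2 * (Ep l (Suc i))\<^sup>2
      \<le> L l / 2 * (Ep l i)\<^sup>2" for l i
  proof -
    interpret linearised_step "\<Omega>s l" ?\<Gamma> \<Omega> \<Gamma>N \<alpha> \<tau> "L l" "mkinv l" "Mkinv l" "Lkinv l" "LS l" "Mq l" "k l" "S l"
      "grad\<eta> l" "F l" "pprev l" "qn l" "pn l" "gn l" "q (Suc i) l" "p i l" "p (Suc i) l" "g (Suc i) l"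
      by (rule step)
    show ?thesis
      using energy_estimate
      unfolding eq_def[abs_def] dS_def[abs_def] T_def[abs_def] eg_def[abs_def] ep_def[abs_def] ep0_def[abs_def]
        Eq_def Ds_def R_def Ep_def c_def .
  qed
  \<comment> \<open>Because of the shift in \<open>Eg\<close>, the relation starts with
    \<open>g 1\<close>, and the arbitrary initial \<open>g 0\<close> does not enter.\<close>
  have exchange: "(Eg l (Suc i))\<^sup>2 = 4 * \<alpha> * R j i + (Eg j i)\<^sup>2" if "l \<noteq> j" for l j i
  proof -
    interpret trace_domain "\<Omega>s j" ?\<Gamma> \<Omega> by (rule td)
    have "exchange_equation (\<Omega>s j) ?\<Gamma> \<alpha> (qn j) (gn j) (gn l)"
      using limit that by (simp add: limit_solution_def)
    moreover have "exchange_equation (\<Omega>s j) ?\<Gamma> \<alpha> (q (Suc i) j) (g (Suc i) j) (g (Suc (Suc i)) l)"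
      using scheme that unfolding iterative_scheme_def by (elim conjE allE[of _ "Suc (Suc i)"]) simp
    ultimately show ?thesis
      unfolding Eg_def R_def
      by (rule exchange_error[OF lim_state(1) state(1) lim_state(3) state(3) lim_state(3) state(3)])
  qed
  \<comment> \<open>The weight \<tau> / (4 \<alpha>) turns the term 4 \<alpha> R of the exchange
    relation into the term \<tau> R of the energy estimate.\<close>
  define V where "V i = (\<Sum>l\<in>UNIV. L l / 2 * (Ep l i)\<^sup>2) + \<tau> / (4 * \<alpha>) * (\<Sum>l\<in>UNIV. (Eg l i)\<^sup>2)" for i
  define d where "d i = (\<Sum>l\<in>UNIV. \<tau> * mkinv l / 2 * (Eq l i)\<^sup>2 + c l * (Ds l i)\<^sup>2)" for i
  have "d \<longlonglongrightarrow> 0"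
  proof (rule dissipation_tendsto_zero[of V])
    show "0 \<le> V i" for i
      unfolding V_def using stab_pos time_step robin
      by (intro add_nonneg_nonneg mult_nonneg_nonneg sum_nonneg) (auto simp: less_imp_le)
    show "0 \<le> d i" for i
      unfolding d_def using c_pos time_step kinv_bounds(1)
      by (intro add_nonneg_nonneg mult_nonneg_nonneg sum_nonneg) (auto simp: less_imp_le)
    fix i
    \<comment> \<open>The exchange swaps the subdomains, as the new interface error of one comes
      from the data of the other; in the sum over both the swap is invisible.\<close>
    have "\<tau> / (4 * \<alpha>) * (\<Sum>l\<in>UNIV. (Eg l (Suc i))\<^sup>2)
        = \<tau> * R 1 i + \<tau> * R 2 i + \<tau> / (4 * \<alpha>) * (\<Sum>l\<in>UNIV. (Eg l i)\<^sup>2)"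
      using exchange[of 1 2 i] exchange[of 2 1 i] robin by (simp add: sum_2 field_simps)
    then show "V (Suc i) + d i \<le> V i"
      using est[of 1 i] est[of 2 i] unfolding V_def d_def sum_2 by linarith
  qed
  then have d: "d \<longlonglongrightarrow> 0" .
  have Eq_lim: "Eq l \<longlonglongrightarrow> 0" and Ds_lim: "Ds l \<longlonglongrightarrow> 0" for l
  proof -
    have c1: "0 < \<tau> * mkinv l / 2" for l using time_step kinv_bounds(1)[of l] by simp
    have "(\<lambda>i. \<Sum>l\<in>UNIV. \<tau> * mkinv l / 2 * (Eq l i)\<^sup>2) \<longlonglongrightarrow> 0"
    proof (rule tendsto_sandwich[OF _ _ tendsto_const d]; intro always_eventually allI)
      show "0 \<le> (\<Sum>l\<in>UNIV. \<tau> * mkinv l / 2 * (Eq l i)\<^sup>2)" for i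
        using c1 by (intro sum_nonneg mult_nonneg_nonneg) (auto simp: less_imp_le)
      show "(\<Sum>l\<in>UNIV. \<tau> * mkinv l / 2 * (Eq l i)\<^sup>2) \<le> d i" for i
        unfolding d_def using c_pos by (intro sum_mono) (simp add: less_imp_le)
    qed
    then show "Eq l \<longlonglongrightarrow> 0" by (rule sum_square_tendsto_zero[rotated 3]) (use c1 in auto)
    have "(\<lambda>i. \<Sum>l\<in>UNIV. c l * (Ds l i)\<^sup>2) \<longlonglongrightarrow> 0"
    proof (rule tendsto_sandwich[OF _ _ tendsto_const d]; intro always_eventually allI)
      show "0 \<le> (\<Sum>l\<in>UNIV. c l * (Ds l i)\<^sup>2)" for i
        using c_pos by (intro sum_nonneg mult_nonneg_nonneg) (auto simp: less_imp_le)
      show "(\<Sum>l\<in>UNIV. c l * (Ds l i)\<^sup>2) \<le> d i" for i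
        unfolding d_def using less_imp_le[OF c1] by (intro sum_mono) simp
    qed
    then show "Ds l \<longlonglongrightarrow> 0" by (rule sum_square_tendsto_zero[rotated 3]) (use c_pos in auto)
  qed
  have "Ep l \<longlonglongrightarrow> 0" for l
  proof -
    interpret td: trace_domain "\<Omega>s l" ?\<Gamma> \<Omega> by (rule td)
    have "\<Gamma>D \<subseteq> frontier \<Omega>" using boundary_parts(1) closure_subset by blast
    note E = dirichlet_part[OF dirichlet[of l, folded dim_eq] this boundary_parts(2) op td.\<Gamma> null]
    \<comment> \<open>C depends on the subdomain but not on the iterate, so the vanishing saturation
      and flux errors force the pressure error to vanish.\<close>
    obtain C where C: "0 \<le> C" "\<And>f :: real ^ 'd \<Rightarrow> real. f \<in> L2_space (?\<mu> l) \<Longrightarrow>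
        \<exists>v\<in>flux_space (\<Omega>s l) ?\<Gamma> \<Gamma>N. (AE x in ?\<mu> l. weak_div (\<Omega>s l) v x = f x) \<and>
          (AE x in ?\<sigma>. normal_trace (\<Omega>s l) ?\<Gamma> v x = 0) \<and> L2_norm (?\<mu> l) v \<le> C * L2_norm (?\<mu> l) f"
      by (rule td.flux_with_divergence[OF subdomains(1) E]) (rule that)
    have bound: "Ep l (Suc i) \<le> C * (Lkinv l * Mq l * Ds l i + Mkinv l * Eq l i)" for i
    proof -
      interpret linearised_step "\<Omega>s l" ?\<Gamma> \<Omega> \<Gamma>N \<alpha> \<tau> "L l" "mkinv l" "Mkinv l" "Lkinv l" "LS l" "Mq l" "k l" "S l"
        "grad\<eta> l" "F l" "pprev l" "qn l" "pn l" "gn l" "q (Suc i) l" "p i l" "p (Suc i) l" "g (Suc i) l"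
        by (rule step)
      obtain v where v: "v \<in> flux_space (\<Omega>s l) ?\<Gamma> \<Gamma>N" "AE x in ?\<mu> l. weak_div (\<Omega>s l) v x = ep x"
        "AE x in ?\<sigma>. normal_trace (\<Omega>s l) ?\<Gamma> v x = 0" "L2_norm (?\<mu> l) v \<le> C * L2_norm (?\<mu> l) ep"
        using C(2)[OF error_L2(2)] by blast
      show ?thesis
        using pressure_estimate[OF v C(1)]
        unfolding eq_def[abs_def] dS_def[abs_def] ep_def[abs_def] Eq_def Ds_def Ep_def .
    qed
    have "(\<lambda>i. Ep l (Suc i)) \<longlonglongrightarrow> 0"
    proof (rule tendsto_sandwich[OF _ _ tendsto_const]; (intro always_eventually allI)?)
      show "0 \<le> Ep l (Suc i)" for i by (simp add: Ep_def)
      show "Ep l (Suc i) \<le> C * (Lkinv l * Mq l * Ds l i + Mkinv l * Eq l i)" for i by (rule bound)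
      have "(\<lambda>i. C * (Lkinv l * Mq l * Ds l i + Mkinv l * Eq l i)) \<longlonglongrightarrow> C * (Lkinv l * Mq l * 0 + Mkinv l * 0)"
        by (intro tendsto_intros Eq_lim Ds_lim)
      then show "(\<lambda>i. C * (Lkinv l * Mq l * Ds l i + Mkinv l * Eq l i)) \<longlonglongrightarrow> 0" by simp
    qed
    then show ?thesis by (simp add: filterlim_sequentially_Suc)
  qed
  then have "(\<lambda>i. sqrt (\<Sum>l\<in>UNIV. (Ep l i)\<^sup>2)) \<longlonglongrightarrow> sqrt (\<Sum>l\<in>(UNIV::2 set). 0\<^sup>2)"
    by (intro tendsto_real_sqrt tendsto_sum tendsto_power)
  then show ?thesis by (simp add: L2_norm_pair_def Ep_def)
qed

end
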